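(* Let $p(x)$ be a polynomial of degree $\ell$ that is non-negative and non-decreasing for $x\ge0$, and let $k\ge2$ be a fixed integer. Then, as $n\to\infty$, $$\mathbb{E}[p(C_{w_c,n,2k})]=\mathbb{E}[p(C_{\eta,n})]+\begin{cases}O\left(\dfrac{\log^{\ell}(n)}{n^{k-1}}\right)&\text{for even }k\ge2,\\[2mm] O\left(\dfrac{\log^{\ell}(n)}{n^{k-2}}\right)&\text{for odd }k\ge3,\end{cases}$$ and $$\mathbb{E}[p(C_{w_i,n,2k})]=\mathbb{E}[p(C_{\pi,n})]\quad\text{for } i=a,b.$$
   Context: $S_n$ and $A_n$ are the symmetric and alternating groups on $\{1,\dots,n\}$. Let $(\sigma_1,\dots,\sigma_k)$ be uniformly distributed on $S_n^k$. Put $w_c(\sigma_1,\dots,\sigma_k)=\sigma_1\cdots\sigma_k\sigma_1^{-1}\cdots\sigma_k^{-1}$, $w_a(\sigma_1,\dots,\sigma_k)=\sigma_1\sigma_2\cdots\sigma_k$, $w_b(\sigma_1,\dots,\sigma_k)=\sigma_1^{-1}\sigma_2^{-1}\cdots\sigma_k^{-1}$. For $i\in\{a,b,c\}$, $C_{w_i,n,2k}$ is the number of cycles of $w_i(\sigma_1,\dots,\sigma_k)$. $C_{\eta,n}$ is the number of cycles of a uniformly distributed $\eta\in A_n$, and $C_{\pi,n}$ the number of cycles of a uniformly distributed $\pi\in S_n$. Fixed points are counted as cycles of length 1. The implied constants may depend on $p$ and $k$. *)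

theory Defs
  imports
    "HOL-Probability.Probability"
    "HOL-Library.Landau_Symbols"
    "HOL-Combinatorics.Orbits"
    "HOL-Algebra.Sym_Groups"
begin

text \<open>
  For a permutation of \<open>{1..n}\<close> the cycles are the orbits on \<open>{1..n}\<close>. The orbit of a
  fixed point \<open>x\<close> is \<open>{x}\<close>, so fixed points count as cycles of length 1.
\<close>
definition num_cycles :: "nat \<Rightarrow> (nat \<Rightarrow> nat) \<Rightarrow> nat" where
  "num_cycles n \<pi> = card (Orbits.orbit \<pi> ` {1..n})"

text \<open>
  The tuple \<open>(\<sigma>\<^sub>1, \<dots>, \<sigma>\<^sub>k)\<close> is the list \<open>[\<sigma>\<^sub>1, \<dots>, \<sigma>\<^sub>k]\<close>. Products are taken
  in the group \<^term>\<open>sym_group n\<close>, whose multiplication is \<open>(\<circ>)\<close>; on its carrier \<^term>\<open>inv' \<sigma>\<close> is the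
  group inverse.
\<close>
definition sym_tuples :: "nat \<Rightarrow> nat \<Rightarrow> (nat \<Rightarrow> nat) list set" where
  "sym_tuples n k = {\<sigma>s. length \<sigma>s = k \<and> set \<sigma>s \<subseteq> carrier (sym_group n)}"

definition word_a :: "(nat \<Rightarrow> nat) list \<Rightarrow> nat \<Rightarrow> nat" where
  "word_a \<sigma>s = foldr (\<circ>) \<sigma>s id"

definition word_b :: "(nat \<Rightarrow> nat) list \<Rightarrow> nat \<Rightarrow> nat" where
  "word_b \<sigma>s = foldr (\<circ>) (map inv' \<sigma>s) id"

definition word_c :: "(nat \<Rightarrow> nat) list \<Rightarrow> nat \<Rightarrow> nat" where
  "word_c \<sigma>s = foldr (\<circ>) (\<sigma>s @ map inv' \<sigma>s) id"

definition expect_word ::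
    "((nat \<Rightarrow> nat) list \<Rightarrow> nat \<Rightarrow> nat) \<Rightarrow> real poly \<Rightarrow> nat \<Rightarrow> nat \<Rightarrow> real" where
  "expect_word w p n k =
     measure_pmf.expectation (pmf_of_set (sym_tuples n k))
       (\<lambda>\<sigma>s. poly p (real (num_cycles n (w \<sigma>s))))"

definition expect_sym :: "real poly \<Rightarrow> nat \<Rightarrow> real" where
  "expect_sym p n =
     measure_pmf.expectation (pmf_of_set (carrier (sym_group n)))
       (\<lambda>\<pi>. poly p (real (num_cycles n \<pi>)))"

definition expect_alt :: "real poly \<Rightarrow> nat \<Rightarrow> real" where
  "expect_alt p n =
     measure_pmf.expectation (pmf_of_set (carrier (alt_group n)))
       (\<lambda>\<eta>. poly p (real (num_cycles n \<eta>)))"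

text \<open>
  \<^const>\<open>pmf_of_set\<close> is the uniform distribution only on finite nonempty sets; the three
  sample spaces above qualify.
\<close>
lemma finite_sym_group_carrier: "finite (carrier (sym_group n))"
  by (simp add: sym_group_def finite_permutations)

lemma sym_group_carrier_nonempty: "carrier (sym_group n) \<noteq> {}"
proof -
  have "id \<in> carrier (sym_group n)"
    by (simp add: sym_group_carrier permutes_id)
  then show ?thesis by blast
qed

lemma finite_alt_group_carrier: "finite (carrier (alt_group n))"
  by (rule finite_subset[OF _ finite_sym_group_carrier[of n]])
     (auto simp: sym_group_def alt_group_def)

lemma alt_group_carrier_nonempty: "carrier (alt_group n) \<noteq> {}"
proof -
  have "id \<in> carrier (alt_group n)"
    by (simp add: alt_group_carrier permutes_id)
  then show ?thesis by blast
qed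

lemma finite_sym_tuples: "finite (sym_tuples n k)"
  unfolding sym_tuples_def
  using finite_lists_length_eq[OF finite_sym_group_carrier[of n], of k]
  by (simp add: conj_commute)

lemma sym_tuples_nonempty: "sym_tuples n k \<noteq> {}"
proof -
  have "replicate k id \<in> sym_tuples n k"
    by (auto simp: sym_tuples_def sym_group_def permutes_id)
  then show ?thesis by blast
qed

end

theory Submission
  imports Defs "HOL-Library.Poly_Mapping" "HOL-Analysis.Harmonic_Numbers"
begin

text \<open>
  The substitution \<open>x \<mapsto> X x\<close>, \<open>y \<mapsto> y X\<^sup>-\<^sup>1\<close> shows that the word \<open>w\<^sub>c\<close> has the law of a product of
  \<open>g = k div 2\<close> independent commutators. By Frobenius' formula the density of this law with respect to
  the uniform distribution is the sum over the irreducible characters \<open>\<chi>\<close> of \<open>\<chi> / \<chi>(1)\<^bsup>2g-1\<^esup>\<close>; the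
  trivial and the sign character contribute the uniform distribution on \<open>A\<^sub>n\<close>. By Cauchy--Schwarz the
  error is at most the \<open>L\<^sup>2\<close> norm of \<open>p(C)\<close>, which is \<open>O(log\<^sup>l n)\<close>, times the \<open>L\<^sup>2\<close> norm of the remaining
  density, whose square is the sum of \<open>\<chi>(1)\<^bsup>-2(2g-1)\<^esup>\<close> over the other characters. That sum is at most
  the \<open>(2g-1)\<close>-st power of the sum of \<open>\<chi>(1)\<^bsup>-2\<^esup>\<close>, which is \<open>O(n\<^bsup>-2\<^esup>)\<close>: by convexity of \<open>x \<mapsto> x\<^bsup>-2\<^esup>\<close>
  the branching rule makes it contract from one \<open>n\<close> to the next, up to the two terms of degree \<open>n - 1\<close>.

  Characters are replaced by the joint spectral projections of the Jucys--Murphy elements in the group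
  algebra, following Okounkov and Vershik: they exist by the recursion of Kerov's transition measures,
  and the identity \<open>\<Sum> f\<^sub>\<lambda>\<^sup>2 = n!\<close> for the numbers of standard tableaux makes them primitive.
\<close>


text \<open>Three statements have to pass through one induction. Scalar corners at level n turn a
  trace at level n + 1 into the transition measure of the enlarged diagram; the transition measure
  splits each idempotent into those of the larger tableaux; and the partial isometries between
  tableaux of equal shape, built from these idempotents, are numerous enough to force scalar corners
  at the next level. The trace form is positive definite, so vanishing, positivity and dimension are
  all decided by computing traces, and no representation space is constructed. Sums run over
  tableaux: a diagram occurs once per tableau, which is why powers such as 4g - 1 appear where
  characters give 4g - 2. The critical point of the contraction is a box that completes a rectangle,
  because a rectangle has a single diagram below it and convexity gains nothing there. The loss for
  odd k has a simple origin: one letter stays unpaired and cancels against its own inverse.\<close>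

section \<open>The group algebra of the finitary symmetric group\<close>

text \<open>Permutations are written additively because the multiplication of
  \<^typ>\<open>'a \<Rightarrow>\<^sub>0 'b\<close> is convolution over an additive monoid. All symmetric groups sit
  inside one group, so \<open>Sym m \<subseteq> Sym n\<close> and \<open>Alg m \<subseteq> Alg n\<close> hold literally for \<open>m \<le> n\<close>.\<close>
typedef fperm = "{f :: nat \<Rightarrow> nat. permutation f}"
  morphisms app Fperm
  by (rule exI[of _ id]) simp

setup_lifting type_definition_fperm

instantiation fperm :: group_add
begin
lift_definition zero_fperm :: fperm is id by simp
lift_definition plus_fperm :: "fperm \<Rightarrow> fperm \<Rightarrow> fperm" is "(\<circ>)"
  by (rule permutation_compose)
lift_definition uminus_fperm :: "fperm \<Rightarrow> fperm" is "Hilbert_Choice.inv"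
  by (rule permutation_inverse)
definition minus_fperm :: "fperm \<Rightarrow> fperm \<Rightarrow> fperm" where "minus_fperm g h = g + - h"
instance
proof
  show "- g + g = 0" for g :: fperm
    by transfer (metis inv_o_cancel permutation_bijective bij_is_inj)
qed (auto simp: minus_fperm_def, (transfer; simp add: o_assoc)+)
end

lift_definition tr :: "nat \<Rightarrow> nat \<Rightarrow> fperm" is "Transposition.transpose"
  by (rule permutation_swap_id)

lemma app_plus: "app (g + h) = app g \<circ> app h"
  by transfer simp

lemma app_zero: "app 0 = id"
  by transfer simp

lemma app_uminus: "app (- g) = Hilbert_Choice.inv (app g)"
  by transfer simp

lemma app_tr: "app (tr i j) = Transposition.transpose i j"
  by transfer simp

definition Sym :: "nat \<Rightarrow> fperm set" where
  "Sym n = {g. app g permutes {1..n}}"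

lemma bij_app_Sym: "bij_betw app (Sym n) {f. f permutes {1..n}}"
proof (rule bij_betwI[where g=Fperm])
  have "Fperm f \<in> Sym n" "app (Fperm f) = f" if "f permutes {1..n}" for f
  proof -
    have "permutation f" using that permutation_permutes by blast
    then show "app (Fperm f) = f" by (simp add: Fperm_inverse)
    then show "Fperm f \<in> Sym n" using that by (simp add: Sym_def)
  qed
  then show "Fperm \<in> {f. f permutes {1..n}} \<rightarrow> Sym n"
    "\<And>y. y \<in> {f. f permutes {1..n}} \<Longrightarrow> app (Fperm y) = y" by auto
qed (auto simp: Sym_def app_inverse)

lemma finite_Sym [simp]: "finite (Sym n)"
  using bij_betw_finite[OF bij_app_Sym] by (simp add: finite_permutations)

lemma card_Sym: "card (Sym n) = fact n"
  using bij_betw_same_card[OF bij_app_Sym, of n] by (simp add: card_permutations)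

lemma zero_in_Sym [simp]: "0 \<in> Sym n"
  by (simp add: Sym_def app_zero permutes_id)

lemma plus_in_Sym: "g \<in> Sym n \<Longrightarrow> h \<in> Sym n \<Longrightarrow> g + h \<in> Sym n"
  by (simp add: Sym_def app_plus permutes_compose)

lemma uminus_in_Sym_iff [simp]: "- g \<in> Sym n \<longleftrightarrow> g \<in> Sym n"
proof -
  have "g \<in> Sym n \<Longrightarrow> - g \<in> Sym n" for g
    by (simp add: Sym_def app_uminus permutes_inv)
  from this this[of "- g"] show ?thesis by auto
qed

lemma plus_in_Sym_iff1: "g \<in> Sym n \<Longrightarrow> g + h \<in> Sym n \<longleftrightarrow> h \<in> Sym n"
  using plus_in_Sym[of "-g" n "g + h"] plus_in_Sym[of g n h] by (auto simp flip: add.assoc)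

lemma Sym_mono: "m \<le> n \<Longrightarrow> Sym m \<subseteq> Sym n"
  unfolding Sym_def using permutes_subset[of _ "{1..m}" "{1..n}"] by auto

lemma tr_in_Sym: "i \<in> {1..n} \<Longrightarrow> j \<in> {1..n} \<Longrightarrow> tr i j \<in> Sym n"
  unfolding Sym_def by (auto simp: app_tr intro: permutes_swap_id)

lemma Sym_Suc_iff: "g \<in> Sym n \<longleftrightarrow> g \<in> Sym (Suc n) \<and> app g (Suc n) = Suc n"
proof
  show "g \<in> Sym n \<Longrightarrow> g \<in> Sym (Suc n) \<and> app g (Suc n) = Suc n"
    using Sym_mono[of n "Suc n"] by (auto simp: Sym_def permutes_not_in)
next
  assume a: "g \<in> Sym (Suc n) \<and> app g (Suc n) = Suc n"
  have "x = Suc n" if "x \<in> {1..Suc n} - {1..n}" for x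
    using that by auto
  then have "app g permutes {1..n}"
    using permutes_superset[of "app g" "{1..Suc n}" "{1..n}"] a unfolding Sym_def by blast
  then show "g \<in> Sym n" unfolding Sym_def by blast
qed

lemma tr_twice [simp]: "tr i j + tr i j = 0"
  by transfer simp

lemma uminus_tr [simp]: "- tr i j = tr i j"
  by (rule minus_unique) simp

lemma conj_tr: "g + tr i j = tr (app g i) (app g j) + g"
proof -
  have "app g \<circ> Transposition.transpose i j = Transposition.transpose (app g i) (app g j) \<circ> app g"
  proof
    fix x
    have "bij (app g)" using app[of g] by (simp add: permutation_bijective)
    then have "inj (app g)" by (rule bij_is_inj)
    then show "(app g \<circ> Transposition.transpose i j) x = (Transposition.transpose (app g i) (app g j) \<circ> app g) x"
      by (auto simp: Transposition.transpose_def inj_eq)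
  qed
  then show ?thesis by (metis app_plus app_tr app_inject)
qed

section \<open>The real group algebra and its chain of subalgebras\<close>

instantiation poly_mapping :: (type, real_vector) real_vector
begin
lift_definition scaleR_poly_mapping :: "real \<Rightarrow> ('a \<Rightarrow>\<^sub>0 'b) \<Rightarrow> ('a \<Rightarrow>\<^sub>0 'b)" is "\<lambda>r f x. r *\<^sub>R f x"
  by (rule finite_subset[rotated]) auto
instance
  by standard (transfer; simp add: scaleR_add_right scaleR_add_left fun_eq_iff)+
end

lemma lookup_scaleR [simp]: "Poly_Mapping.lookup (r *\<^sub>R M) g = r *\<^sub>R Poly_Mapping.lookup M g"
  by transfer simp

lemma poly_mapping_decompose:
  assumes "finite X" "Poly_Mapping.keys M \<subseteq> X"
  shows "M = (\<Sum>g\<in>X. Poly_Mapping.single g (Poly_Mapping.lookup M g))"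
proof (rule poly_mapping_eqI)
  fix g
  have "Poly_Mapping.lookup (\<Sum>g\<in>X. Poly_Mapping.single g (Poly_Mapping.lookup M g)) g
     = (\<Sum>h\<in>X. if h = g then Poly_Mapping.lookup M h else 0)"
    by (auto simp: lookup_sum lookup_single when_def intro!: sum.cong)
  also have "\<dots> = Poly_Mapping.lookup M g"
    using assms by (auto simp: in_keys_iff)
  finally show "Poly_Mapping.lookup M g = Poly_Mapping.lookup (\<Sum>g\<in>X. Poly_Mapping.single g (Poly_Mapping.lookup M g)) g" ..
qed

lemma scaleR_single: "r *\<^sub>R Poly_Mapping.single g c = Poly_Mapping.single g (r *\<^sub>R c)"
  by (rule poly_mapping_eqI) (simp add: lookup_single when_def)

instance poly_mapping :: (monoid_add, real_algebra_1) real_algebra_1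
proof
  fix r :: real and M N :: "'a \<Rightarrow>\<^sub>0 'b"
  let ?m = "\<lambda>g. Poly_Mapping.single g (Poly_Mapping.lookup M g)"
  let ?n = "\<lambda>g. Poly_Mapping.single g (Poly_Mapping.lookup N g)"
  have M: "M = sum ?m (Poly_Mapping.keys M)" by (rule poly_mapping_decompose) simp_all
  have N: "N = sum ?n (Poly_Mapping.keys N)" by (rule poly_mapping_decompose) simp_all
  have "r *\<^sub>R sum ?m (Poly_Mapping.keys M) * sum ?n (Poly_Mapping.keys N) = r *\<^sub>R (sum ?m (Poly_Mapping.keys M) * sum ?n (Poly_Mapping.keys N))"
    by (simp add: sum_product scaleR_sum_right scaleR_single mult_single)
  then show "r *\<^sub>R M * N = r *\<^sub>R (M * N)" using M N by argo
  have "sum ?m (Poly_Mapping.keys M) * r *\<^sub>R sum ?n (Poly_Mapping.keys N) = r *\<^sub>R (sum ?m (Poly_Mapping.keys M) * sum ?n (Poly_Mapping.keys N))"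
    by (simp add: sum_product scaleR_sum_right scaleR_single mult_single)
  then show "M * r *\<^sub>R N = r *\<^sub>R (M * N)" using M N by argo
qed

type_synonym galg = "fperm \<Rightarrow>\<^sub>0 real"

abbreviation co :: "galg \<Rightarrow> fperm \<Rightarrow> real" where
  "co \<equiv> Poly_Mapping.lookup"

definition de :: "fperm \<Rightarrow> galg" where
  "de g = Poly_Mapping.single g 1"

lemma de_0: "de 0 = 1"
  by (simp add: de_def)

lemma de_plus: "de (g + h) = de g * de h"
  by (simp add: de_def mult_single)

lemma co_de: "co (de g) h = (if g = h then 1 else 0)"
  by (simp add: de_def lookup_single when_def)

lemma galg_expand:
  assumes "finite X" "Poly_Mapping.keys M \<subseteq> X"
  shows "M = (\<Sum>g\<in>X. co M g *\<^sub>R de g)"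
  using poly_mapping_decompose[OF assms] by (simp add: de_def scaleR_single)

lemma galg_induct [case_names zero add scale de]:
  assumes "P 0" "\<And>M N. P M \<Longrightarrow> P N \<Longrightarrow> P (M + N)" "\<And>r M. P M \<Longrightarrow> P (r *\<^sub>R M)"
    and "\<And>g. g \<in> Poly_Mapping.keys M \<Longrightarrow> P (de g)"
  shows "P M"
proof -
  have *: "P (\<Sum>g\<in>X. co M g *\<^sub>R de g)" if "finite X" "X \<subseteq> Poly_Mapping.keys M" for X
    using that by (induction X rule: finite_induct) (auto intro: assms)
  show ?thesis
    using *[of "Poly_Mapping.keys M"] galg_expand[of "Poly_Mapping.keys M" M] by simp
qed

definition Alg :: "nat \<Rightarrow> galg set" where
  "Alg n = {M. Poly_Mapping.keys M \<subseteq> Sym n}"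

lemma Alg_iff: "M \<in> Alg n \<longleftrightarrow> (\<forall>g. g \<notin> Sym n \<longrightarrow> co M g = 0)"
  by (auto simp: Alg_def in_keys_iff)

lemma Alg_induct [consumes 1, case_names zero add scale de]:
  assumes "M \<in> Alg n" "P 0" "\<And>M N. P M \<Longrightarrow> P N \<Longrightarrow> P (M + N)" "\<And>r M. P M \<Longrightarrow> P (r *\<^sub>R M)"
    and "\<And>g. g \<in> Sym n \<Longrightarrow> P (de g)"
  shows "P M"
  using assms by (intro galg_induct[of P M]) (auto simp: Alg_def)

lemma Alg_expand: "M \<in> Alg n \<Longrightarrow> M = (\<Sum>g\<in>Sym n. co M g *\<^sub>R de g)"
  by (rule galg_expand) (auto simp: Alg_def)

lemma Alg_0 [simp]: "0 \<in> Alg n" and Alg_add: "M \<in> Alg n \<Longrightarrow> N \<in> Alg n \<Longrightarrow> M + N \<in> Alg n"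
  and Alg_scale: "M \<in> Alg n \<Longrightarrow> r *\<^sub>R M \<in> Alg n" and Alg_diff: "M \<in> Alg n \<Longrightarrow> N \<in> Alg n \<Longrightarrow> M - N \<in> Alg n"
  by (auto simp: Alg_iff lookup_add lookup_minus)

lemma Alg_de: "g \<in> Sym n \<Longrightarrow> de g \<in> Alg n"
  by (auto simp: Alg_iff co_de)

lemma Alg_1 [simp]: "1 \<in> Alg n"
  using Alg_de[of 0 n] by (simp add: de_0)

lemma Alg_of_real: "of_real r \<in> Alg n"
  by (simp add: of_real_def Alg_scale)

lemma Alg_mult: "M \<in> Alg n \<Longrightarrow> N \<in> Alg n \<Longrightarrow> M * N \<in> Alg n"
proof (induction M rule: Alg_induct)
  case (de g)
  from de(2) show ?case
    by (induction N rule: Alg_induct)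
      (use de(1) in \<open>auto simp: Alg_add Alg_scale algebra_simps Alg_de plus_in_Sym simp flip: de_plus\<close>)
qed (auto simp: Alg_add Alg_scale algebra_simps)

lemma Alg_sum: "(\<And>x. x \<in> X \<Longrightarrow> f x \<in> Alg n) \<Longrightarrow> sum f X \<in> Alg n"
  by (induction X rule: infinite_finite_induct) (auto simp: Alg_add)

lemma Alg_mono: "m \<le> n \<Longrightarrow> M \<in> Alg m \<Longrightarrow> M \<in> Alg n"
  using Sym_mono[of m n] by (auto simp: Alg_iff)

lemma co_de_mult: "co (de g * M) h = co M (- g + h)"
proof (induction M rule: galg_induct)
  case (de k)
  have "g + k = h \<longleftrightarrow> k = - g + h" by (auto simp: add.assoc[symmetric])
  then show ?case by (simp add: co_de flip: de_plus)
qed (auto simp: algebra_simps lookup_add)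

lemma co_mult_de: "co (M * de g) h = co M (h - g)"
proof (induction M rule: galg_induct)
  case (de k)
  have "k + g = h \<longleftrightarrow> k = h - g" by (auto simp: diff_conv_add_uminus add.assoc simp del: add_uminus_conv_diff)
  then show ?case by (simp add: co_de flip: de_plus)
qed (auto simp: algebra_simps lookup_add)

section \<open>The adjoint and the trace\<close>

lift_definition flip_keys :: "('a :: group_add \<Rightarrow>\<^sub>0 'b :: zero) \<Rightarrow> 'a \<Rightarrow>\<^sub>0 'b"
  is "\<lambda>f g. f (- g)"
proof -
  fix f :: "'a \<Rightarrow> 'b" assume "finite {g. f g \<noteq> 0}"
  then have "finite (uminus ` {g. f g \<noteq> 0})" by simp
  moreover have "uminus ` {g. f g \<noteq> 0} = {g. f (- g) \<noteq> 0}"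
    by (auto simp: image_iff) (metis minus_minus)
  ultimately show "finite {g. f (- g) \<noteq> 0}" by simp
qed

definition star :: "galg \<Rightarrow> galg" where
  "star = flip_keys"

lemma co_star [simp]: "co (star M) g = co M (- g)"
  unfolding star_def by transfer simp

lemma star_0 [simp]: "star 0 = 0" and star_star [simp]: "star (star M) = M"
  by (rule poly_mapping_eqI; simp)+

lemma star_add: "star (M + N) = star M + star N"
  and star_scale: "star (r *\<^sub>R M) = r *\<^sub>R star M"
  and star_diff: "star (M - N) = star M - star N"
  by (rule poly_mapping_eqI; simp add: lookup_add lookup_minus)+

lemma star_de: "star (de g) = de (- g)"
  by (rule poly_mapping_eqI) (auto simp: co_de)

lemma star_1 [simp]: "star 1 = 1"
  using star_de[of 0] by (simp add: de_0)

lemma star_mult: "star (M * N) = star N * star M"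
proof (induction M rule: galg_induct)
  case (de g)
  show ?case
    by (induction N rule: galg_induct)
      (auto simp: star_add star_scale algebra_simps star_de minus_add simp flip: de_plus)
qed (auto simp: star_add star_scale algebra_simps)

lemma star_sum: "star (sum f X) = (\<Sum>x\<in>X. star (f x))"
  by (induction X rule: infinite_finite_induct) (auto simp: star_add)

lemma star_of_real [simp]: "star (of_real r) = of_real r"
  by (simp add: of_real_def star_scale)

lemma star_in_Alg: "star M \<in> Alg n \<longleftrightarrow> M \<in> Alg n"
  by (auto simp: Alg_iff) (metis minus_minus uminus_in_Sym_iff)

text \<open>On \<open>Alg n\<close> this is the trace of the regular representation divided by n!.
  Together with \<open>star\<close> it gives the inner product in which group elements are
  orthonormal; being independent of n, it serves all levels at once.\<close>

definition tau :: "galg \<Rightarrow> real" where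
  "tau M = co M 0"

lemma tau_0 [simp]: "tau 0 = 0" and tau_add: "tau (M + N) = tau M + tau N"
  and tau_scale: "tau (r *\<^sub>R M) = r * tau M" and tau_diff: "tau (M - N) = tau M - tau N"
  and tau_star: "tau (star M) = tau M"
  and tau_1 [simp]: "tau 1 = 1"
  by (auto simp: tau_def lookup_add lookup_minus)

lemma tau_sum: "tau (sum f X) = (\<Sum>x\<in>X. tau (f x))"
  by (simp add: tau_def lookup_sum)

lemma tau_mult_de: "tau (M * de g) = co M (- g)"
  by (simp add: tau_def co_mult_de)

lemma tau_de_mult: "tau (de g * M) = co M (- g)"
  by (simp add: tau_def co_de_mult)

lemma tau_commute: "tau (M * N) = tau (N * M)"
  by (induction N rule: galg_induct)
    (auto simp: tau_add tau_scale algebra_simps tau_mult_de tau_de_mult)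

lemma tau_star_mult:
  assumes "M \<in> Alg n"
  shows "tau (star M * N) = (\<Sum>g\<in>Sym n. co M g * co N g)"
proof -
  have "tau (star M * N) = tau (\<Sum>g\<in>Sym n. co M g *\<^sub>R (de (- g) * N))"
    by (subst Alg_expand[OF assms]) (simp add: star_sum star_scale star_de sum_distrib_right)
  then show ?thesis by (simp add: tau_sum tau_scale tau_de_mult)
qed

lemma tau_star_self: "M \<in> Alg n \<Longrightarrow> tau (star M * M) = (\<Sum>g\<in>Sym n. (co M g)\<^sup>2)"
  by (simp add: tau_star_mult power2_eq_square)

text \<open>Such a trace is a sum of squares of coefficients. Through this faithfulness, computed
  traces become identities in the algebra.\<close>

lemma tau_star_self_eq_0:
  assumes "M \<in> Alg n" "tau (star M * M) = 0"
  shows "M = 0"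
proof (rule poly_mapping_eqI)
  fix g
  have "\<forall>g\<in>Sym n. (co M g)\<^sup>2 = 0"
    using assms by (subst (asm) tau_star_self[OF assms(1)]) (simp add: sum_nonneg_eq_0_iff)
  then show "co M g = co 0 g" using assms(1) by (cases "g \<in> Sym n") (auto simp: Alg_iff)
qed

section \<open>Real polynomials evaluated in a noncommutative algebra\<close>

definition peval :: "real poly \<Rightarrow> 'a \<Rightarrow> 'a :: real_algebra_1" where
  "peval q X = fold_coeffs (\<lambda>a r. of_real a + X * r) q 0"

lemma peval_0 [simp]: "peval 0 X = 0"
  by (simp add: peval_def)

lemma peval_pCons: "peval (pCons a q) X = of_real a + X * peval q X"
  by (cases "a = 0 \<and> q = 0") (auto simp: peval_def)

lemma peval_1 [simp]: "peval 1 X = 1"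
  by (simp add: one_pCons peval_pCons)

lemma peval_add: "peval (p + q) X = peval p X + peval q X"
  by (induction p q rule: poly_induct2) (auto simp: peval_pCons algebra_simps)

lemma peval_smult: "peval (smult c q) X = c *\<^sub>R peval q X"
  by (induction q) (auto simp: peval_pCons algebra_simps of_real_def)

lemma peval_sum: "peval (sum f I) X = (\<Sum>i\<in>I. peval (f i) X)"
  by (induction I rule: infinite_finite_induct) (auto simp: peval_add)

text \<open>Real coefficients are central, so the relation passes through Horner's scheme. With
  \<open>X = Y\<close> it says that commuting with \<open>X\<close> implies commuting with
  polynomials in \<open>X\<close>.\<close>

lemma peval_intertwine:
  assumes "F * X = Y * F"
  shows "F * peval q X = peval q Y * F"
proof (induction q)
  case (pCons a q)
  have "F * peval (pCons a q) X = of_real a * F + (F * X) * peval q X"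
    by (simp add: peval_pCons algebra_simps of_real_def)
  also have "\<dots> = of_real a * F + Y * (peval q Y * F)"
    by (simp add: assms mult.assoc flip: pCons(2))
  finally show ?case by (simp add: peval_pCons algebra_simps)
qed auto

lemma peval_mult: "peval (p * q) X = peval p X * peval q X"
  by (induction p)
    (auto simp: peval_pCons peval_add peval_smult algebra_simps of_real_def)

lemma peval_eigen:
  assumes "e * X = x *\<^sub>R e"
  shows "e * peval q X = poly q x *\<^sub>R e"
proof (induction q)
  case (pCons a q)
  have "e * peval (pCons a q) X = a *\<^sub>R e + (e * X) * peval q X"
    by (simp add: peval_pCons algebra_simps of_real_def)
  also have "\<dots> = a *\<^sub>R e + x *\<^sub>R (poly q x *\<^sub>R e)"
    by (simp only: assms scaleR_left_distrib mult_scaleR_left pCons(2))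
  finally show ?case by (simp add: algebra_simps)
qed auto

lemma peval_in_Alg: "X \<in> Alg n \<Longrightarrow> peval q X \<in> Alg n"
  by (induction q) (auto simp: peval_pCons Alg_add Alg_mult Alg_of_real)

lemma star_peval: "star X = X \<Longrightarrow> star (peval q X) = peval q X"
proof (induction q)
  case (pCons a q)
  then show ?case
    using peval_intertwine[of X X X q]
    by (simp add: peval_pCons star_add star_mult)
qed auto

text \<open>The Jucys--Murphy elements.\<close>
definition JM :: "nat \<Rightarrow> galg" where
  "JM n = (\<Sum>i\<in>{1..<n}. de (tr i n))"

lemma JM_Suc: "JM (Suc n) = (\<Sum>i\<in>{1..n}. de (tr i (Suc n)))"
  unfolding JM_def by (rule sum.cong) auto

lemma JM_in_Alg: "JM n \<in> Alg n"
  unfolding JM_def by (intro Alg_sum Alg_de tr_in_Sym) auto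

lemma star_JM: "star (JM n) = JM n"
  by (simp add: JM_def star_sum star_de)

text \<open>Conjugation by an element of \<open>Sym n\<close> fixes \<open>Suc n\<close> and
  permutes the other points, hence permutes the transpositions in the sum.\<close>

lemma JM_commutes_Alg:
  assumes "M \<in> Alg n"
  shows "M * JM (Suc n) = JM (Suc n) * M"
  using assms
proof (induction M rule: Alg_induct)
  case (de g)
  have p: "app g permutes {1..n}" using de by (simp add: Sym_def)
  have "de g * JM (Suc n) = (\<Sum>i\<in>{1..n}. de (tr (app g i) (Suc n)) * de g)"
    using p by (auto simp: JM_Suc sum_distrib_left conj_tr permutes_not_in
        simp flip: de_plus intro!: sum.cong)
  also have "\<dots> = (\<Sum>i\<in>{1..n}. de (tr i (Suc n)) * de g)"
    using p by (rule sum.reindex_bij_betw[OF permutes_imp_bij])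
  finally show ?case by (simp add: JM_Suc sum_distrib_right)
qed (auto simp: algebra_simps)

lemma JM_commute: "JM m * JM n = JM n * JM m"
proof -
  have *: "JM m * JM n = JM n * JM m" if less: "m < n" for m n
  proof -
    obtain k where k: "n = Suc k" "m \<le> k" using less by (cases n) auto
    show ?thesis using JM_commutes_Alg[of "JM m" k] Alg_mono[OF k(2) JM_in_Alg] k(1) by simp
  qed
  show ?thesis using *[of m n] *[of n m] by (cases m n rule: linorder_cases) auto
qed

text \<open>Each transposition in \<open>JM (Suc n)\<close> moves \<open>Suc n\<close>, so its
  inverse is not in \<open>Sym n\<close>. This supplies the mean zero of the spectral
  measures.\<close>

lemma tau_JM: "M \<in> Alg n \<Longrightarrow> tau (M * JM (Suc n)) = 0"
proof -
  assume M: "M \<in> Alg n"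
  have "tr i (Suc n) \<notin> Sym n" if "i \<in> {1..n}" for i
    using that by (auto simp: Sym_Suc_iff[of _ n] app_tr)
  then show ?thesis using M
    by (auto simp: JM_Suc sum_distrib_left tau_sum tau_mult_de Alg_iff intro!: sum.neutral)
qed

section \<open>Simple transpositions and the conditional expectation\<close>

definition sw :: "nat \<Rightarrow> galg" where
  "sw n = de (tr (Suc n) (Suc (Suc n)))"

lemma sw_in_Alg: "sw n \<in> Alg (Suc (Suc n))"
  unfolding sw_def by (intro Alg_de tr_in_Sym) auto

lemma sw_sw: "sw n * sw n = 1" "sw n * (sw n * M) = M"
  by (simp_all add: sw_def de_0 flip: de_plus mult.assoc)

lemma star_sw [simp]: "star (sw n) = sw n"
  by (simp add: sw_def star_de)

lemma sw_commutes_Alg: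
  assumes "M \<in> Alg n"
  shows "M * sw n = sw n * M"
  using assms
proof (induction M rule: Alg_induct)
  case (de g)
  have p: "app g permutes {1..n}" using de by (simp add: Sym_def)
  show ?case
    using p by (auto simp: sw_def conj_tr permutes_not_in simp flip: de_plus)
qed (auto simp: algebra_simps)

text \<open>Conjugation carries each transposition ending in n + 2 to the one ending in n + 1,
  except the summand \<open>sw n\<close> itself, which produces the 1. This is the relation of the
  degenerate affine Hecke algebra.\<close>

lemma sw_JM: "sw n * JM (Suc (Suc n)) = JM (Suc n) * sw n + 1"
proof -
  have "sw n * de (tr i (Suc (Suc n))) = de (tr i (Suc n)) * sw n" if "i \<in> {1..n}" for i
    using that conj_tr[of "tr (Suc n) (Suc (Suc n))" i "Suc (Suc n)"]
    by (auto simp: sw_def app_tr simp flip: de_plus)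
  moreover have "JM (Suc (Suc n)) = (\<Sum>i\<in>{1..n}. de (tr i (Suc (Suc n)))) + sw n"
    by (simp add: JM_Suc sw_def)
  ultimately show ?thesis
    by (simp add: distrib_left sw_sw sum_distrib_left sum_distrib_right JM_Suc)
qed

lemma JM_sw: "JM (Suc (Suc n)) * sw n = sw n * JM (Suc n) + 1"
  using arg_cong[OF sw_JM[of n], of star] by (simp add: star_mult star_add star_JM)

lift_definition restrict_keys :: "'a set \<Rightarrow> ('a \<Rightarrow>\<^sub>0 'b :: zero) \<Rightarrow> 'a \<Rightarrow>\<^sub>0 'b"
  is "\<lambda>X f g. if g \<in> X then f g else 0"
  by (rule finite_subset[rotated]) auto

text \<open>The orthogonal projection onto \<open>Alg n\<close>, in other words the trace-preserving
  conditional expectation.\<close>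

definition Eres :: "nat \<Rightarrow> galg \<Rightarrow> galg" where
  "Eres n = restrict_keys (Sym n)"

lemma co_Eres: "co (Eres n M) g = (if g \<in> Sym n then co M g else 0)"
  unfolding Eres_def by transfer simp

lemma Eres_0 [simp]: "Eres n 0 = 0"
  and Eres_add: "Eres n (M + N) = Eres n M + Eres n N"
  and Eres_scale: "Eres n (r *\<^sub>R M) = r *\<^sub>R Eres n M"
  by (rule poly_mapping_eqI; simp add: co_Eres lookup_add)+

lemma Eres_in_Alg: "Eres n M \<in> Alg n"
  by (simp add: Alg_iff co_Eres)

lemma Eres_de: "Eres n (de g) = (if g \<in> Sym n then de g else 0)"
  by (rule poly_mapping_eqI) (auto simp: co_Eres co_de)

lemma tau_Eres: "tau (Eres n M) = tau M"
  by (simp add: tau_def co_Eres)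

lemma Eres_mult_left: "M \<in> Alg n \<Longrightarrow> Eres n (M * N) = M * Eres n N"
proof (induction M rule: Alg_induct)
  case (de g)
  show ?case
    by (induction N rule: galg_induct)
      (use de in \<open>auto simp: Eres_add Eres_scale algebra_simps Eres_de plus_in_Sym_iff1 simp flip: de_plus\<close>)
qed (auto simp: Eres_add Eres_scale algebra_simps)

text \<open>A group element fixing \<open>Suc n\<close> commutes with \<open>sw n\<close> and
  survives on both sides; any other has a conjugate that moves \<open>Suc (Suc n)\<close>, and both
  sides drop it.\<close>

lemma Eres_sw:
  assumes "N \<in> Alg (Suc n)"
  shows "Eres (Suc n) (sw n * N * sw n) = Eres n N"
  using assms
proof (induction N rule: Alg_induct)
  case (de g)
  show ?case
  proof (cases "g \<in> Sym n")
    case True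
    then have "sw n * de g * sw n = de g"
      using sw_commutes_Alg[OF Alg_de[OF True]] by (simp add: mult.assoc sw_sw)
    then show ?thesis using True Sym_mono[of n "Suc n"] by (auto simp: Eres_de)
  next
    case False
    let ?t = "tr (Suc n) (Suc (Suc n))"
    have "app g (Suc n) \<in> {1..Suc n}"
      using de permutes_in_image[of "app g" "{1..Suc n}" "Suc n"] unfolding Sym_def by simp
    moreover have "app g (Suc n) \<noteq> Suc n" using False de by (simp add: Sym_Suc_iff[of g n])
    ultimately have "app (?t + g + ?t) (Suc (Suc n)) \<noteq> Suc (Suc n)"
      by (auto simp: app_plus app_tr Transposition.transpose_def)
    then have "?t + g + ?t \<notin> Sym (Suc n)" by (simp add: Sym_Suc_iff[of _ "Suc n"])
    then show ?thesis using False by (simp add: Eres_de sw_def flip: de_plus)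
  qed
qed (auto simp: Eres_add Eres_scale algebra_simps)

lemma tau_conj_sw:
  assumes "e \<in> Alg (Suc n)" "N \<in> Alg (Suc n)"
  shows "tau (e * (sw n * N * sw n)) = tau (e * Eres n N)"
  by (metis Eres_mult_left Eres_sw assms tau_Eres)


section \<open>Young diagrams as Maya diagrams\<close>

text \<open>A Young diagram is encoded by the set of positions of the up-steps of its rim, a set of
  integers agreeing with \<open>{0..}\<close> far away. Adding a box of content \<open>x\<close> moves the particle at \<open>x\<close>
  to \<open>x - 1\<close>; a standard tableau is the list of the contents of its boxes, last box first.\<close>
definition addable :: "int set \<Rightarrow> int set" where
  "addable M = {x \<in> M. x - 1 \<notin> M}"

definition removable :: "int set \<Rightarrow> int set" where
  "removable M = {x. x \<notin> M \<and> x - 1 \<in> M}"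

definition hop :: "int set \<Rightarrow> int \<Rightarrow> int set" where
  "hop M x = insert (x - 1) (M - {x})"

definition unhop :: "int set \<Rightarrow> int \<Rightarrow> int set" where
  "unhop M x = insert x (M - {x - 1})"

fun shape :: "int list \<Rightarrow> int set" where
  "shape [] = {0..}"
| "shape (x # a) = hop (shape a) x"

fun syt :: "nat \<Rightarrow> int list set" where
  "syt 0 = {[]}"
| "syt (Suc n) = (\<Union>a\<in>syt n. (\<lambda>x. x # a) ` addable (shape a))"

lemma Cons_in_syt [simp]: "x # a \<in> syt (Suc n) \<longleftrightarrow> a \<in> syt n \<and> x \<in> addable (shape a)"
  by auto

lemma syt_SucE:
  assumes "b \<in> syt (Suc n)"
  obtains x a where "b = x # a" "a \<in> syt n" "x \<in> addable (shape a)"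
  using assms by auto

declare syt.simps(2) [simp del]

lemma length_syt: "a \<in> syt n \<Longrightarrow> length a = n"
  by (induction n arbitrary: a) (auto elim: syt_SucE)

lemma unhop_hop: "x \<in> addable M \<Longrightarrow> unhop (hop M x) x = M"
  and hop_unhop: "x \<in> removable M \<Longrightarrow> hop (unhop M x) x = M"
  and removable_hop: "x \<in> addable M \<Longrightarrow> x \<in> removable (hop M x)"
  and addable_unhop: "x \<in> removable M \<Longrightarrow> x \<in> addable (unhop M x)"
  by (auto simp: unhop_def hop_def addable_def removable_def)

lemma shape_bounds:
  assumes "a \<in> syt n"
  shows "{int n..} \<subseteq> shape a \<and> shape a \<subseteq> {- int n..}"
  using assms
proof (induction n arbitrary: a)
  case (Suc n)
  then obtain x b where a: "a = x # b" "b \<in> syt n" "x \<in> addable (shape b)"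
    by (auto elim: syt_SucE)
  have b: "{int n..} \<subseteq> shape b" "shape b \<subseteq> {- int n..}" using Suc(1)[OF a(2)] by auto
  have "x \<in> shape b" "x - 1 \<notin> shape b" using a(3) by (auto simp: addable_def)
  then have "x \<in> {- int n..}" "x - 1 \<notin> {int n..}" using b by blast+
  then have x: "- int n \<le> x" "x \<le> int n" by auto
  have "{int (Suc n)..} \<subseteq> hop (shape b) x"
    using b(1) x by (auto simp: hop_def subset_iff)
  moreover have "hop (shape b) x \<subseteq> {- int (Suc n)..}"
    using b(2) x by (force simp: hop_def)
  ultimately have "{int (Suc n)..} \<subseteq> hop (shape b) x \<and> hop (shape b) x \<subseteq> {- int (Suc n)..}" ..
  then show ?case by (simp add: a)
qed auto

lemma addable_subset:
  assumes "a \<in> syt n"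
  shows "addable (shape a) \<subseteq> {- int n..int n}"
proof
  fix x assume "x \<in> addable (shape a)"
  then have "x \<in> shape a" "x - 1 \<notin> shape a" by (auto simp: addable_def)
  then have "x \<in> {- int n..}" "x - 1 \<notin> {int n..}" using shape_bounds[OF assms] by blast+
  then show "x \<in> {- int n..int n}" by simp
qed

lemma removable_subset:
  assumes "a \<in> syt n"
  shows "removable (shape a) \<subseteq> {- int n..int n}"
proof
  fix x assume "x \<in> removable (shape a)"
  then have "x \<notin> shape a" "x - 1 \<in> shape a" by (auto simp: removable_def)
  then have "x - 1 \<in> {- int n..}" "x \<notin> {int n..}" using shape_bounds[OF assms] by blast+
  then show "x \<in> {- int n..int n}" by simp
qed

lemma finite_addable [simp]: "a \<in> syt n \<Longrightarrow> finite (addable (shape a))"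
  by (rule finite_subset[OF addable_subset]) simp_all

lemma finite_removable [simp]: "a \<in> syt n \<Longrightarrow> finite (removable (shape a))"
  by (rule finite_subset[OF removable_subset]) simp_all

lemma finite_syt [simp]: "finite (syt n)"
  by (induction n) (auto simp: syt.simps(2))

section \<open>Balance of addable and removable contents\<close>

definition dcon :: "int set \<Rightarrow> int \<Rightarrow> int" where
  "dcon M c = of_bool (c \<in> M) - of_bool (c - 1 \<in> M)"

lemma dcon_eq: "dcon M c = of_bool (c \<in> addable M) - of_bool (c \<in> removable M)"
  by (auto simp: dcon_def addable_def removable_def)

text \<open>A new box at x changes the signed corner density by a discrete second difference, so
  total mass and first moment are the same for all diagrams.\<close>

lemma dcon_hop:
  "x \<in> addable M \<Longrightarrow> dcon (hop M x) c
     = dcon M c + of_bool (c = x + 1) + of_bool (c = x - 1) - 2 * of_bool (c = x)"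
  by (auto simp: dcon_def addable_def hop_def)

text \<open>The window is given by a fixed N so that all steps of the induction sum over the same
  set; \<open>n \<le> N\<close> keeps both neighbours of each added content inside it.\<close>

lemma sum_dcon:
  assumes "a \<in> syt n" "n \<le> N"
  shows "(\<Sum>c\<in>{- int N..int N}. dcon (shape a) c) = 1
    \<and> (\<Sum>c\<in>{- int N..int N}. c * dcon (shape a) c) = 0"
  using assms
proof (induction n arbitrary: a)
  case 0
  have d: "dcon {0..} c = (if c = 0 then 1 else 0)" for c by (auto simp: dcon_def)
  have "(\<Sum>c\<in>{- int N..int N}. c * (if c = 0 then 1 else 0)) = 0"
    by (rule sum.neutral) auto
  then show ?case using 0 by (simp add: d)
next
  case (Suc n)
  then obtain x b where a: "a = x # b" "b \<in> syt n" "x \<in> addable (shape b)"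
    by (auto elim: syt_SucE)
  let ?I = "{- int N..int N}"
  have x: "x \<in> ?I" "x + 1 \<in> ?I" "x - 1 \<in> ?I"
    using addable_subset[OF a(2)] a(3) \<open>Suc n \<le> N\<close> by (auto simp: subset_iff)
  have IH: "(\<Sum>c\<in>?I. dcon (shape b) c) = 1" "(\<Sum>c\<in>?I. c * dcon (shape b) c) = 0"
    using Suc(1)[OF a(2)] Suc(3) by auto
  have *: "f c * dcon (shape a) c = f c * dcon (shape b) c + (if c = x + 1 then f c else 0)
      + (if c = x - 1 then f c else 0) - 2 * (if c = x then f c else 0)" for f :: "int \<Rightarrow> int" and c
    by (simp add: a dcon_hop[OF a(3)] algebra_simps)
  have **: "(\<Sum>c\<in>?I. f c * dcon (shape a) c)
      = (\<Sum>c\<in>?I. f c * dcon (shape b) c) + f (x + 1) + f (x - 1) - 2 * f x" for f :: "int \<Rightarrow> int"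
    unfolding * sum_subtractf sum.distrib sum_distrib_left[symmetric] using x by simp
  show ?case using **[of "\<lambda>_. 1"] **[of "\<lambda>c. c"] IH by simp
qed

lemma sum_addable_minus_removable:
  assumes "a \<in> syt n"
  shows "(\<Sum>c\<in>addable (shape a). f c) - (\<Sum>c\<in>removable (shape a). f c)
    = (\<Sum>c\<in>{- int n..int n}. f c * dcon (shape a) c)"
proof -
  let ?I = "{- int n..int n}"
  have "(\<Sum>c\<in>addable (shape a). f c) = (\<Sum>c\<in>?I. if c \<in> addable (shape a) then f c else 0)"
    using addable_subset[OF assms] by (intro sum.mono_neutral_cong_left) auto
  moreover have "(\<Sum>c\<in>removable (shape a). f c) = (\<Sum>c\<in>?I. if c \<in> removable (shape a) then f c else 0)"
    using removable_subset[OF assms] by (intro sum.mono_neutral_cong_left) auto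
  ultimately show ?thesis
    by (simp add: sum_subtractf[symmetric] dcon_eq) (rule sum.cong; auto)
qed

lemma card_addable: "a \<in> syt n \<Longrightarrow> card (addable (shape a)) = Suc (card (removable (shape a)))"
  using sum_addable_minus_removable[of a n "\<lambda>_. 1"] sum_dcon[of a n n] by simp

lemma sum_addable_eq_sum_removable:
  "a \<in> syt n \<Longrightarrow> \<Sum>(addable (shape a)) = \<Sum>(removable (shape a))"
  using sum_addable_minus_removable[of a n "\<lambda>c. c"] sum_dcon[of a n n] by simp

lemma addable_nonempty: "a \<in> syt n \<Longrightarrow> addable (shape a) \<noteq> {}"
  using card_addable[of a n] by auto

section \<open>Divided differences\<close>

lemma divided_difference_linear_factor:
  fixes X :: "real set"
  assumes "finite X" "x0 \<in> X"
  shows "(\<Sum>x\<in>X. (x - x0) * f x / (\<Prod>z\<in>X-{x}. x - z))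
    = (\<Sum>x\<in>X-{x0}. f x / (\<Prod>z\<in>X-{x0}-{x}. x - z))"
proof -
  have "(x - x0) * f x / (\<Prod>z\<in>X-{x}. x - z) = f x / (\<Prod>z\<in>X-{x0}-{x}. x - z)"
    if "x \<in> X - {x0}" for x
  proof -
    have "(\<Prod>z\<in>X-{x}. x - z) = (x - x0) * (\<Prod>z\<in>X-{x}-{x0}. x - z)"
      using assms that by (intro prod.remove) auto
    moreover have "X-{x}-{x0} = X-{x0}-{x}" by auto
    ultimately show ?thesis using that by simp
  qed
  then show ?thesis using assms by (simp add: sum.remove[of X x0])
qed

text \<open>The constant x0 - x1 is (x - x1) - (x - x0), and each of these factors deletes one node.
  The two reduced sums agree because their value depends only on the number of nodes.\<close>

lemma divided_difference_one:
  fixes X :: "real set"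
  assumes "finite X" "2 \<le> card X"
  shows "(\<Sum>x\<in>X. 1 / (\<Prod>z\<in>X-{x}. x - z)) = 0"
  using assms
proof (induction "card X" arbitrary: X rule: less_induct)
  case less
  have c: "(\<Sum>x\<in>Y. 1 / (\<Prod>z\<in>Y-{x}. x - z)) = (if card Y = 1 then 1 else 0)"
    if "finite Y" "card Y < card X" "Y \<noteq> {}" for Y :: "real set"
  proof (cases "card Y = 1")
    case True
    then obtain y where y: "Y = {y}" by (rule card_1_singletonE)
    show ?thesis unfolding y by simp
  next
    case False
    then have "2 \<le> card Y" using that by (metis One_nat_def card_gt_0_iff Suc_leI le_neq_implies_less numeral_2_eq_2)
    then show ?thesis using less(1)[OF that(2,1)] False by simp
  qed
  obtain x0 where x0: "x0 \<in> X" using less by fastforce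
  have "card (X - {x0}) \<noteq> 0" using less x0 by simp
  then obtain x1 where x1: "x1 \<in> X" "x1 \<noteq> x0" by (metis DiffE all_not_in_conv card.empty singletonI)
  have ne: "X - {x1} \<noteq> {}" "X - {x0} \<noteq> {}" using x0 x1 by auto
  have e: "(\<Sum>x\<in>X. (x - y) * 1 / (\<Prod>z\<in>X-{x}. x - z)) = (if card X - 1 = 1 then 1 else 0)"
    if "y \<in> X" "X - {y} \<noteq> {}" for y
    using divided_difference_linear_factor[OF less(2) that(1), of "\<lambda>_. 1"] c[of "X - {y}"] less that
    by simp
  have "(x0 - x1) * (\<Sum>x\<in>X. 1 / (\<Prod>z\<in>X-{x}. x - z))
     = (\<Sum>x\<in>X. (x - x1) * 1 / (\<Prod>z\<in>X-{x}. x - z)) - (\<Sum>x\<in>X. (x - x0) * 1 / (\<Prod>z\<in>X-{x}. x - z))"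
    by (simp add: sum_distrib_left sum_subtractf[symmetric] diff_divide_distrib)
  also have "\<dots> = 0"
    using e[OF x0 ne(2)] e[OF x1(1) ne(1)] by simp
  finally show ?case using x1 by simp
qed

text \<open>These are divided differences, over the nodes X, of the monic polynomial with root set
  Y: below degree |X| - 1 they vanish, in that degree they give the leading coefficient, one degree
  higher the difference of the sums. A root is peeled off by x - y0 = (x - x0) + (x0 - y0).\<close>

lemma divided_difference_prod:
  fixes X Y :: "real set"
  assumes "finite Y" "finite X"
  shows "card Y + 1 < card X \<Longrightarrow> (\<Sum>x\<in>X. (\<Prod>y\<in>Y. x - y) / (\<Prod>z\<in>X-{x}. x - z)) = 0"
    and "card Y + 1 = card X \<Longrightarrow> (\<Sum>x\<in>X. (\<Prod>y\<in>Y. x - y) / (\<Prod>z\<in>X-{x}. x - z)) = 1"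
    and "card Y = card X \<Longrightarrow> (\<Sum>x\<in>X. (\<Prod>y\<in>Y. x - y) / (\<Prod>z\<in>X-{x}. x - z)) = \<Sum>X - \<Sum>Y"
  using assms
proof (induction Y arbitrary: X rule: finite_induct)
  case empty
  {
    case 1
    then show ?case using divided_difference_one[of X] by simp
  next
    case 2
    then have "card X = 1" by simp
    then obtain y where y: "X = {y}" by (rule card_1_singletonE)
    show ?case unfolding y by simp
  next
    case 3
    then show ?case by simp
  }
next
  case (insert y0 Y)
  have rec: "(\<Sum>x\<in>X. (\<Prod>y\<in>insert y0 Y. x - y) / (\<Prod>z\<in>X-{x}. x - z))
     = (\<Sum>x\<in>X-{x0}. (\<Prod>y\<in>Y. x - y) / (\<Prod>z\<in>X-{x0}-{x}. x - z))
      + (x0 - y0) * (\<Sum>x\<in>X. (\<Prod>y\<in>Y. x - y) / (\<Prod>z\<in>X-{x}. x - z))"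
    if "finite X" "x0 \<in> X" for x0 and X :: "real set"
  proof -
    have "(\<Sum>x\<in>X. (\<Prod>y\<in>insert y0 Y. x - y) / (\<Prod>z\<in>X-{x}. x - z))
       = (\<Sum>x\<in>X. (x - x0) * (\<Prod>y\<in>Y. x - y) / (\<Prod>z\<in>X-{x}. x - z))
        + (x0 - y0) * (\<Sum>x\<in>X. (\<Prod>y\<in>Y. x - y) / (\<Prod>z\<in>X-{x}. x - z))"
      using insert by (simp add: sum_distrib_left sum.distrib[symmetric] add_divide_distrib[symmetric])
        (rule sum.cong; simp add: algebra_simps)
    then show ?thesis using divided_difference_linear_factor[OF that] by simp
  qed
  {
    case 1
    then obtain x0 where "x0 \<in> X" by fastforce
    with 1 insert show ?case by (simp only: rec) simp
  next
    case 2
    then obtain x0 where "x0 \<in> X" by fastforce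
    with 2 insert show ?case by (simp only: rec) simp
  next
    case 3
    then have "X \<noteq> {}" using insert.hyps by auto
    then obtain x0 where x0: "x0 \<in> X" by auto
    have c: "card Y = card (X - {x0})" "card Y + 1 = card X" using 3 insert.hyps x0 by auto
    have "\<Sum>X = x0 + \<Sum>(X - {x0})" by (rule sum.remove[OF \<open>finite X\<close> x0])
    moreover have "\<Sum>(insert y0 Y) = y0 + \<Sum>Y" using insert.hyps by simp
    ultimately show ?case
      using rec[OF \<open>finite X\<close> x0] insert.IH(3)[OF c(1)] insert.IH(2)[OF c(2)] \<open>finite X\<close> by simp
  }
qed

text \<open>Kerov's transition measure of a diagram.\<close>
definition rho :: "int set \<Rightarrow> int \<Rightarrow> real" where
  "rho M x = (\<Prod>y\<in>removable M. real_of_int (x - y)) / (\<Prod>z\<in>addable M - {x}. real_of_int (x - z))"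

definition trans_mean :: "int set \<Rightarrow> real poly \<Rightarrow> real" where
  "trans_mean M q = (\<Sum>x\<in>addable M. rho M x * poly q (real_of_int x))"

lemma trans_mean_add: "trans_mean M (p + q) = trans_mean M p + trans_mean M q"
  by (simp add: trans_mean_def algebra_simps sum.distrib)

lemma trans_mean_smult: "trans_mean M (smult c q) = c * trans_mean M q"
  by (simp add: trans_mean_def sum_distrib_left algebra_simps)

lemma rho_nonzero:
  assumes "a \<in> syt n" "x \<in> addable (shape a)"
  shows "rho (shape a) x \<noteq> 0"
proof -
  have "x \<notin> removable (shape a)" using assms(2) by (auto simp: addable_def removable_def)
  then show ?thesis using assms(1) by (auto simp: rho_def)
qed

lemma
  assumes "a \<in> syt n"
  shows trans_mean_1: "trans_mean (shape a) 1 = 1"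
    and trans_mean_X: "trans_mean (shape a) [:0, 1:] = 0"
proof -
  define X where "X = real_of_int ` addable (shape a)"
  define Y where "Y = real_of_int ` removable (shape a)"
  have fin: "finite X" "finite Y" using assms by (auto simp: X_def Y_def)
  have card: "card X = Suc (card Y)"
    using card_addable[OF assms] by (simp add: X_def Y_def card_image inj_on_def)
  have sum: "\<Sum>X = \<Sum>Y"
    using sum_addable_eq_sum_removable[OF assms]
    by (simp add: X_def Y_def sum.reindex inj_on_def flip: of_int_sum)
  have rho: "rho (shape a) x = (\<Prod>y\<in>Y. real_of_int x - y) / (\<Prod>z\<in>X - {real_of_int x}. real_of_int x - z)" for x
  proof -
    have "X - {real_of_int x} = real_of_int ` (addable (shape a) - {x})" by (auto simp: X_def)
    then show ?thesis by (simp add: rho_def Y_def prod.reindex inj_on_def)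
  qed
  have L: "trans_mean (shape a) q = (\<Sum>x\<in>X. (\<Prod>y\<in>Y. x - y) / (\<Prod>z\<in>X - {x}. x - z) * poly q x)" for q
    unfolding trans_mean_def rho by (simp add: X_def sum.reindex inj_on_def)
  show 1: "trans_mean (shape a) 1 = 1"
    unfolding L using divided_difference_prod(2)[OF fin(2,1)] card by simp
  \<comment> \<open>One auxiliary root t raises the degree from |X| - 1 to |X|, where the sums of
    nodes and roots become visible; as these agree for X and Y, the mean of x - t is -t.\<close>
  obtain t where t: "t \<notin> Y" using fin(2) infinite_UNIV_char_0 by (metis ex_new_if_finite)
  have "trans_mean (shape a) [:-t, 1:] = (\<Sum>x\<in>X. (\<Prod>y\<in>insert t Y. x - y) / (\<Prod>z\<in>X - {x}. x - z))"
    unfolding L using fin t by (auto intro!: sum.cong)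
  also have "\<dots> = \<Sum>X - \<Sum>(insert t Y)"
    using fin t card by (intro divided_difference_prod(3)) auto
  also have "\<dots> = - t" using sum fin t by simp
  finally have "trans_mean (shape a) [:-t, 1:] = - t" .
  moreover have "[:0, 1:] = [:-t, 1:] + smult t 1" by simp
  ultimately show "trans_mean (shape a) [:0, 1:] = 0"
    using 1 by (simp only: trans_mean_add trans_mean_smult)
qed

text \<open>Over a common window the exponents \<open>- dcon M c\<close> make adding a box additive.
  In \<open>rho_hop\<close> the three changed exponents then yield the factor u^2 / (u^2 - 1) with u
  = x - y.\<close>

lemma rho_powi:
  assumes "finite I" "addable M \<subseteq> I" "removable M \<subseteq> I" "x \<in> addable M"
  shows "rho M x = (\<Prod>c\<in>I-{x}. real_of_int (x - c) powi (- dcon M c))"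
proof -
  have xr: "x \<notin> removable M" using assms(4) by (auto simp: addable_def removable_def)
  have disj: "c \<in> addable M \<Longrightarrow> c \<notin> removable M" for c by (auto simp: addable_def removable_def)
  have "(\<Prod>c\<in>I-{x}. real_of_int (x - c) powi (- dcon M c))
     = (\<Prod>c\<in>I-{x}. (if c \<in> removable M then real_of_int (x - c) else 1)
         * (if c \<in> addable M then inverse (real_of_int (x - c)) else 1))"
    by (rule prod.cong) (auto simp: dcon_eq power_int_minus dest: disj)
  also have "\<dots> = (\<Prod>c\<in>I-{x}. (if c \<in> removable M then real_of_int (x - c) else 1))
         * (\<Prod>c\<in>I-{x}. (if c \<in> addable M then inverse (real_of_int (x - c)) else 1))"
    by (rule prod.distrib)
  also have "(\<Prod>c\<in>I-{x}. (if c \<in> removable M then real_of_int (x - c) else 1))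
      = (\<Prod>c\<in>removable M. real_of_int (x - c))"
    using assms xr by (intro prod.mono_neutral_cong_right) auto
  also have "(\<Prod>c\<in>I-{x}. (if c \<in> addable M then inverse (real_of_int (x - c)) else 1))
      = (\<Prod>c\<in>addable M - {x}. inverse (real_of_int (x - c)))"
    using assms by (intro prod.mono_neutral_cong_right) auto
  finally show ?thesis by (simp add: rho_def divide_inverse prod_inversef[symmetric, unfolded o_def])
qed

lemma rho_hop:
  assumes "finite (addable M)" "finite (removable M)"
    and y: "y \<in> addable M" and x: "x \<in> addable M" "x \<in> addable (hop M y)"
  shows "rho (hop M y) x * (real_of_int (x - y) ^ 2 - 1) = rho M x * real_of_int (x - y) ^ 2"
proof -
  define I where "I = addable M \<union> removable M \<union> {y - 1, y, y + 1}"
  let ?t = "\<lambda>c. of_bool (c = y + 1) + of_bool (c = y - 1) - 2 * of_bool (c = y)"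
  have fin: "finite I" using assms by (auto simp: I_def)
  have sub: "addable (hop M y) \<subseteq> I" "removable (hop M y) \<subseteq> I"
    using y by (auto simp: I_def addable_def removable_def hop_def)
  have ne: "x \<noteq> y" "x \<noteq> y + 1" "x \<noteq> y - 1"
    using x y by (auto simp: addable_def hop_def)
  define u where "u = real_of_int (x - y)"
  have u: "u \<noteq> 0" "u + 1 \<noteq> 0" "u - 1 \<noteq> 0"
    using ne unfolding u_def by linarith+
  have "rho (hop M y) x = (\<Prod>c\<in>I-{x}. real_of_int (x - c) powi (- dcon M c) * real_of_int (x - c) powi (- ?t c))"
    unfolding rho_powi[OF fin sub x(2)] dcon_hop[OF y]
    by (rule prod.cong) (auto simp: power_int_add[symmetric] intro!: arg_cong2[where f = "(powi)"])
  also have "\<dots> = rho M x * (\<Prod>c\<in>I-{x}. real_of_int (x - c) powi (- ?t c))"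
    using fin x(1) by (subst rho_powi[of I]) (auto simp: I_def prod.distrib)
  also have "(\<Prod>c\<in>I-{x}. real_of_int (x - c) powi (- ?t c))
      = (\<Prod>c\<in>{y - 1, y, y + 1}. real_of_int (x - c) powi (- ?t c))"
    using fin ne by (intro prod.mono_neutral_right) (auto simp: I_def)
  also have "\<dots> = inverse (u + 1) * u ^ 2 * inverse (u - 1)"
    by (simp add: u_def power_int_minus algebra_simps)
  finally have f: "rho (hop M y) x = rho M x * (inverse (u + 1) * u ^ 2 * inverse (u - 1))" .
  have "u ^ 2 - 1 = (u + 1) * (u - 1)" by (simp add: power2_eq_square algebra_simps)
  then have "rho (hop M y) x * (u ^ 2 - 1)
      = rho M x * u ^ 2 * (inverse (u + 1) * (u + 1)) * (inverse (u - 1) * (u - 1))"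
    unfolding f by (simp only: mult_ac)
  then show ?thesis unfolding u_def[symmetric] using u by simp
qed

text \<open>Adding y loses the addable content y and gains at most y - 1 and y + 1. The square kills
  the lost point, its decrement by 1 kills the gained ones, and \<open>rho_hop\<close> compares the
  weights at the common points.\<close>

lemma trans_mean_hop:
  assumes fin: "finite (addable M)" "finite (removable M)" and y: "y \<in> addable M"
  shows "trans_mean (hop M y) (([:- real_of_int y, 1:] ^ 2 - 1) * q)
     = trans_mean M ([:- real_of_int y, 1:] ^ 2 * q)"
proof -
  let ?B = "addable M \<inter> addable (hop M y)"
  have sub: "addable (hop M y) \<subseteq> ?B \<union> {y - 1, y + 1}" and sub': "addable M \<subseteq> ?B \<union> {y}"
    using y by (auto simp: addable_def hop_def)
  have fin': "finite (addable (hop M y))" using fin sub by (meson finite.simps finite_Int finite_Un finite_subset)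
  have "trans_mean (hop M y) (([:- real_of_int y, 1:] ^ 2 - 1) * q)
      = (\<Sum>x\<in>?B. rho (hop M y) x * ((real_of_int (x - y) ^ 2 - 1) * poly q (real_of_int x)))"
    unfolding trans_mean_def using fin' sub
    by (intro sum.mono_neutral_cong_right) (auto simp: algebra_simps)
  also have "\<dots> = (\<Sum>x\<in>?B. rho M x * (real_of_int (x - y) ^ 2 * poly q (real_of_int x)))"
    using rho_hop[OF fin y] by (intro sum.cong) (auto simp flip: mult.assoc)
  also have "\<dots> = trans_mean M ([:- real_of_int y, 1:] ^ 2 * q)"
    unfolding trans_mean_def using fin sub'
    by (intro sum.mono_neutral_cong_left) (auto simp: algebra_simps)
  finally show ?thesis .
qed

text \<open>The Lagrange basis polynomials of the node set \<open>X\<close>.\<close>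
definition lag :: "int set \<Rightarrow> int \<Rightarrow> real poly" where
  "lag X x = (\<Prod>z\<in>X-{x}. smult (1 / real_of_int (x - z)) [:- real_of_int z, 1:])"

lemma poly_lag:
  assumes "finite X" "x \<in> X" "z \<in> X"
  shows "poly (lag X x) (real_of_int z) = (if z = x then 1 else 0)"
  using assms by (auto simp: lag_def poly_prod diff_divide_distrib[symmetric] intro!: prod.neutral)

lemma degree_lag: "finite X \<Longrightarrow> degree (lag X x) \<le> card (X - {x})"
proof -
  assume "finite X"
  then have "degree (lag X x) \<le> (\<Sum>z\<in>X-{x}. 1)"
    unfolding lag_def
    by (intro order_trans[OF degree_prod_sum_le]) (auto intro!: sum_mono)
  then show ?thesis by simp
qed

lemma sum_lag:
  assumes "finite X" "X \<noteq> {}"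
  shows "(\<Sum>x\<in>X. lag X x) = 1"
proof (rule poly_eqI_degree[where A = "real_of_int ` X"])
  fix z assume "z \<in> real_of_int ` X"
  then show "poly (\<Sum>x\<in>X. lag X x) z = poly 1 z"
    using assms by (auto simp: poly_sum poly_lag)
next
  have "degree (\<Sum>x\<in>X. lag X x) \<le> card X - 1"
  proof (rule degree_sum_le[OF assms(1)])
    show "degree (lag X x) \<le> card X - 1" if "x \<in> X" for x
      using degree_lag[OF assms(1), of x] assms(1) that by simp
  qed
  then show "degree (\<Sum>x\<in>X. lag X x) < card (real_of_int ` X)"
  proof -
    have "card (real_of_int ` X) = card X" by (simp add: card_image inj_on_def)
    moreover have "card X > 0" using assms by (simp add: card_gt_0_iff)
    ultimately show ?thesis using \<open>degree (\<Sum>x\<in>X. lag X x) \<le> card X - 1\<close> by linarith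
  qed
next
  show "degree 1 < card (real_of_int ` X)"
    using assms by (simp add: card_image inj_on_def card_gt_0_iff)
qed

section \<open>Young's lattice and the number of standard tableaux\<close>

lemma removable_predecessor:
  assumes "a \<in> syt (Suc n)" "x \<in> removable (shape a)"
  shows "\<exists>b\<in>syt n. x \<in> addable (shape b) \<and> hop (shape b) x = shape a"
  using assms
proof (induction n arbitrary: a x)
  case 0
  then show ?case by (auto elim!: syt_SucE simp: hop_def addable_def removable_def)
next
  case (Suc n)
  obtain y b where a: "a = y # b" "b \<in> syt (Suc n)" "y \<in> addable (shape b)"
    using Suc(2) by (rule syt_SucE)
  show ?case
  proof (cases "x = y")
    case True
    then show ?thesis using a by auto
  next
    case False
    \<comment> \<open>Distinct corners do not interact: x was a corner before y was added, so x can
      be taken off by induction and y put back.\<close>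
    then have "x \<in> removable (shape b)"
      using Suc(3) a by (auto simp: hop_def addable_def removable_def)
    then obtain c where c: "c \<in> syt n" "x \<in> addable (shape c)" "hop (shape c) x = shape b"
      using Suc(1)[OF a(2)] by blast
    have "y \<in> addable (shape c)" "x \<in> addable (hop (shape c) y)"
      "hop (hop (shape c) y) x = shape a"
        using Suc(3) a(1,3) c(2) c(3)[symmetric] False by (auto simp: hop_def addable_def removable_def)
    then show ?thesis using c by (intro bexI[of _ "y # c"]) auto
  qed
qed

lemma unhop_reachable:
  "a \<in> syt (Suc n) \<Longrightarrow> x \<in> removable (shape a) \<Longrightarrow> \<exists>b\<in>syt n. shape b = unhop (shape a) x"
  using removable_predecessor[of a n x] unhop_hop by metis

text \<open>Two different last boxes of one diagram are both corners and can be removed in either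
  order. Corners never have adjacent contents; the resulting gap of 2 later keeps (x - y)^2 - 1
  positive.\<close>

lemma diamond:
  assumes "x # a \<in> syt (Suc (Suc n))" "y # b \<in> syt (Suc (Suc n))"
    and "shape (x # a) = shape (y # b)" "x \<noteq> y"
  shows "\<exists>c. x # y # c \<in> syt (Suc (Suc n)) \<and> y # x # c \<in> syt (Suc (Suc n))
    \<and> shape (y # c) = shape a \<and> shape (x # c) = shape b \<and> 2 \<le> \<bar>x - y\<bar>"
proof -
  have a: "a \<in> syt (Suc n)" "x \<in> addable (shape a)" and b: "b \<in> syt (Suc n)" "y \<in> addable (shape b)"
    using assms by auto
  have y: "y \<in> removable (hop (shape a) x)"
    using removable_hop[OF b(2)] assms(3) by simp
  then have "y \<in> removable (shape a)"
    using assms(4) a by (auto simp: hop_def addable_def removable_def)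
  from removable_predecessor[OF a(1) this] obtain c where
    c: "c \<in> syt n" "y \<in> addable (shape c)" "hop (shape c) y = shape a" by auto
  have *: "x \<in> addable (shape c)" "y \<in> addable (hop (shape c) x)" "2 \<le> \<bar>x - y\<bar>"
    "hop (hop (shape c) y) x = hop (hop (shape c) x) y"
    using y a(2) c(2) assms(4) unfolding c(3)[symmetric]
    by (auto simp: hop_def addable_def removable_def)
  have "shape b = unhop (shape (y # b)) y" using unhop_hop[OF b(2)] by simp
  also have "\<dots> = unhop (hop (hop (shape c) x) y) y" using assms(3) c(3) *(4) by simp
  also have "\<dots> = hop (shape c) x" using unhop_hop *(2) by simp
  finally show ?thesis using * c a by auto
qed

definition dimn :: "nat \<Rightarrow> int set \<Rightarrow> nat" where
  "dimn n M = card {a \<in> syt n. shape a = M}"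

lemma dimn_0: "dimn 0 {0..} = 1"
proof -
  have "{a \<in> syt 0. shape a = {0..}} = {[]}" by auto
  then show ?thesis by (simp add: dimn_def)
qed

lemma dimn_Suc:
  assumes "finite (removable M)"
  shows "dimn (Suc n) M = (\<Sum>x\<in>removable M. dimn n (unhop M x))"
proof -
  have "{a \<in> syt (Suc n). shape a = M}
      = (\<Union>x\<in>removable M. (#) x ` {a \<in> syt n. shape a = unhop M x})"
    by (auto elim!: syt_SucE simp: unhop_hop hop_unhop removable_hop addable_unhop image_iff)
  then have "dimn (Suc n) M = card (\<Union>x\<in>removable M. (#) x ` {a \<in> syt n. shape a = unhop M x})"
    by (simp add: dimn_def)
  also have "\<dots> = (\<Sum>x\<in>removable M. card ((#) x ` {a \<in> syt n. shape a = unhop M x}))"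
    using assms by (intro card_UN_disjoint) auto
  also have "\<dots> = (\<Sum>x\<in>removable M. dimn n (unhop M x))"
    by (simp add: dimn_def card_image)
  finally show ?thesis .
qed

text \<open>Young's lattice is a differential poset. Moves up then down and down then up along
  distinct boxes correspond under the swap between R and Q; the moves that return by the same box
  leave a surplus of one, as there is one more addable than removable box.\<close>

lemma dimn_up:
  assumes "a \<in> syt n"
  shows "(\<Sum>x\<in>addable (shape a). dimn (Suc n) (hop (shape a) x)) = Suc n * dimn n (shape a)"
  using assms
proof (induction n arbitrary: a)
  case 0
  have "addable {0..} = {0}" "removable (hop {0..} 0) = {0}"
    by (auto simp: addable_def removable_def hop_def)
  moreover note dimn_0
  moreover have "unhop (hop {0..} 0) 0 = {0..}" by (auto simp: hop_def unhop_def)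
  ultimately show ?case using 0 by (simp add: dimn_Suc)
next
  case (Suc n)
  define M where "M = shape a"
  define R where "R = (SIGMA x:addable M. removable (hop M x) - {x})"
  define Q where "Q = (SIGMA y:removable M. addable (unhop M y) - {y})"
  have fin: "finite (addable M)" "finite (removable M)" using Suc by (auto simp: M_def)
  have finR: "finite (removable (hop M x))" if "x \<in> addable M" for x
    using that Suc finite_removable[of "x # a" "Suc (Suc n)"] by (simp add: M_def)
  have un: "\<exists>b\<in>syt n. shape b = unhop M y" if "y \<in> removable M" for y
    using that Suc unhop_reachable by (simp add: M_def)
  have finA: "finite (addable (unhop M y))" if "y \<in> removable M" for y
    using un[OF that] finite_addable by metis
  have 1: "dimn (Suc (Suc n)) (hop M x)
      = dimn (Suc n) M + (\<Sum>y\<in>removable (hop M x) - {x}. dimn (Suc n) (unhop (hop M x) y))"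
    if "x \<in> addable M" for x
    using finR[OF that] that
    by (simp add: dimn_Suc[of "hop M x" "Suc n"] sum.remove[OF _ removable_hop[OF that]] unhop_hop)
  have 2: "Suc n * dimn n (unhop M y)
      = dimn (Suc n) M + (\<Sum>x\<in>addable (unhop M y) - {y}. dimn (Suc n) (hop (unhop M y) x))"
    if "y \<in> removable M" for y
  proof -
    obtain b where "b \<in> syt n" "shape b = unhop M y" using un[OF \<open>y \<in> removable M\<close>] by auto
    then have "Suc n * dimn n (unhop M y) = (\<Sum>x\<in>addable (unhop M y). dimn (Suc n) (hop (unhop M y) x))"
      using Suc(1)[of b] by simp
    then show ?thesis
      using finA[OF that] that by (simp add: sum.remove[OF _ addable_unhop[OF that]] hop_unhop)
  qed
  have "(\<Sum>(x, y)\<in>R. dimn (Suc n) (unhop (hop M x) y)) = (\<Sum>(y, x)\<in>Q. dimn (Suc n) (hop (unhop M y) x))"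
    by (rule sum.reindex_bij_witness[of _ prod.swap prod.swap])
      (auto simp: R_def Q_def hop_def unhop_def addable_def removable_def intro!: arg_cong[of _ _ "dimn (Suc n)"])
  then have 3: "(\<Sum>x\<in>addable M. \<Sum>y\<in>removable (hop M x) - {x}. dimn (Suc n) (unhop (hop M x) y))
     = (\<Sum>y\<in>removable M. \<Sum>x\<in>addable (unhop M y) - {y}. dimn (Suc n) (hop (unhop M y) x))"
    unfolding R_def Q_def using fin finR finA by (simp add: sum.Sigma)
  have "(\<Sum>x\<in>addable M. dimn (Suc (Suc n)) (hop M x))
     = card (addable M) * dimn (Suc n) M
      + (\<Sum>y\<in>removable M. \<Sum>x\<in>addable (unhop M y) - {y}. dimn (Suc n) (hop (unhop M y) x))"
    by (simp add: 1 sum.distrib 3)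
  also have "\<dots> = dimn (Suc n) M + (\<Sum>y\<in>removable M. Suc n * dimn n (unhop M y))"
  proof -
    have "(\<Sum>y\<in>removable M. Suc n * dimn n (unhop M y)) = card (removable M) * dimn (Suc n) M
        + (\<Sum>y\<in>removable M. \<Sum>x\<in>addable (unhop M y) - {y}. dimn (Suc n) (hop (unhop M y) x))"
      by (simp add: sum.cong[OF refl 2] sum.distrib del: mult_Suc)
    then show ?thesis using card_addable[OF Suc(2)] by (simp add: M_def del: mult_Suc) (simp add: mult_Suc)
  qed
  also have "\<dots> = Suc (Suc n) * dimn (Suc n) M"
    using fin by (simp only: dimn_Suc[of M n] flip: sum_distrib_left) simp
  finally show ?case by (simp add: M_def)
qed

lemma sum_syt_Suc:
  "(\<Sum>a\<in>syt (Suc n). f a) = (\<Sum>a\<in>syt n. \<Sum>x\<in>addable (shape a). f (x # a))"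
proof -
  have "(\<Sum>a\<in>syt (Suc n). f a) = (\<Sum>a\<in>syt n. \<Sum>b\<in>(\<lambda>x. x # a) ` addable (shape a). f b)"
    unfolding syt.simps(2) by (rule sum.UNION_disjoint) auto
  also have "\<dots> = (\<Sum>a\<in>syt n. \<Sum>x\<in>addable (shape a). f (x # a))"
    by (rule sum.cong) (auto simp: sum.reindex inj_on_def)
  finally show ?thesis .
qed

text \<open>Each diagram is counted once per tableau, so this is the sum of the squares of the
  tableau numbers; by \<open>dimn_up\<close> it grows by the factor n + 1.\<close>

lemma sum_dimn: "(\<Sum>a\<in>syt n. dimn n (shape a)) = fact n"
proof (induction n)
  case 0
  show ?case by (simp add: dimn_0)
next
  case (Suc n)
  have "(\<Sum>a\<in>syt (Suc n). dimn (Suc n) (shape a))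
      = (\<Sum>a\<in>syt n. \<Sum>x\<in>addable (shape a). dimn (Suc n) (hop (shape a) x))"
    by (simp add: sum_syt_Suc)
  also have "\<dots> = (\<Sum>a\<in>syt n. Suc n * dimn n (shape a))"
    by (rule sum.cong) (simp_all add: dimn_up)
  also have "\<dots> = Suc n * (\<Sum>a\<in>syt n. dimn n (shape a))"
    by (rule sum_distrib_left[symmetric])
  finally show ?case unfolding Suc by simp
qed


section \<open>The primitive idempotents of the standard tableaux\<close>

text \<open>\<open>idem a\<close> is the projection onto the joint eigenspace of the Jucys--Murphy elements in which
  they take the contents listed in \<open>a\<close> as eigenvalues.\<close>
fun idem :: "int list \<Rightarrow> galg" where
  "idem [] = 1"
| "idem (x # a) = idem a * peval (lag (addable (shape a)) x) (JM (Suc (length a)))"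

definition idem_system :: "nat \<Rightarrow> bool" where
  "idem_system n \<longleftrightarrow> (\<forall>a\<in>syt n. idem a \<in> Alg n \<and> star (idem a) = idem a \<and> 0 < tau (idem a))
     \<and> (\<forall>a\<in>syt n. \<forall>b\<in>syt n. idem a * idem b = (if a = b then idem a else 0))
     \<and> (\<Sum>a\<in>syt n. idem a) = 1"

text \<open>The spectral measure of the next Jucys--Murphy element on \<open>idem a\<close> is the transition measure.
  It yields the eigenvalues occurring on \<open>idem a\<close> and shows that each of them does occur.\<close>
definition spectral :: "nat \<Rightarrow> bool" where
  "spectral n \<longleftrightarrow> (\<forall>a\<in>syt n. \<forall>q.
     tau (idem a * peval q (JM (Suc n))) = tau (idem a) * trans_mean (shape a) q)"

text \<open>The corner at \<open>idem a\<close> consists of scalars, and taking traces dictates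
  which scalar. This takes the place of Schur's lemma.\<close>

definition primitive :: "nat \<Rightarrow> bool" where
  "primitive n \<longleftrightarrow> (\<forall>a\<in>syt n. \<forall>M\<in>Alg n. idem a * M * idem a = (tau (idem a * M) / tau (idem a)) *\<^sub>R idem a)"

lemma idem_systemD:
  assumes "idem_system n" "a \<in> syt n"
  shows "idem a \<in> Alg n" "star (idem a) = idem a" "0 < tau (idem a)" "idem a * idem a = idem a"
    "idem a * (idem a * M) = idem a * M" "b \<in> syt n \<Longrightarrow> a \<noteq> b \<Longrightarrow> idem a * idem b = 0"
  using assms by (auto simp: idem_system_def simp flip: mult.assoc)

lemma peval_diff: "peval (p - q) X = peval p X - peval q X"
  using peval_add[of "p - q" q X] by simp

text \<open>The spectral measure lives on the addable contents, so the square of the polynomial Q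
  vanishing there has trace zero on \<open>idem a\<close>, and faithfulness makes Q itself vanish.
  The Lagrange polynomial of x times t - x is a multiple of Q.\<close>

lemma idem_JM_eigen:
  assumes "idem_system n" "spectral n" "x # a \<in> syt (Suc n)"
  shows "idem (x # a) * JM (Suc n) = real_of_int x *\<^sub>R idem (x # a)"
proof -
  have a: "a \<in> syt n" "x \<in> addable (shape a)" and len: "length a = n"
    using assms(3) length_syt by auto
  note I = idem_systemD[OF assms(1) a(1)]
  let ?X = "addable (shape a)" and ?J = "JM (Suc n)"
  define Q where "Q = (\<Prod>z\<in>?X. [:- real_of_int z, 1:])"
  have fin: "finite ?X" using a by simp
  have c: "idem a * peval q ?J = peval q ?J * idem a" for q
    by (rule peval_intertwine[OF JM_commutes_Alg[OF I(1)]])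
  have sp: "star (peval q ?J) = peval q ?J" for q
    by (rule star_peval[OF star_JM])
  define v where "v = idem a * peval Q ?J"
  have "star v * v = peval Q ?J * idem a * (idem a * peval Q ?J)"
    by (simp add: v_def star_mult sp I(2))
  also have "\<dots> = idem a * peval (Q * Q) ?J"
    by (simp add: mult.assoc I(5)) (simp add: c[symmetric] peval_mult flip: mult.assoc)
  finally have "tau (star v * v) = tau (idem a) * trans_mean (shape a) (Q * Q)"
    using assms(2) a by (simp add: spectral_def)
  also have "trans_mean (shape a) (Q * Q) = 0"
    unfolding trans_mean_def Q_def using fin by (auto simp: poly_prod intro!: sum.neutral)
  finally have "v = 0"
    using tau_star_self_eq_0[of v "Suc n"] Alg_mult[OF Alg_mono[OF _ I(1)] peval_in_Alg[OF JM_in_Alg]]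
    by (simp add: v_def)
  have "lag ?X x = smult (\<Prod>z\<in>?X-{x}. 1 / real_of_int (x - z)) (\<Prod>z\<in>?X-{x}. [:- real_of_int z, 1:])"
    unfolding lag_def by (rule prod_smult)
  then have "lag ?X x * [:- real_of_int x, 1:] = smult (\<Prod>z\<in>?X-{x}. 1 / real_of_int (x - z)) Q"
    using fin a(2) by (simp add: Q_def prod.remove mult.commute del: mult_pCons_right mult_pCons_left)
  then have "idem a * peval (lag ?X x * [:- real_of_int x, 1:]) ?J = 0"
    using \<open>v = 0\<close> by (simp add: peval_smult v_def)
  then show ?thesis
    by (simp add: len peval_mult peval_pCons of_real_def algebra_simps del: mult_pCons_right mult_pCons_left)
qed

lemma idem_peval:
  assumes "idem_system n" "spectral n" "x # a \<in> syt (Suc n)"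
  shows "idem (x # a) * peval q (JM (Suc n)) = poly q (real_of_int x) *\<^sub>R idem (x # a)"
  by (rule peval_eigen[OF idem_JM_eigen[OF assms]])

lemma idem_system_Suc:
  assumes "idem_system n" "spectral n"
  shows "idem_system (Suc n)"
proof -
  let ?J = "JM (Suc n)"
  have c: "idem a * peval q ?J = peval q ?J * idem a" if "a \<in> syt n" for a q
    by (rule peval_intertwine[OF JM_commutes_Alg[OF idem_systemD(1)[OF assms(1) that]]])
  have cM: "idem a * (peval q ?J * M) = peval q ?J * (idem a * M)" if "a \<in> syt n" for a q M
    using c[OF that] by (simp flip: mult.assoc)
  have len: "length a = n" if "a \<in> syt n" for a by (rule length_syt[OF that])
  have 1: "idem a \<in> Alg (Suc n) \<and> star (idem a) = idem a \<and> 0 < tau (idem a)" if mem: "a \<in> syt (Suc n)" for a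
  proof -
    obtain x b where a: "a = x # b" "b \<in> syt n" "x \<in> addable (shape b)"
      using mem by (elim syt_SucE) blast
    note I = idem_systemD[OF assms(1) a(2)]
    have in_Alg: "idem a \<in> Alg (Suc n)"
      using I(1) by (simp add: a len Alg_mult Alg_mono[of n "Suc n"] peval_in_Alg JM_in_Alg)
    have star: "star (idem a) = idem a"
      using c[OF a(2)] by (simp add: a len star_mult star_peval star_JM I(2))
    have "idem a * idem a = idem b * idem b * peval (lag (addable (shape b)) x) ?J * peval (lag (addable (shape b)) x) ?J"
      by (simp add: a len mult.assoc cM[OF a(2)])
    also have "\<dots> = idem a * peval (lag (addable (shape b)) x) ?J"
      by (simp add: a len I(4))
    also have "\<dots> = idem a"
      using idem_peval[OF assms, of x b] a by (simp add: poly_lag)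
    finally have "idem a * idem a = idem a" .
    then have "tau (idem a) = tau (star (idem a) * idem a)" by (simp add: star)
    also have "\<dots> \<ge> 0" by (simp add: tau_star_self[OF in_Alg] sum_nonneg)
    finally have "tau (idem a) \<ge> 0" .
    moreover have "tau (idem a) = tau (idem b) * trans_mean (shape b) (lag (addable (shape b)) x)"
      using assms(2) a by (simp add: spectral_def len)
    moreover have "trans_mean (shape b) (lag (addable (shape b)) x)
        = (\<Sum>z\<in>addable (shape b). if z = x then rho (shape b) z else 0)"
      unfolding trans_mean_def using a by (intro sum.cong) (auto simp: poly_lag)
    moreover have "\<dots> = rho (shape b) x" using a by simp
    \<comment> \<open>A projection has nonnegative trace and \<open>rho\<close> does not vanish.
      Positivity of the transition measure is thus a result of the algebra, obtained without any
      ordering of the contents.\<close>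
    ultimately have "tau (idem a) > 0" using rho_nonzero[OF a(2,3)] I(3)
      by (metis less_eq_real_def mult_eq_0_iff less_irrefl)
    then show ?thesis using in_Alg star by simp
  qed
  have 2: "idem a * idem b = (if a = b then idem a else 0)" if mem: "a \<in> syt (Suc n)" "b \<in> syt (Suc n)" for a b
  proof -
    obtain x a' where a: "a = x # a'" "a' \<in> syt n" "x \<in> addable (shape a')"
      using mem(1) by (elim syt_SucE) blast
    obtain y b' where b: "b = y # b'" "b' \<in> syt n" "y \<in> addable (shape b')"
      using mem(2) by (elim syt_SucE) blast
    have *: "idem a * idem b = idem a' * idem b' * peval (lag (addable (shape a')) x * lag (addable (shape b')) y) ?J"
      by (simp add: a b len mult.assoc cM peval_mult)
    show ?thesis
    proof (cases "a' = b'")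
      case False
      then show ?thesis using * a b idem_systemD(6)[OF assms(1) a(2) b(2)] by simp
    next
      case True
      have "idem a * idem b = idem a' * peval (lag (addable (shape a')) x * lag (addable (shape a')) y) ?J"
        using * idem_systemD(4)[OF assms(1) a(2)] unfolding True by simp
      also have "\<dots> = idem a * peval (lag (addable (shape a')) y) ?J"
        by (simp add: a(1) len[OF a(2)] peval_mult mult.assoc)
      finally have "idem a * idem b = idem a * peval (lag (addable (shape a')) y) ?J" .
      then show ?thesis
        using idem_peval[OF assms, of x a'] mem a b True by (auto simp: poly_lag)
    qed
  qed
  have "(\<Sum>a\<in>syt (Suc n). idem a) = (\<Sum>a\<in>syt n. idem a * peval (\<Sum>x\<in>addable (shape a). lag (addable (shape a)) x) ?J)"
    unfolding sum_syt_Suc by (rule sum.cong) (auto simp: len peval_sum sum_distrib_left)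
  also have "\<dots> = (\<Sum>a\<in>syt n. idem a)"
    by (rule sum.cong) (use sum_lag addable_nonempty in auto)
  also have "\<dots> = 1" using assms(1) by (simp add: idem_system_def)
  finally show ?thesis unfolding idem_system_def using 1 2 by blast
qed

section \<open>Intertwiners of consecutive Jucys--Murphy elements\<close>

lemma intertwiner_identities:
  fixes s a b :: "'a :: ring_1"
  assumes ss: "s * s = 1" and sa: "s * a = b * s - 1" and sb: "s * b = a * s + 1" and ab: "b * a = a * b"
  defines "F \<equiv> s * a - a * s"
  shows "F * a = b * F" "F * b = a * F" "F * F = 1 - (a - b) * (a - b)"
proof -
  have ss': "s * (s * m) = m" and sa': "s * (a * m) = b * (s * m) - m"
    and sb': "s * (b * m) = a * (s * m) + m" and ab': "b * (a * m) = a * (b * m)" for m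
    by (simp_all add: ss sa sb ab algebra_simps flip: mult.assoc)
  \<comment> \<open>Read as rewrite rules, the relations move s to the right, sort a before b and
    cancel s s; the primed versions act inside longer products. The resulting normal form decides
    all three identities.\<close>
  note R = ss sa sb ab ss' sa' sb' ab'
  show "F * a = b * F" "F * b = a * F" "F * F = 1 - (a - b) * (a - b)"
    by (simp_all add: F_def R algebra_simps)
qed

text \<open>The simple transposition does not exchange the two Jucys--Murphy elements because of the
  extra 1 in \<open>sw_JM\<close>; in this commutator the extra terms cancel.\<close>

definition Phi :: "nat \<Rightarrow> galg" where
  "Phi n = sw n * JM (Suc n) - JM (Suc n) * sw n"

lemma Phi_JM: "Phi n * JM (Suc n) = JM (Suc (Suc n)) * Phi n"
  and Phi_J': "Phi n * JM (Suc (Suc n)) = JM (Suc n) * Phi n"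
  and Phi_Phi: "Phi n * Phi n = 1 - (JM (Suc n) - JM (Suc (Suc n))) * (JM (Suc n) - JM (Suc (Suc n)))"
  unfolding Phi_def
  by (rule intertwiner_identities; simp add: sw_sw sw_JM JM_sw JM_commute)+

lemma star_Phi: "star (Phi n) = - Phi n"
  by (simp add: Phi_def star_diff star_mult star_JM)

lemma Phi_in_Alg: "Phi n \<in> Alg (Suc (Suc n))"
  unfolding Phi_def using Alg_mono[OF _ JM_in_Alg, of "Suc n" "Suc (Suc n)"] by (simp add: Alg_diff Alg_mult sw_in_Alg)

lemma Phi_commutes_Alg:
  assumes "M \<in> Alg n"
  shows "M * Phi n = Phi n * M"
proof -
  have "M * (sw n * X) = sw n * (M * X)" "M * (JM (Suc n) * X) = JM (Suc n) * (M * X)" for X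
    using sw_commutes_Alg[OF assms] JM_commutes_Alg[OF assms] by (simp_all flip: mult.assoc)
  then show ?thesis
    using sw_commutes_Alg[OF assms] JM_commutes_Alg[OF assms] by (simp add: Phi_def algebra_simps)
qed

lemma spectral_0: "spectral 0"
proof -
  have "JM (Suc 0) = 0" by (simp add: JM_def)
  moreover have "addable {0..} = {0}" "removable {0..} = {}" by (auto simp: addable_def removable_def)
  moreover have "peval q (0 :: galg) = of_real (poly q 0)" for q
    by (induction q) (auto simp: peval_pCons)
  ultimately show ?thesis
    by (simp add: spectral_def trans_mean_def rho_def of_real_def tau_scale)
qed

lemma idem_system_0: "idem_system 0"
  by (simp add: idem_system_def)

text \<open>With \<open>e = idem (y # a)\<close> one has \<open>e * Phi n = e * sw n * (JM (Suc n) - y)\<close>. Computing the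
  trace of \<open>e * Phi n * q (JM (Suc n)) * star (Phi n)\<close> in two ways relates the spectral measures of
  two consecutive levels on all multiples of \<open>(t - y)\<^sup>2 - 1\<close>; total mass and mean determine the
  rest.\<close>
lemma spectral_Suc:
  assumes I0: "idem_system n" "spectral n" and pr: "primitive n"
  shows "spectral (Suc n)"
  unfolding spectral_def
proof (intro ballI allI)
  fix b q assume b: "b \<in> syt (Suc n)"
  then obtain y a where ya: "b = y # a" "a \<in> syt n" "y \<in> addable (shape a)" by (elim syt_SucE) blast
  let ?y = "real_of_int y" and ?J = "JM (Suc n)" and ?K = "JM (Suc (Suc n))" and ?s = "sw n"
  note I = idem_systemD[OF I0(1) ya(2)]
  note Ib = idem_systemD[OF idem_system_Suc[OF I0] b]
  define e where "e = idem b"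
  define B where "B = [:- ?y, 1:] ^ 2 - 1"
  have eJ: "e * ?J = ?y *\<^sub>R e" using idem_JM_eigen[OF I0, of y a] b by (simp add: e_def ya(1))
  have eA: "e \<in> Alg (Suc n)" and ee: "e * e = e" "e * (e * M) = e * M" for M
    using Ib by (simp_all add: e_def)
  have ea: "e * idem a = e" "idem a * e = e"
  proof -
    show "idem a * e = e" by (simp add: e_def ya(1) I(5))
    then have "star (idem a * e) = star e" by simp
    then show "e * idem a = e" using I(2) Ib(2) by (simp add: star_mult e_def)
  qed
  have eK: "e * peval p ?K = peval p ?K * e" for p
    by (rule peval_intertwine[OF JM_commutes_Alg[OF eA]])
  have eJ': "e * (?J * M) = ?y *\<^sub>R (e * M)" for M by (simp add: eJ flip: mult.assoc)
  have main: "tau (e * peval (B * p) ?K) = tau e * trans_mean (shape b) (B * p)" for p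
  proof -
    \<comment> \<open>The outer factors are those that \<open>Phi n\<close> leaves next to e. Hence
      \<open>e * (?s * N * ?s) * e\<close> can be evaluated through \<open>Phi n\<close> as well as
      through the conditional expectation.\<close>
    define N where "N = (?J - of_real ?y) * peval p ?J * (?J - of_real ?y)"
    have cJ: "peval p ?J * (?J - of_real ?y) = (?J - of_real ?y) * peval p ?J"
      by (rule peval_intertwine[symmetric]) (simp add: algebra_simps of_real_def)
    have Nq: "N = peval ([:- ?y, 1:] ^ 2 * p) ?J"
      by (simp add: N_def mult.assoc cJ peval_mult power2_eq_square peval_pCons
          del: mult_pCons_right mult_pCons_left) (simp add: mult.assoc cJ[simplified])
    have NA: "N \<in> Alg (Suc n)" unfolding Nq by (rule peval_in_Alg[OF JM_in_Alg])
    have ePhi: "e * Phi n = e * ?s * (?J - of_real ?y)"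
      by (simp add: Phi_def algebra_simps eJ' of_real_def)
    have "star (e * Phi n) = star (e * ?s * (?J - of_real ?y))" by (simp add: ePhi)
    then have Phie: "- (Phi n * e) = (?J - of_real ?y) * ?s * e"
      using Ib(2) by (simp add: star_mult star_Phi star_diff star_JM e_def mult.assoc
        star_of_real[of ?y, simplified])
    have "e * (?s * N * ?s) * e = (e * ?s * (?J - of_real ?y)) * peval p ?J * ((?J - of_real ?y) * ?s * e)"
      by (simp add: N_def mult.assoc)
    also have "\<dots> = e * Phi n * peval p ?J * (- (Phi n * e))"
      by (simp only: ePhi Phie)
    also have "\<dots> = - (e * (Phi n * peval p ?J) * Phi n * e)"
      by (simp add: mult.assoc)
    also have "Phi n * peval p ?J = peval p ?K * Phi n"
      by (rule peval_intertwine[OF Phi_JM])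
    also have "e * (peval p ?K * Phi n) * Phi n * e = peval p ?K * (e * (Phi n * Phi n)) * e"
      by (simp add: eK flip: mult.assoc)
    \<comment> \<open>On e the element \<open>?J\<close> is the scalar y, so 1 - (J - K)^2 becomes 1
      - (K - y)^2. The roots y - 1 and y + 1 of B are the only contents that adding y can make
      addable.\<close>
    also have "e * (Phi n * Phi n) = - (e * peval B ?K)"
    proof -
      have BK: "peval B ?K = (?K - ?y *\<^sub>R 1) * (?K - ?y *\<^sub>R 1) - 1"
        by (simp add: B_def peval_diff power2_eq_square peval_mult peval_pCons of_real_def
            del: mult_pCons_right mult_pCons_left)
      have "e * ?K = ?K * e" by (rule JM_commutes_Alg[OF eA])
      then have K: "e * (?K * M) = ?K * (e * M)" for M by (simp flip: mult.assoc)
      show ?thesis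
        unfolding Phi_Phi BK
        by (simp add: algebra_simps of_real_def eJ' eJ JM_commute[of "Suc (Suc n)" "Suc n"])
    qed
    finally have "e * (?s * N * ?s) * e = peval p ?K * (e * peval B ?K) * e" by simp
    also have "\<dots> = peval p ?K * peval B ?K * e"
      by (simp add: eK mult.assoc ee)
    also have "\<dots> = e * peval (B * p) ?K"
      using eK[of "p * B"] by (simp add: peval_mult mult.commute[of B p])
    finally have "tau (e * peval (B * p) ?K) = tau (e * (?s * N * ?s) * e)" by simp
    also have "\<dots> = tau (e * (?s * N * ?s))"
      by (subst tau_commute) (simp add: ee flip: mult.assoc)
    also have "\<dots> = tau (e * Eres n N)" by (rule tau_conj_sw[OF eA NA])
    also have "\<dots> = tau (e * idem a * Eres n N)" by (simp add: ea)
    also have "\<dots> = tau (idem a * e * idem a * Eres n N)" by (simp add: ea)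
    also have "\<dots> = tau (e * (idem a * Eres n N * idem a))"
      by (metis tau_commute mult.assoc)
    \<comment> \<open>Here the scalar corner one level down enters: of N only its trace against
      \<open>idem a\<close> is left, which the spectral measure of a evaluates.\<close>
    also have "idem a * Eres n N * idem a = (tau (idem a * Eres n N) / tau (idem a)) *\<^sub>R idem a"
      using pr ya(2) Eres_in_Alg unfolding primitive_def by blast
    also have "tau (idem a * Eres n N) = tau (idem a * N)"
      using Eres_mult_left[OF I(1)] by (metis tau_Eres)
    also have "tau (idem a * N) = tau (idem a) * trans_mean (shape a) ([:- ?y, 1:] ^ 2 * p)"
      using I0(2) ya(2) unfolding spectral_def Nq by blast
    also have "trans_mean (shape a) ([:- ?y, 1:] ^ 2 * p) = trans_mean (shape b) (B * p)"
      unfolding B_def ya(1) shape.simps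
      by (rule trans_mean_hop[symmetric]) (use ya in auto)
    finally show ?thesis using I(3) ea by (simp add: tau_scale)
  qed
  define r where "r = q mod B"
  have B2: "degree B = 2" "B \<noteq> 0"
    by (simp_all add: B_def power2_eq_square one_pCons)
  have "degree r < 2" using degree_mod_less'[OF B2(2)] B2(1) r_def by (metis degree_0 pos2)
  then have "degree r \<le> 1" by simp
  then obtain c d where r: "r = [:c, d:]" using degree1_coeffs[of r] degree_eq_zeroE[of r]
    by (metis le_Suc_eq le_zero_eq One_nat_def pCons_0_0)
  have q: "q = B * (q div B) + smult c 1 + smult d [:0, 1:]"
    using mult_div_mod_eq[of B q] r_def r by (simp add: add.assoc)
  have "tau (e * peval [:0, 1:] ?K) = 0"
    using tau_JM[OF eA] by (simp add: peval_pCons)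
  moreover have "tau (e * peval q ?K) = tau (e * peval (B * (q div B)) ?K) + c * tau e + d * tau (e * peval [:0, 1:] ?K)"
    by (subst q) (simp only: peval_add peval_smult tau_add tau_scale distrib_left mult_scaleR_right peval_1 mult_1_right)
  moreover have "trans_mean (shape b) q = trans_mean (shape b) (B * (q div B)) + c"
    by (subst q) (simp only: trans_mean_add trans_mean_smult trans_mean_1[OF b] trans_mean_X[OF b])
  ultimately have "tau (e * peval q ?K) = tau e * trans_mean (shape b) q"
    using main[of "q div B"] by (simp add: distrib_left)
  then show "tau (idem b * peval q ?K) = tau (idem b) * trans_mean (shape b) q" by (simp add: e_def)
qed

text \<open>Tableaux are linked if a partial isometry identifies their idempotents. The partial
  isometries between tableaux of equal shape form an orthogonal family of \<open>n!\<close> elements,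
  hence a basis of \<open>Alg n\<close>, which makes every \<open>idem a\<close> primitive.\<close>
definition linked :: "nat \<Rightarrow> int list \<Rightarrow> int list \<Rightarrow> bool" where
  "linked n a b \<longleftrightarrow> (\<exists>u\<in>Alg n. star u * u = idem b \<and> u * star u = idem a)"

lemma partial_isometry_absorb:
  assumes "u \<in> Alg n" "star u * u = p" "p * p = p" "star p = p" "p \<in> Alg n"
  shows "u * p = u"
proof -
  let ?v = "u - u * p"
  have "star ?v * ?v = star u * u - star u * u * p - p * (star u * u) + p * (star u * u) * p"
    by (simp add: star_diff star_mult assms(4) algebra_simps)
  also have "\<dots> = 0" by (simp add: assms(2,3))
  finally have "?v = 0" using tau_star_self_eq_0[of ?v n] assms Alg_diff Alg_mult by auto
  then show ?thesis by simp
qed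

lemma linked_absorb:
  assumes "idem_system n" "a \<in> syt n" "b \<in> syt n" "u \<in> Alg n" "star u * u = idem b" "u * star u = idem a"
  shows "u * idem b = u" "idem a * u = u"
proof -
  note Ia = idem_systemD[OF assms(1,2)] and Ib = idem_systemD[OF assms(1,3)]
  show "u * idem b = u" using partial_isometry_absorb[OF assms(4,5) Ib(4,2,1)] .
  have "star u * idem a = star u"
    using partial_isometry_absorb[of "star u" n "idem a"] assms Ia by (simp add: star_in_Alg)
  then have "star (star u * idem a) = star (star u)" by simp
  then show "idem a * u = u" using Ia(2) by (simp add: star_mult)
qed

lemma linked_trans:
  assumes I: "idem_system n" and syt: "a \<in> syt n" "b \<in> syt n" "c \<in> syt n"
    and "linked n a b" "linked n b c"
  shows "linked n a c"
proof -
  obtain u where u: "u \<in> Alg n" "star u * u = idem b" "u * star u = idem a"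
    using assms by (auto simp: linked_def)
  obtain v where v: "v \<in> Alg n" "star v * v = idem c" "v * star v = idem b"
    using assms by (auto simp: linked_def)
  have "star (u * v) * (u * v) = star v * ((star u * u) * v)" by (simp add: star_mult mult.assoc)
  also have "\<dots> = idem c"
    using linked_absorb(2)[OF I syt(2,3) v] by (simp add: u v)
  finally have 1: "star (u * v) * (u * v) = idem c" .
  have "(u * v) * star (u * v) = u * (v * star v) * star u" by (simp add: star_mult mult.assoc)
  also have "\<dots> = idem a"
    using linked_absorb(1)[OF I syt(1,2) u] by (simp add: u v)
  finally show ?thesis unfolding linked_def using 1 u v Alg_mult by blast
qed

text \<open>A partial isometry in \<open>Alg n\<close> commutes with polynomials in
  \<open>JM (Suc n)\<close>, and equal shapes have the same Lagrange polynomial at x, so it can be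
  cut down to the extended tableaux.\<close>

lemma linked_Cons:
  assumes I: "idem_system n" "spectral n" and syt: "x # a \<in> syt (Suc n)" "x # b \<in> syt (Suc n)"
    and sh: "shape a = shape b" and "linked n a b"
  shows "linked (Suc n) (x # a) (x # b)"
proof -
  obtain u where u: "u \<in> Alg n" "star u * u = idem b" "u * star u = idem a"
    using assms by (auto simp: linked_def)
  have ab: "a \<in> syt n" "b \<in> syt n" "length a = n" "length b = n" using syt length_syt by auto
  let ?l = "peval (lag (addable (shape a)) x) (JM (Suc n))"
  have Pa: "idem (x # a) = idem a * ?l" and Pb: "idem (x # b) = idem b * ?l" using ab sh by auto
  have c: "M * ?l = ?l * M" if "M \<in> Alg n" for M
    by (rule peval_intertwine[OF JM_commutes_Alg[OF that]])
  note Ix = idem_systemD[OF idem_system_Suc[OF I] syt(2)]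
  let ?v = "u * idem (x # b)"
  have "star ?v * ?v = idem (x # b) * (star u * u) * idem (x # b)"
    by (simp add: star_mult Ix(2) mult.assoc del: idem.simps)
  also have "\<dots> = idem (x # b) * (idem b * idem (x # b))" by (simp add: u mult.assoc del: idem.simps)
  also have "idem b * idem (x # b) = idem (x # b)"
    unfolding Pb using idem_systemD(4)[OF I(1) ab(2)] by (simp flip: mult.assoc)
  finally have 1: "star ?v * ?v = idem (x # b)" using Ix(4) by (simp del: idem.simps)
  have "?v * star ?v = u * (idem (x # b) * idem (x # b)) * star u"
    by (simp add: star_mult Ix(2) mult.assoc del: idem.simps)
  also have "\<dots> = (u * idem b) * ?l * star u"
    by (simp only: Ix(4)) (simp only: Pb mult.assoc)
  also have "u * idem b = u" by (rule linked_absorb(1)[OF I(1) ab(1,2) u])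
  also have "u * ?l * star u = ?l * (u * star u)" by (simp add: c[OF u(1)] mult.assoc)
  also have "\<dots> = idem (x # a)"
    unfolding u(3) Pa using c idem_systemD(1)[OF I(1) ab(1)] by simp
  finally show ?thesis unfolding linked_def
    using 1 Alg_mult[OF Alg_mono[OF _ u(1)] Ix(1)] by fastforce
qed

text \<open>The intertwiner exchanges the last two eigenvalues. On the eigenspace
  \<open>star (Phi n) * Phi n\<close> is the scalar (x - y)^2 - 1, positive by the gap of 2, and
  dividing by its square root gives a partial isometry.\<close>

lemma linked_swap:
  assumes I: "idem_system n" "spectral n" "spectral (Suc n)"
    and syt: "x # y # c \<in> syt (Suc (Suc n))" "y # x # c \<in> syt (Suc (Suc n))"
    and xy: "2 \<le> \<bar>x - y\<bar>"
  shows "linked (Suc (Suc n)) (x # y # c) (y # x # c)"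
proof -
  have I1: "idem_system (Suc n)" using idem_system_Suc I by blast
  have I2: "idem_system (Suc (Suc n))" using idem_system_Suc[OF I1] I by blast
  let ?J = "JM (Suc n)" and ?K = "JM (Suc (Suc n))"
  have c: "c \<in> syt n" "length c = n" using syt length_syt by auto
  \<comment> \<open>Passing \<open>Phi n\<close> exchanges \<open>?J\<close> and \<open>?K\<close>
    in the Lagrange polynomials of the left idempotent; on the right idempotent they then take the
    value 1.\<close>
  have absorb: "idem (x # y # c) * Phi n * idem (y # x # c) = Phi n * idem (y # x # c)"
    if syt: "x # y # c \<in> syt (Suc (Suc n))" "y # x # c \<in> syt (Suc (Suc n))" for x y
  proof -
    let ?Q = "idem (y # x # c)"
    let ?l = "lag (addable (shape c)) y" and ?m = "lag (addable (shape (y # c))) x"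
    note IQ = idem_systemD[OF I2 syt(2)]
    have Q1: "?Q * peval q ?K = poly q (real_of_int y) *\<^sub>R ?Q" for q
      by (rule idem_peval[OF I1 I(3) syt(2)])
    have Qd: "?Q = idem (x # c) * peval (lag (addable (shape (x # c))) y) ?K"
      using c by simp
    have cK: "idem (x # c) * peval q ?K = peval q ?K * idem (x # c)" for q
      using syt by (intro peval_intertwine JM_commutes_Alg idem_systemD(1)[OF I1]) auto
    have JK: "peval p ?J * peval q ?K = peval q ?K * peval p ?J" for p q
      by (intro peval_intertwine peval_intertwine[symmetric]) (simp add: JM_commute)
    have Q2: "?Q * peval q ?J = poly q (real_of_int x) *\<^sub>R ?Q" for q
    proof -
      have "?Q * peval q ?J = peval (lag (addable (shape (x # c))) y) ?K * (idem (x # c) * peval q ?J)"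
        unfolding Qd by (simp only: cK mult.assoc)
      also have "idem (x # c) * peval q ?J = poly q (real_of_int x) *\<^sub>R idem (x # c)"
        by (rule idem_peval[OF I(1,2)]) (use syt in auto)
      finally show ?thesis unfolding Qd cK by simp
    qed
    have Q1': "peval q ?K * ?Q = poly q (real_of_int y) *\<^sub>R ?Q" for q
      using arg_cong[OF Q1[of q], of star] by (simp add: star_mult star_peval star_JM star_scale IQ(2) del: idem.simps)
    have Q2': "peval q ?J * ?Q = poly q (real_of_int x) *\<^sub>R ?Q" for q
      using arg_cong[OF Q2[of q], of star] by (simp add: star_mult star_peval star_JM star_scale IQ(2) del: idem.simps)
    have PcQ: "idem c * ?Q = ?Q"
      using idem_systemD(5)[OF I(1) c(1)] by (simp add: mult.assoc)
    have "idem (x # y # c) * Phi n * ?Q = idem c * peval ?l ?J * (peval ?m ?K * Phi n) * ?Q"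
      using c by (simp add: mult.assoc del: shape.simps)
    also have "peval ?m ?K * Phi n = Phi n * peval ?m ?J"
      by (rule peval_intertwine[symmetric, OF Phi_JM])
    also have "idem c * peval ?l ?J * (Phi n * peval ?m ?J) * ?Q
        = idem c * (peval ?l ?J * Phi n) * (peval ?m ?J * ?Q)" by (simp only: mult.assoc)
    also have "peval ?l ?J * Phi n = Phi n * peval ?l ?K"
      by (rule peval_intertwine[symmetric, OF Phi_J'])
    also have "peval ?m ?J * ?Q = ?Q"
      unfolding Q2' using syt finite_addable[of "y # c" "Suc n"] by (subst poly_lag) auto
    also have "idem c * (Phi n * peval ?l ?K) * ?Q = (idem c * Phi n) * (peval ?l ?K * ?Q)"
      by (simp only: mult.assoc)
    also have "peval ?l ?K * ?Q = ?Q"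
      unfolding Q1' using syt c by (subst poly_lag) auto
    also have "idem c * Phi n * ?Q = Phi n * (idem c * ?Q)"
      using Phi_commutes_Alg[OF idem_systemD(1)[OF I(1) c(1)]] by (simp only: mult.assoc flip: mult.assoc)
    finally show ?thesis unfolding PcQ .
  qed
  have sq: "idem (y # x # c) * (Phi n * Phi n) = (1 - (real_of_int (x - y))\<^sup>2) *\<^sub>R idem (y # x # c)"
    if syt: "y # x # c \<in> syt (Suc (Suc n))" for x y
  proof -
    let ?Q = "idem (y # x # c)"
    have QK: "?Q * ?K = real_of_int y *\<^sub>R ?Q" by (rule idem_JM_eigen[OF I1 I(3) syt])
    have cK: "idem (x # c) * peval q ?K = peval q ?K * idem (x # c)" for q
      using syt by (intro peval_intertwine JM_commutes_Alg idem_systemD(1)[OF I1]) auto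
    have Qd: "?Q = idem (x # c) * peval (lag (addable (shape (x # c))) y) ?K"
      using c by simp
    have QJ: "?Q * ?J = real_of_int x *\<^sub>R ?Q"
    proof -
      have "?Q * ?J = peval (lag (addable (shape (x # c))) y) ?K * (idem (x # c) * ?J)"
        unfolding Qd by (simp only: cK mult.assoc)
      also have "idem (x # c) * ?J = real_of_int x *\<^sub>R idem (x # c)"
        by (rule idem_JM_eigen[OF I(1,2)]) (use syt in auto)
      finally show ?thesis unfolding Qd cK by simp
    qed
    have D: "?Q * (?J - ?K) = real_of_int (x - y) *\<^sub>R ?Q"
      by (simp only: right_diff_distrib QK QJ of_int_diff scaleR_left_diff_distrib)
    have "?Q * ((?J - ?K) * (?J - ?K)) = (?Q * (?J - ?K)) * (?J - ?K)" by (simp only: mult.assoc)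
    also have "\<dots> = (real_of_int (x - y))\<^sup>2 *\<^sub>R ?Q"
      by (simp only: D mult_scaleR_left scaleR_scaleR power2_eq_square)
    finally show ?thesis
      unfolding Phi_Phi by (simp only: right_diff_distrib mult_1_right scaleR_left_diff_distrib scaleR_one)
  qed
  let ?P = "idem (x # y # c)" and ?Q = "idem (y # x # c)"
  note IP = idem_systemD[OF I2 syt(1)] and IQ = idem_systemD[OF I2 syt(2)]
  define k where "k = (real_of_int (x - y))\<^sup>2 - 1"
  have "2\<^sup>2 \<le> \<bar>real_of_int (x - y)\<bar>\<^sup>2"
    using xy by (intro power_mono) auto
  then have k: "k > 0" by (simp add: k_def)
  have 1: "star (Phi n * ?Q) * (Phi n * ?Q) = k *\<^sub>R ?Q"
  proof -
    have "star (Phi n * ?Q) * (Phi n * ?Q) = - (?Q * (Phi n * Phi n) * ?Q)"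
      by (simp add: star_mult star_Phi IQ(2) mult.assoc del: idem.simps)
    also have "\<dots> = k *\<^sub>R ?Q"
      unfolding sq[OF syt(2)] by (simp add: IQ(4) k_def algebra_simps del: idem.simps)
    finally show ?thesis .
  qed
  have PPhi: "?P * Phi n = Phi n * ?Q"
  proof -
    have "star (?Q * Phi n * ?P) = star (Phi n * ?P)" using absorb[OF syt(2,1)] by simp
    then have "?P * Phi n * ?Q = ?P * Phi n"
      by (simp add: star_mult star_Phi IQ(2) IP(2) mult.assoc del: idem.simps)
    then show ?thesis using absorb[OF syt] by simp
  qed
  have 2: "(Phi n * ?Q) * star (Phi n * ?Q) = k *\<^sub>R ?P"
  proof -
    have "(Phi n * ?Q) * star (Phi n * ?Q) = - (Phi n * (?Q * ?Q) * Phi n)"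
      by (simp add: star_mult star_Phi IQ(2) mult.assoc del: idem.simps)
    also have "\<dots> = - (?P * (Phi n * Phi n))"
      unfolding IQ(4) PPhi[symmetric] by (simp only: mult.assoc)
    also have "\<dots> = k *\<^sub>R ?P"
      unfolding sq[OF syt(1)] by (simp add: k_def power2_commute algebra_simps del: idem.simps)
    finally show ?thesis .
  qed
  define u where "u = (1 / sqrt k) *\<^sub>R (Phi n * ?Q)"
  have "u \<in> Alg (Suc (Suc n))" unfolding u_def by (intro Alg_scale Alg_mult Phi_in_Alg IQ(1))
  moreover have "star u * u = ?Q" "u * star u = ?P"
    unfolding u_def star_scale mult_scaleR_left mult_scaleR_right 1 2 scaleR_scaleR
    using k by (simp_all add: field_simps del: idem.simps)
  ultimately show ?thesis unfolding linked_def by blast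
qed

text \<open>For different last boxes the diamond gives the chain \<open>x # a'\<close>,
  \<open>x # y # c\<close>, \<open>y # x # c\<close>, \<open>y # b'\<close>: its outer links hold by
  induction, the middle one is a swap.\<close>

lemma same_shape_linked:
  assumes "\<And>m. m \<le> n \<Longrightarrow> idem_system m" "\<And>m. m < n \<Longrightarrow> spectral m"
    and "a \<in> syt n" "b \<in> syt n" "shape a = shape b"
  shows "linked n a b"
  using assms
proof (induction n arbitrary: a b)
  case 0
  then show ?case by (auto simp: linked_def intro!: bexI[of _ 1])
next
  case (Suc n)
  have IH: "linked n a b" if "a \<in> syt n" "b \<in> syt n" "shape a = shape b" for a b
    using Suc that by auto
  obtain x a' where a: "a = x # a'" "a' \<in> syt n" "x \<in> addable (shape a')"
    using Suc(4) by (elim syt_SucE) blast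
  obtain y b' where b: "b = y # b'" "b' \<in> syt n" "y \<in> addable (shape b')"
    using Suc(5) by (elim syt_SucE) blast
  have In: "idem_system n" "spectral n" "idem_system (Suc n)" using Suc by auto
  show ?case
  proof (cases "x = y")
    case True
    then have "shape a' = shape b'" using Suc(6) a b unhop_hop by (metis shape.simps(2))
    then show ?thesis using linked_Cons[OF In(1,2)] IH a b True by auto
  next
    case False
    have "n \<noteq> 0"
    proof
      assume "n = 0"
      then have "x = 0" "y = 0" using a b by (auto simp: addable_def)
      then show False using False by simp
    qed
    then obtain m where m: "n = Suc m" by (cases n) auto
    from diamond[of x a' m y b'] obtain c where c: "x # y # c \<in> syt (Suc n)" "y # x # c \<in> syt (Suc n)"
      "shape (y # c) = shape a'" "shape (x # c) = shape b'" "2 \<le> \<bar>x - y\<bar>"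
      using Suc(4-6) a(1) b(1) False m by metis
    have 1: "linked (Suc n) (x # a') (x # y # c)"
      using c a by (intro linked_Cons[OF In(1,2)] IH) auto
    have 2: "linked (Suc n) (x # y # c) (y # x # c)"
      unfolding m using c Suc(2,3) m by (intro linked_swap) auto
    have 3: "linked (Suc n) (y # x # c) (y # b')"
      using c b by (intro linked_Cons[OF In(1,2)] IH) auto
    show ?thesis
      using linked_trans[OF In(3)] 1 2 3 c a b by (metis Suc.prems(3,4))
  qed
qed

text \<open>Replaces dimension theory: summed over all group elements v, it bounds the number of
  members of an orthogonal family.\<close>

lemma bessel:
  assumes "finite I" "v \<in> Alg n" "\<And>i. i \<in> I \<Longrightarrow> w i \<in> Alg n"
    and orth: "\<And>i j. i \<in> I \<Longrightarrow> j \<in> I \<Longrightarrow> i \<noteq> j \<Longrightarrow> tau (star (w i) * w j) = 0"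
    and pos: "\<And>i. i \<in> I \<Longrightarrow> 0 < tau (star (w i) * w i)"
  shows "(\<Sum>i\<in>I. (tau (star v * w i))\<^sup>2 / tau (star (w i) * w i)) \<le> tau (star v * v)"
proof -
  define c where "c i = tau (star v * w i) / tau (star (w i) * w i)" for i
  define s where "s = (\<Sum>i\<in>I. c i *\<^sub>R w i)"
  have sA: "s \<in> Alg n" unfolding s_def using assms by (intro Alg_sum Alg_scale) auto
  have vs: "tau (star v * s) = (\<Sum>i\<in>I. c i * tau (star v * w i))"
    by (simp add: s_def sum_distrib_left tau_sum tau_scale)
  have sv: "tau (star s * v) = tau (star v * s)"
    by (metis star_mult star_star tau_star)
  have "tau (star s * s) = (\<Sum>i\<in>I. \<Sum>j\<in>I. c i * c j * tau (star (w i) * w j))"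
    by (simp add: s_def star_sum star_scale sum_product tau_sum tau_scale mult_ac)
  also have "\<dots> = (\<Sum>i\<in>I. \<Sum>j\<in>I. if j = i then c i * c i * tau (star (w i) * w i) else 0)"
    by (intro sum.cong refl) (auto simp: orth)
  also have "\<dots> = (\<Sum>i\<in>I. c i * tau (star v * w i))"
    using assms(1) pos by (simp add: c_def) (intro sum.cong; force)
  finally have ss: "tau (star s * s) = (\<Sum>i\<in>I. c i * tau (star v * w i))" .
  have "0 \<le> tau (star (v - s) * (v - s))"
    by (subst tau_star_self[of _ n]) (auto intro: Alg_diff assms sA sum_nonneg)
  also have "\<dots> = tau (star v * v) - (\<Sum>i\<in>I. c i * tau (star v * w i))"
    using vs sv ss by (simp add: star_diff algebra_simps tau_diff tau_add)
  finally show ?thesis by (simp add: c_def power2_eq_square)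
qed

lemma card_syt_pairs: "card (SIGMA a:syt n. {b \<in> syt n. shape b = shape a}) = fact n"
  using sum_dimn[of n] by (simp add: dimn_def)

lemma primitive_if_linked:
  assumes I: "idem_system n" and link: "\<And>a b. a \<in> syt n \<Longrightarrow> b \<in> syt n \<Longrightarrow> shape a = shape b \<Longrightarrow> linked n a b"
  shows "primitive n"
proof -
  define B where "B = (SIGMA a:syt n. {b \<in> syt n. shape b = shape a})"
  \<comment> \<open>On the diagonal the idempotent itself is chosen, so that a corner element of
    trace zero is orthogonal to the whole family.\<close>
  have "\<exists>u. \<forall>(a, b)\<in>B. u (a, b) \<in> Alg n \<and> star (u (a, b)) * u (a, b) = idem b
      \<and> u (a, b) * star (u (a, b)) = idem a \<and> (a = b \<longrightarrow> u (a, b) = idem a)"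
  proof -
    have "\<exists>u. u \<in> Alg n \<and> star u * u = idem (snd p) \<and> u * star u = idem (fst p) \<and> (fst p = snd p \<longrightarrow> u = idem (fst p))"
      if "p \<in> B" for p
    proof (cases "fst p = snd p")
      case True
      then show ?thesis using that idem_systemD[OF I, of "fst p"] by (auto simp: B_def)
    next
      case False
      then show ?thesis using that link[of "fst p" "snd p"] by (auto simp: B_def linked_def)
    qed
    then have "\<exists>u. \<forall>p\<in>B. u p \<in> Alg n \<and> star (u p) * u p = idem (snd p) \<and> u p * star (u p) = idem (fst p)
        \<and> (fst p = snd p \<longrightarrow> u p = idem (fst p))" by (intro bchoice) blast
    then show ?thesis by auto
  qed
  then obtain u where u: "\<And>a b. (a, b) \<in> B \<Longrightarrow> u (a, b) \<in> Alg n"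
    "\<And>a b. (a, b) \<in> B \<Longrightarrow> star (u (a, b)) * u (a, b) = idem b"
    "\<And>a b. (a, b) \<in> B \<Longrightarrow> u (a, b) * star (u (a, b)) = idem a"
    "\<And>a. (a, a) \<in> B \<Longrightarrow> u (a, a) = idem a" by fastforce
  have absorb: "u (a, b) * idem b = u (a, b)" "idem a * u (a, b) = u (a, b)" if "(a, b) \<in> B" for a b
    using linked_absorb[OF I _ _ u(1-3)[OF that]] that by (auto simp: B_def)
  have orth: "tau (star w * u (a, b)) = 0"
    if ab: "(a, b) \<in> B" and cd: "c \<in> syt n" "d \<in> syt n" "idem c * w = w" "w * idem d = w" "(c, d) \<noteq> (a, b)" for a b c d w
  proof -
    have abs: "a \<in> syt n" "b \<in> syt n" using ab by (auto simp: B_def)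
    have w1: "star w * idem c = star w" using arg_cong[OF cd(3), of star] idem_systemD(2)[OF I cd(1)]
      by (simp add: star_mult)
    have w2: "idem d * star w = star w" using arg_cong[OF cd(4), of star] idem_systemD(2)[OF I cd(2)]
      by (simp add: star_mult)
    show ?thesis
    proof (cases "a = c")
      case False
      have "star w * u (a, b) = star w * (idem c * idem a) * u (a, b)"
        using w1 absorb(2)[OF ab] by (metis mult.assoc)
      then show ?thesis using idem_systemD(6)[OF I cd(1) abs(1)] False by simp
    next
      case True
      then have "b \<noteq> d" using cd by auto
      have "tau (star w * u (a, b)) = tau (idem d * star w * (u (a, b) * idem b))"
        using w2 absorb(1)[OF ab] by simp
      also have "\<dots> = tau (idem b * idem d * star w * u (a, b))"
        by (metis mult.assoc tau_commute)
      finally show ?thesis using idem_systemD(6)[OF I abs(2) cd(2)] \<open>b \<noteq> d\<close> by simp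
    qed
  qed
  have finB: "finite B" by (simp add: B_def)
  show ?thesis unfolding primitive_def
  proof (intro ballI)
    fix a M assume a: "a \<in> syt n" and M: "M \<in> Alg n"
    note Ia = idem_systemD[OF I a]
    \<comment> \<open>The component of the corner element orthogonal to \<open>idem a\<close>; if
      nonzero, it would extend the n! orthogonal partial isometries.\<close>
    define N where "N = idem a * M * idem a - (tau (idem a * M) / tau (idem a)) *\<^sub>R idem a"
    have NA: "N \<in> Alg n" unfolding N_def using M Ia(1) by (intro Alg_diff Alg_mult Alg_scale)
    have PN: "idem a * N = N" and NP: "N * idem a = N"
      by (simp_all add: N_def algebra_simps Ia(4,5))
    have "tau (N * idem a) = 0"
    proof -
      have "tau (idem a * M * idem a) = tau (idem a * M)"
        by (subst tau_commute) (simp add: Ia(5) mult.assoc)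
      then show ?thesis using Ia(3) by (subst NP) (simp add: N_def tau_diff tau_scale)
    qed
    then have NPa: "tau (star N * idem a) = 0"
      using Ia(2) by (metis star_mult star_star tau_commute tau_star)
    have "N = 0"
    proof (rule ccontr)
      assume "N \<noteq> 0"
      have posN: "0 < tau (star N * N)"
        using tau_star_self_eq_0[OF NA] \<open>N \<noteq> 0\<close> tau_star_self[OF NA]
        by (metis less_eq_real_def sum_nonneg zero_le_power2)
      define w where "w i = (case i of None \<Rightarrow> N | Some p \<Rightarrow> u p)" for i
      define K where "K = insert None (Some ` B)"
      have finK: "finite K" using finB by (simp add: K_def)
      have "w i \<in> Alg n" if "i \<in> K" for i
        using that NA u(1) by (auto simp: K_def w_def)
      moreover have "0 < tau (star (w i) * w i)" if "i \<in> K" for i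
        using that posN u(2) idem_systemD(3)[OF I] by (auto simp: K_def w_def B_def)
      moreover have "tau (star (w i) * w j) = 0" if "i \<in> K" "j \<in> K" "i \<noteq> j" for i j
      proof -
        have Nu: "tau (star N * u (c, d)) = 0" if "(c, d) \<in> B" for c d
        proof (cases "(c, d) = (a, a)")
          case True
          then show ?thesis using NPa u(4)[of a] that by auto
        next
          case False
          then show ?thesis using orth[OF that a a PN NP] by auto
        qed
        have uN: "tau (star (u (c, d)) * N) = 0" if "(c, d) \<in> B" for c d
          using Nu[OF that] by (metis star_mult star_star tau_star)
        have uu: "tau (star (u (c, d)) * u (e, f)) = 0" if "(c, d) \<in> B" "(e, f) \<in> B" "(c, d) \<noteq> (e, f)" for c d e f
          using orth[OF that(2) _ _ absorb(2,1)[OF that(1)] that(3)] that by (auto simp: B_def)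
        have uu': "tau (star (u p) * u q) = 0" if "p \<in> B" "q \<in> B" "p \<noteq> q" for p q
          using uu that by (cases p; cases q) blast
        have uN': "tau (star (u p) * N) = 0" "tau (star N * u p) = 0" if "p \<in> B" for p
          using Nu uN that by (cases p; simp)+
        show ?thesis
        proof (cases "i = None \<or> j = None")
          case True
          then show ?thesis using that uN' by (auto simp: K_def w_def)
        next
          case False
          then obtain p q where pq: "i = Some p" "j = Some q" by auto
          then have "p \<in> B" "q \<in> B" "p \<noteq> q" using that unfolding K_def by blast+
          then show ?thesis using uu' pq by (simp add: w_def)
        qed
      qed
      ultimately have "(\<Sum>i\<in>K. (tau (star (de g) * w i))\<^sup>2 / tau (star (w i) * w i)) \<le> tau (star (de g) * de g)"
        if "g \<in> Sym n" for g
        using bessel[OF finK Alg_de[OF that], of w] by blast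
      \<comment> \<open>Summed over g, every member of the family contributes exactly 1 on the left,
        n! + 1 in total, against n! on the right.\<close>
      then have "(\<Sum>g\<in>Sym n. \<Sum>i\<in>K. (co (w i) g)\<^sup>2 / tau (star (w i) * w i)) \<le> (\<Sum>g\<in>Sym n. 1)"
        by (intro sum_mono) (simp add: star_de tau_de_mult co_de)
      also have "(\<Sum>g\<in>Sym n. \<Sum>i\<in>K. (co (w i) g)\<^sup>2 / tau (star (w i) * w i))
          = (\<Sum>i\<in>K. (\<Sum>g\<in>Sym n. (co (w i) g)\<^sup>2) / tau (star (w i) * w i))"
        by (subst sum.swap) (simp add: sum_divide_distrib)
      also have "\<dots> = (\<Sum>i\<in>K. 1)"
      proof (rule sum.cong[OF refl])
        fix i assume i: "i \<in> K"
        have "w i \<in> Alg n" using i NA u(1) by (auto simp: K_def w_def)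
        moreover have "0 < tau (star (w i) * w i)"
          using i posN u(2) idem_systemD(3)[OF I] by (auto simp: K_def w_def B_def)
        ultimately show "(\<Sum>g\<in>Sym n. (co (w i) g)\<^sup>2) / tau (star (w i) * w i) = 1"
          by (simp add: tau_star_self)
      qed
      also have "\<dots> = 1 + fact n"
        using finB card_syt_pairs[of n] by (simp add: K_def card_image B_def[symmetric])
      finally show False by (simp add: card_Sym)
    qed
    then show "idem a * M * idem a = (tau (idem a * M) / tau (idem a)) *\<^sub>R idem a" by (simp add: N_def)
  qed
qed

text \<open>The dependence is not circular: linking at n relies on idempotents up to n but on
  spectral measures below n only, and those at n rest on all three properties at n - 1.\<close>

lemma all_levels: "idem_system n \<and> spectral n \<and> primitive n"
proof (induction n rule: less_induct)
  case (less n)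
  have IS: "idem_system n \<and> spectral n"
  proof (cases n)
    case 0
    then show ?thesis using idem_system_0 spectral_0 by simp
  next
    case (Suc m)
    then show ?thesis using less[of m] idem_system_Suc spectral_Suc by blast
  qed
  have "idem_system m" if "m \<le> n" for m
    using less IS that by (cases "m = n") auto
  moreover have "spectral m" if "m < n" for m
    using less that by auto
  ultimately have "primitive n"
    using IS same_shape_linked by (intro primitive_if_linked) auto
  then show ?case using IS by simp
qed

lemma idem_props:
  assumes "a \<in> syt n"
  shows "idem a \<in> Alg n" "star (idem a) = idem a" "0 < tau (idem a)" "idem a * idem a = idem a"
    "b \<in> syt n \<Longrightarrow> a \<noteq> b \<Longrightarrow> idem a * idem b = 0"
  using idem_systemD[OF _ assms] all_levels by auto

lemma sum_idem: "(\<Sum>a\<in>syt n. idem a) = 1"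
  using all_levels[of n] by (simp add: idem_system_def)

lemma idem_corner: "a \<in> syt n \<Longrightarrow> M \<in> Alg n \<Longrightarrow> idem a * M * idem a = (tau (idem a * M) / tau (idem a)) *\<^sub>R idem a"
  using all_levels[of n] by (auto simp: primitive_def)

text \<open>The partial isometries from a to the tableaux of its shape are orthogonal elements of
  the left ideal of \<open>idem a\<close>. Bessel's inequality for the vectors
  \<open>de g * idem a\<close>, summed over g, counts them.\<close>

lemma dimn_le_tau:
  assumes a: "a \<in> syt n"
  shows "real (dimn n (shape a)) \<le> fact n * tau (idem a)"
proof -
  define B where "B = {b \<in> syt n. shape b = shape a}"
  have I: "idem_system n" using all_levels by blast
  note Ia = idem_props[OF a]
  have "\<forall>b\<in>B. \<exists>u. u \<in> Alg n \<and> star u * u = idem a \<and> u * star u = idem b"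
  proof
    fix b assume "b \<in> B"
    then have "linked n b a"
      using all_levels a by (intro same_shape_linked) (simp_all add: B_def)
    then show "\<exists>u. u \<in> Alg n \<and> star u * u = idem a \<and> u * star u = idem b"
      by (auto simp: linked_def)
  qed
  then obtain u where u: "\<And>b. b \<in> B \<Longrightarrow> u b \<in> Alg n" "\<And>b. b \<in> B \<Longrightarrow> star (u b) * u b = idem a"
    "\<And>b. b \<in> B \<Longrightarrow> u b * star (u b) = idem b" by metis
  have absorb: "u b * idem a = u b" "idem b * u b = u b" if "b \<in> B" for b
    using linked_absorb[OF I _ a u[OF that]] that by (auto simp: B_def)
  have orth: "tau (star (u b) * u c) = 0" if "b \<in> B" "c \<in> B" "b \<noteq> c" for b c
  proof -
    have bc: "b \<in> syt n" "c \<in> syt n" using that by (auto simp: B_def)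
    have "star (idem b * u b) = star (u b)" using absorb(2)[OF that(1)] by simp
    then have "star (u b) * idem b = star (u b)" using idem_props(2)[OF bc(1)] by (simp add: star_mult)
    then have "star (u b) * u c = star (u b) * (idem b * idem c) * u c"
      using absorb(2)[OF that(2)] by (metis mult.assoc)
    then show ?thesis using idem_props(5)[OF bc] that by simp
  qed
  have finB: "finite B" by (simp add: B_def)
  have "(\<Sum>b\<in>B. (co (u b) g)\<^sup>2 / tau (idem a)) \<le> tau (idem a)" if g: "g \<in> Sym n" for g
  proof -
    let ?v = "de g * idem a"
    have vA: "?v \<in> Alg n" using g Ia(1) by (intro Alg_mult Alg_de)
    have sv: "star ?v = idem a * de (- g)" by (simp add: star_mult Ia(2) star_de)
    have "tau (star ?v * u b) = co (u b) g" if "b \<in> B" for b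
    proof -
      have "tau (star ?v * u b) = tau (de (- g) * (u b * idem a))"
        unfolding sv by (metis mult.assoc tau_commute)
      then show ?thesis using absorb(1)[OF that] by (simp add: tau_de_mult)
    qed
    moreover have "tau (star ?v * ?v) = tau (idem a)"
    proof -
      have "star ?v * ?v = idem a * (de (- g) * de g) * idem a" unfolding sv by (simp only: mult.assoc)
      then show ?thesis by (simp add: de_0 Ia(4) flip: de_plus)
    qed
    ultimately show ?thesis
      using bessel[OF finB vA, of u] u orth Ia(3) by simp
  qed
  then have "(\<Sum>g\<in>Sym n. \<Sum>b\<in>B. (co (u b) g)\<^sup>2 / tau (idem a)) \<le> (\<Sum>g\<in>Sym n. tau (idem a))"
    by (rule sum_mono)
  also have "(\<Sum>g\<in>Sym n. \<Sum>b\<in>B. (co (u b) g)\<^sup>2 / tau (idem a))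
      = (\<Sum>b\<in>B. (\<Sum>g\<in>Sym n. (co (u b) g)\<^sup>2) / tau (idem a))"
    by (subst sum.swap) (simp add: sum_divide_distrib)
  also have "\<dots> = (\<Sum>b\<in>B. 1)"
    by (rule sum.cong[OF refl]) (use u Ia(3) in \<open>simp add: tau_star_self[symmetric]\<close>)
  finally show ?thesis by (simp add: card_Sym B_def dimn_def)
qed


section \<open>The average commutator and the words\<close>

lemma sum_Sym_translate: "g \<in> Sym n \<Longrightarrow> (\<Sum>x\<in>Sym n. f (g + x)) = (\<Sum>x\<in>Sym n. f x)"
  by (rule sum.reindex_bij_witness[of _ "\<lambda>x. - g + x" "\<lambda>x. g + x"])
    (auto simp: plus_in_Sym add.assoc[symmetric])

lemma sum_Sym_translate': "g \<in> Sym n \<Longrightarrow> (\<Sum>x\<in>Sym n. f (x + g)) = (\<Sum>x\<in>Sym n. f x)"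
  by (rule sum.reindex_bij_witness[of _ "\<lambda>x. x + - g" "\<lambda>x. x + g"])
    (auto simp: plus_in_Sym add.assoc simp del: add_uminus_conv_diff)

lemma sum_Sym_uminus: "(\<Sum>x\<in>Sym n. f (- x)) = (\<Sum>x\<in>Sym n. f x)"
  by (rule sum.reindex_bij_witness[of _ uminus uminus]) auto

lemma sum_Sym_conj: "g \<in> Sym n \<Longrightarrow> (\<Sum>x\<in>Sym n. f (g + x + - g)) = (\<Sum>x\<in>Sym n. f x)"
  using sum_Sym_translate'[of "- g" n "\<lambda>x. f (g + x)"] sum_Sym_translate[of g n f]
  by (simp add: add.assoc del: add_uminus_conv_diff)

definition conj_sum :: "nat \<Rightarrow> galg \<Rightarrow> galg" where
  "conj_sum n M = (\<Sum>x\<in>Sym n. de x * M * de (- x))"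

lemma conj_sum_in_Alg: "M \<in> Alg n \<Longrightarrow> conj_sum n M \<in> Alg n"
  unfolding conj_sum_def by (intro Alg_sum Alg_mult Alg_de) auto

lemma conj_sum_central:
  assumes "N \<in> Alg n"
  shows "N * conj_sum n M = conj_sum n M * N"
  using assms
proof (induction N rule: Alg_induct)
  case (de g)
  have "de g * conj_sum n M = (\<Sum>x\<in>Sym n. de (g + x) * M * de (- (g + x)) * de g)"
    by (simp add: conj_sum_def sum_distrib_left de_plus minus_add mult.assoc)
      (simp add: de_0 flip: de_plus mult.assoc)
  also have "\<dots> = (\<Sum>x\<in>Sym n. de x * M * de (- x) * de g)"
    by (rule sum_Sym_translate[OF de])
  finally show ?case by (simp add: conj_sum_def sum_distrib_right)
qed (auto simp: algebra_simps)

lemma tau_conj_sum: "tau (conj_sum n M * N) = tau (M * conj_sum n N)"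
proof -
  have "tau (conj_sum n M * N) = (\<Sum>x\<in>Sym n. tau (M * (de (- x) * N * de x)))"
    unfolding conj_sum_def sum_distrib_right tau_sum
    by (rule sum.cong[OF refl]) (metis mult.assoc tau_commute)
  also have "\<dots> = (\<Sum>x\<in>Sym n. tau (M * (de (- x) * N * de (- (- x)))))" by simp
  also have "\<dots> = (\<Sum>x\<in>Sym n. tau (M * (de x * N * de (- x))))"
    by (rule sum_Sym_uminus)
  finally show ?thesis by (simp add: conj_sum_def sum_distrib_left tau_sum)
qed

definition comm_sum :: "nat \<Rightarrow> galg" where
  "comm_sum n = (\<Sum>x\<in>Sym n. \<Sum>y\<in>Sym n. de (x + y + - x + - y))"

lemma comm_sum_eq: "comm_sum n = (\<Sum>y\<in>Sym n. conj_sum n (de y) * de (- y))"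
  unfolding comm_sum_def conj_sum_def sum_distrib_right
  by (subst sum.swap) (simp add: de_plus del: add_uminus_conv_diff)

lemma comm_sum_central:
  assumes "N \<in> Alg n"
  shows "N * comm_sum n = comm_sum n * N"
  using assms
proof (induction N rule: Alg_induct)
  case (de g)
  let ?f = "\<lambda>x y. de (x + y + - x + - y) * de g"
  have "de g * comm_sum n = (\<Sum>x\<in>Sym n. \<Sum>y\<in>Sym n. ?f (g + x + - g) (g + y + - g))"
    by (simp add: comm_sum_def sum_distrib_left minus_add add.assoc
        del: add_uminus_conv_diff flip: de_plus)
  also have "\<dots> = (\<Sum>x\<in>Sym n. \<Sum>y\<in>Sym n. ?f (g + x + - g) y)"
    by (intro sum.cong refl sum_Sym_conj[OF de])
  also have "\<dots> = (\<Sum>x\<in>Sym n. \<Sum>y\<in>Sym n. ?f x y)"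
    by (rule sum_Sym_conj[OF de])
  finally show ?case by (simp add: comm_sum_def sum_distrib_right)
qed (auto simp: algebra_simps)

text \<open>The dimension of the left ideal of \<open>Alg n\<close> generated by
  \<open>idem a\<close>, that is, the degree of the irreducible representation.\<close>

definition deg :: "nat \<Rightarrow> int list \<Rightarrow> real" where
  "deg n a = fact n * tau (idem a)"

lemma deg_pos: "a \<in> syt n \<Longrightarrow> 0 < deg n a"
  by (simp add: deg_def idem_props(3))

lemma dimn_le_deg: "a \<in> syt n \<Longrightarrow> dimn n (shape a) \<le> deg n a"
  by (simp add: deg_def dimn_le_tau)

lemma central_mult_idem:
  assumes a: "a \<in> syt n" and "M \<in> Alg n" and "\<And>N. N \<in> Alg n \<Longrightarrow> N * M = M * N"
  shows "M * idem a = (tau (idem a * M) / tau (idem a)) *\<^sub>R idem a"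
proof -
  have "M * idem a = M * (idem a * idem a)" by (simp add: idem_props(4)[OF a])
  also have "\<dots> = idem a * M * idem a" using assms(3)[OF idem_props(1)[OF a]] by (simp add: mult.assoc)
  finally show ?thesis by (simp add: idem_corner[OF a assms(2)])
qed

text \<open>A central element is a scalar on \<open>idem a\<close>. Scalar corners turn each summand
  into a squared coefficient of \<open>idem a\<close>, and these squares add up to its
  trace.\<close>

lemma conj_sum_idem_mult_idem:
  assumes a: "a \<in> syt n"
  shows "conj_sum n (idem a) * idem a = (1 / tau (idem a)) *\<^sub>R idem a"
proof -
  note p = idem_props[OF a]
  have "tau (idem a * (de x * idem a * de (- x))) = (co (idem a) x)\<^sup>2 / tau (idem a)" if "x \<in> Sym n" for x
  proof -
    have "idem a * (de x * idem a * de (- x)) = (idem a * de x * idem a) * de (- x)" by (simp add: mult.assoc)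
    also have "idem a * de x * idem a = (co (idem a) (- x) / tau (idem a)) *\<^sub>R idem a"
      by (simp add: idem_corner[OF a Alg_de[OF that]] tau_mult_de)
    also have "co (idem a) (- x) = co (idem a) x" using co_star[of "idem a" x] p(2) by simp
    finally show ?thesis by (simp add: tau_scale tau_mult_de power2_eq_square)
  qed
  then have "tau (idem a * conj_sum n (idem a)) = (\<Sum>x\<in>Sym n. (co (idem a) x)\<^sup>2 / tau (idem a))"
    by (simp add: conj_sum_def sum_distrib_left tau_sum)
  also have "\<dots> = tau (star (idem a) * idem a) / tau (idem a)"
    by (simp add: tau_star_self[OF p(1)] sum_divide_distrib)
  also have "\<dots> = 1" using p by simp
  finally show ?thesis
    using central_mult_idem[OF a conj_sum_in_Alg[OF p(1)] conj_sum_central] by simp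
qed

text \<open>Frobenius' formula: on the block of \<^term>\<open>idem a\<close>, which has degree \<^term>\<open>deg n a\<close>, the
  average of all commutators is the scalar \<open>1 / (deg n a)\<^sup>2\<close>.\<close>
lemma comm_sum_mult_idem:
  assumes a: "a \<in> syt n"
  shows "comm_sum n * idem a = ((fact n)\<^sup>2 / (deg n a)\<^sup>2) *\<^sub>R idem a"
proof -
  note p = idem_props[OF a]
  have "conj_sum n (de y) * de (- y) * idem a = (1 / tau (idem a)) *\<^sub>R (co (conj_sum n (idem a)) (- y) *\<^sub>R de (- y)) * idem a"
    if "y \<in> Sym n" for y
  proof -
    have yA: "conj_sum n (de y) \<in> Alg n" using that by (simp add: conj_sum_in_Alg Alg_de)
    have "conj_sum n (de y) * de (- y) * idem a = de (- y) * (conj_sum n (de y) * idem a)"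
      using conj_sum_central[of "de (- y)" n "de y"] that by (simp add: Alg_de mult.assoc[symmetric])
    also have "conj_sum n (de y) * idem a = (tau (idem a * conj_sum n (de y)) / tau (idem a)) *\<^sub>R idem a"
      by (rule central_mult_idem[OF a yA conj_sum_central])
    also have "tau (idem a * conj_sum n (de y)) = co (conj_sum n (idem a)) (- y)"
      by (simp add: tau_conj_sum[symmetric] tau_mult_de)
    finally show ?thesis by simp
  qed
  then have "comm_sum n * idem a
      = (\<Sum>y\<in>Sym n. (1 / tau (idem a)) *\<^sub>R (co (conj_sum n (idem a)) (- y) *\<^sub>R de (- y)) * idem a)"
    by (simp add: comm_sum_eq sum_distrib_right)
  also have "\<dots> = (\<Sum>y\<in>Sym n. (1 / tau (idem a)) *\<^sub>R (co (conj_sum n (idem a)) y *\<^sub>R de y) * idem a)"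
    by (rule sum_Sym_uminus)
  also have "\<dots> = (1 / tau (idem a)) *\<^sub>R (\<Sum>y\<in>Sym n. co (conj_sum n (idem a)) y *\<^sub>R de y) * idem a"
    by (simp add: scaleR_sum_right sum_distrib_right)
  also have "(\<Sum>y\<in>Sym n. co (conj_sum n (idem a)) y *\<^sub>R de y) = conj_sum n (idem a)"
    by (rule Alg_expand[symmetric, OF conj_sum_in_Alg[OF p(1)]])
  finally show ?thesis
    using conj_sum_idem_mult_idem[OF a] by (simp add: deg_def power_mult_distrib power2_eq_square)
qed

lemma comm_sum_power_eq:
  "comm_sum n ^ g = (\<Sum>a\<in>syt n. ((fact n)\<^sup>2 / (deg n a)\<^sup>2) ^ g *\<^sub>R idem a)"
proof -
  have "comm_sum n ^ g * idem a = ((fact n)\<^sup>2 / (deg n a)\<^sup>2) ^ g *\<^sub>R idem a" if "a \<in> syt n" for a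
  proof (induction g)
    case (Suc g)
    have "comm_sum n ^ Suc g * idem a = comm_sum n * (comm_sum n ^ g * idem a)"
      by (simp add: mult.assoc)
    then show ?case by (simp add: Suc comm_sum_mult_idem[OF that])
  qed simp
  then have "comm_sum n ^ g * (\<Sum>a\<in>syt n. idem a) = (\<Sum>a\<in>syt n. ((fact n)\<^sup>2 / (deg n a)\<^sup>2) ^ g *\<^sub>R idem a)"
    unfolding sum_distrib_left by (intro sum.cong) auto
  then show ?thesis by (simp add: sum_idem)
qed

section \<open>Words in independent uniform letters\<close>

fun tuples :: "nat \<Rightarrow> nat \<Rightarrow> fperm list set" where
  "tuples n 0 = {[]}"
| "tuples n (Suc k) = (\<lambda>(x, gs). x # gs) ` (Sym n \<times> tuples n k)"

lemma in_tuples_iff: "gs \<in> tuples n k \<longleftrightarrow> length gs = k \<and> set gs \<subseteq> Sym n"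
  by (induction k arbitrary: gs) (auto simp: image_iff length_Suc_conv)

lemma finite_tuples [simp]: "finite (tuples n k)"
  by (induction k) auto

lemma sum_tuples_Suc:
  "(\<Sum>gs\<in>tuples n (Suc k). f gs) = (\<Sum>x\<in>Sym n. \<Sum>gs\<in>tuples n k. f (x # gs))"
  by (simp add: sum.reindex inj_on_def sum.cartesian_product split_def)

definition comm_word :: "fperm list \<Rightarrow> fperm" where
  "comm_word gs = sum_list gs + sum_list (map uminus gs)"

lemma sum_list_in_Sym: "set gs \<subseteq> Sym n \<Longrightarrow> sum_list gs \<in> Sym n"
  by (induction gs) (auto simp: plus_in_Sym)

text \<open>The substitution \<open>x \<mapsto> X x\<close>, \<open>y \<mapsto> y X\<^sup>-\<^sup>1\<close> turns \<open>x y X x\<^sup>-\<^sup>1 y\<^sup>-\<^sup>1 Y\<close> into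
  \<open>X [x, y] Y\<close>, so each pair of letters contributes one independent commutator.\<close>
lemma sum_comm_word_Suc_Suc:
  "(\<Sum>gs\<in>tuples n (Suc (Suc k)). de (comm_word gs)) = comm_sum n * (\<Sum>gs\<in>tuples n k. de (comm_word gs))"
proof -
  have "(\<Sum>x\<in>Sym n. \<Sum>y\<in>Sym n. de (comm_word (x # y # gs))) = comm_sum n * de (comm_word gs)"
    if gs: "gs \<in> tuples n k" for gs
  proof -
    define X where "X = sum_list gs"
    define Y where "Y = sum_list (map uminus gs)"
    have X: "X \<in> Sym n" using gs by (simp add: X_def in_tuples_iff sum_list_in_Sym)
    let ?f = "\<lambda>x y. de (x + y + X + - x + - y + Y)"
    have "(\<Sum>x\<in>Sym n. \<Sum>y\<in>Sym n. de (comm_word (x # y # gs))) = (\<Sum>x\<in>Sym n. \<Sum>y\<in>Sym n. ?f x y)"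
      by (simp add: comm_word_def X_def Y_def add.assoc del: add_uminus_conv_diff)
    also have "\<dots> = (\<Sum>x\<in>Sym n. \<Sum>y\<in>Sym n. ?f (X + x) (y + - X))"
      using sum_Sym_translate[OF X, of "\<lambda>x. \<Sum>y\<in>Sym n. ?f x y"] X
      by (simp add: sum_Sym_translate'[of "- X" n "?f _"] del: add_uminus_conv_diff)
    also have "\<dots> = (\<Sum>x\<in>Sym n. \<Sum>y\<in>Sym n. de X * de (x + y + - x + - y) * de Y)"
      by (simp add: minus_add add.assoc del: add_uminus_conv_diff flip: de_plus)
    also have "\<dots> = de X * comm_sum n * de Y"
      by (simp add: comm_sum_def sum_distrib_left sum_distrib_right)
    also have "\<dots> = comm_sum n * de (X + Y)"
      by (simp add: comm_sum_central[OF Alg_de[OF X]] de_plus mult.assoc)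
    finally show ?thesis by (simp add: comm_word_def X_def Y_def)
  qed
  then have "(\<Sum>gs\<in>tuples n k. \<Sum>x\<in>Sym n. \<Sum>y\<in>Sym n. de (comm_word (x # y # gs)))
      = (\<Sum>gs\<in>tuples n k. comm_sum n * de (comm_word gs))"
    by (intro sum.cong) auto
  moreover have "(\<Sum>gs\<in>tuples n (Suc (Suc k)). de (comm_word gs))
      = (\<Sum>gs\<in>tuples n k. \<Sum>x\<in>Sym n. \<Sum>y\<in>Sym n. de (comm_word (x # y # gs)))"
  proof -
    let ?h = "\<lambda>x y gs. de (comm_word (x # y # gs))"
    have "(\<Sum>x\<in>Sym n. \<Sum>y\<in>Sym n. \<Sum>gs\<in>tuples n k. ?h x y gs)
        = (\<Sum>x\<in>Sym n. \<Sum>gs\<in>tuples n k. \<Sum>y\<in>Sym n. ?h x y gs)"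
      by (intro sum.cong refl sum.swap)
    also have "\<dots> = (\<Sum>gs\<in>tuples n k. \<Sum>x\<in>Sym n. \<Sum>y\<in>Sym n. ?h x y gs)"
      by (rule sum.swap)
    finally show ?thesis unfolding sum_tuples_Suc .
  qed
  ultimately show ?thesis by (simp add: sum_distrib_left)
qed

text \<open>For odd k the letter left after pairing forms the word x x^-1, which is trivial, and
  contributes only the factor n!.\<close>

lemma sum_comm_word:
  "(\<Sum>gs\<in>tuples n k. de (comm_word gs)) = (fact n) ^ (k mod 2) *\<^sub>R comm_sum n ^ (k div 2)"
proof (induction k rule: induct_nat_012)
  case 0
  show ?case by (simp add: comm_word_def de_0)
next
  case 1
  have "(\<Sum>gs\<in>tuples n (Suc 0). de (comm_word gs)) = (\<Sum>x\<in>Sym n. 1)"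
    unfolding sum_tuples_Suc by (simp add: comm_word_def de_0 del: tuples.simps(2))
  then show ?case by (simp add: card_Sym of_nat_fact scaleR_conv_of_real)
next
  case (ge2 k)
  then show ?case by (simp only: sum_comm_word_Suc_Suc) simp
qed

lemma sum_comm_word_fun:
  "(\<Sum>gs\<in>tuples n k. h (comm_word gs)) = (\<Sum>g\<in>Sym n. h g * co (\<Sum>gs\<in>tuples n k. de (comm_word gs)) g)"
proof -
  have "comm_word gs \<in> Sym n" if "gs \<in> tuples n k" for gs
  proof -
    have "set gs \<subseteq> Sym n" using that by (simp add: in_tuples_iff)
    then have "set (map uminus gs) \<subseteq> Sym n" by auto
    with \<open>set gs \<subseteq> Sym n\<close> show ?thesis by (simp add: comm_word_def plus_in_Sym sum_list_in_Sym)
  qed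
  then have "(\<Sum>gs\<in>tuples n k. h (comm_word gs))
      = (\<Sum>gs\<in>tuples n k. \<Sum>g\<in>Sym n. h g * co (de (comm_word gs)) g)"
    by (intro sum.cong refl) (simp add: co_de if_distrib cong: if_cong)
  also have "\<dots> = (\<Sum>g\<in>Sym n. h g * co (\<Sum>gs\<in>tuples n k. de (comm_word gs)) g)"
    by (subst sum.swap) (simp add: lookup_sum sum_distrib_left)
  finally show ?thesis .
qed

section \<open>Single rows (\<open>e = 1\<close>) and columns (\<open>e = -1\<close>): the trivial
  and the sign character\<close>

fun line :: "int \<Rightarrow> nat \<Rightarrow> int list" where
  "line e 0 = []"
| "line e (Suc n) = e * int n # line e n"

lemma shape_row: "shape (line 1 n) = {-1..} - {int n - 1}"
proof (induction n)
  case 0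
  have "x \<in> {0..} \<longleftrightarrow> x \<in> {-1..} - {- 1}" for x :: int by (simp, arith)
  then show ?case by auto
next
  case (Suc n)
  have "x \<in> hop ({-1..} - {int n - 1}) (int n) \<longleftrightarrow> x \<in> {-1..} - {int n}" for x
    by (simp add: hop_def, arith)
  then show ?case using Suc by auto
qed

lemma shape_col: "shape (line (-1) n) = insert (- int n) {1..}"
proof (induction n)
  case 0
  have "x \<in> {0..} \<longleftrightarrow> x \<in> insert 0 {1..}" for x :: int by (simp, arith)
  then show ?case by auto
next
  case (Suc n)
  have "x \<in> hop (insert (- int n) {1..}) (- int n) \<longleftrightarrow> x \<in> insert (- int n - 1) {1..}" for x
    by (simp add: hop_def)
  then show ?case using Suc by auto
qed

lemma line_in_syt:
  assumes "e = 1 \<or> e = - 1"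
  shows "line e n \<in> syt n"
proof (induction n)
  case (Suc n)
  have "e * int n \<in> addable (shape (line e n))"
    using assms by (elim disjE) (simp_all add: shape_row shape_col addable_def)
  then show ?case using Suc by simp
qed simp

lemma length_line [simp]: "length (line e n) = n"
  by (induction n) auto

text \<open>A row has one corner and removing it leaves a row, so its tableau is unique. The
  separate k serves \<open>lin\<close>, which does not record the number of boxes.\<close>

lemma shape_eq_row_iff:
  assumes "a \<in> syt n"
  shows "shape a = shape (line 1 k) \<longleftrightarrow> k = n \<and> a = line 1 n"
  using assms
proof (induction n arbitrary: a k)
  case 0
  have "k = 0" if "shape (line 1 k) = {0..}"
  proof -
    have "-1 \<notin> shape (line 1 k)" using that by simp
    then show ?thesis unfolding shape_row by simp
  qed
  then show ?case using 0 by auto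
next
  case (Suc n)
  then obtain x b where a: "a = x # b" "b \<in> syt n" "x \<in> addable (shape b)" by (elim syt_SucE) blast
  have x: "x \<in> removable (shape a)" "shape b = unhop (shape a) x"
    using a removable_hop unhop_hop by auto
  show ?case
  proof
    assume sh: "shape a = shape (line 1 k)"
    have "x \<in> removable ({-1..} - {int k - 1})" using x(1) unfolding sh shape_row .
    then have "x = int k - 1 \<and> k \<noteq> 0" unfolding removable_def by (simp, arith)
    then obtain j where j: "k = Suc j" "x = int j" by (cases k) auto
    then have "shape b = shape (line 1 j)"
      using x(2) sh unhop_hop[of "int j" "shape (line 1 j)"] line_in_syt[of 1 "Suc j"] by simp
    then show "k = Suc n \<and> a = line 1 (Suc n)" using Suc(1)[OF a(2)] j a by simp
  qed auto
qed

lemma shape_eq_col_iff: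
  assumes "a \<in> syt n"
  shows "shape a = shape (line (-1) k) \<longleftrightarrow> k = n \<and> a = line (-1) n"
  using assms
proof (induction n arbitrary: a k)
  case 0
  have "k = 0" if "shape (line (-1) k) = {0..}"
  proof -
    have "0 \<in> shape (line (-1) k)" using that by simp
    then show ?thesis unfolding shape_col by simp
  qed
  then show ?case using 0 by auto
next
  case (Suc n)
  then obtain x b where a: "a = x # b" "b \<in> syt n" "x \<in> addable (shape b)" by (elim syt_SucE) blast
  have x: "x \<in> removable (shape a)" "shape b = unhop (shape a) x"
    using a removable_hop unhop_hop by auto
  show ?case
  proof
    assume sh: "shape a = shape (line (-1) k)"
    have "x \<in> removable (insert (- int k) {1..})" using x(1) unfolding sh shape_col .
    then have "x = 1 - int k \<and> k \<noteq> 0" unfolding removable_def by (simp, arith)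
    then obtain j where j: "k = Suc j" "x = - int j" by (cases k) auto
    then have "shape b = shape (line (-1) j)"
      using x(2) sh unhop_hop[of "- int j" "shape (line (-1) j)"] line_in_syt[of "-1" "Suc j"] by simp
    then show "k = Suc n \<and> a = line (-1) (Suc n)" using Suc(1)[OF a(2)] j a by simp
  qed auto
qed

text \<open>The trivial character for \<open>e = 1\<close>, the sign character otherwise.\<close>
definition chi :: "int \<Rightarrow> fperm \<Rightarrow> int" where
  "chi e g = (if e = 1 then 1 else sign (app g))"

lemma permutation_app [simp]: "permutation (app g)"
  using app[of g] by simp

lemma chi_plus: "chi e (g + h) = chi e g * chi e h"
  by (simp add: chi_def app_plus sign_compose)

lemma chi_uminus: "chi e (- g) = chi e g"
  by (simp add: chi_def app_uminus sign_inverse)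

lemma chi_square: "chi e g * chi e g = 1"
  by (simp add: chi_def sign_def)

lemma chi_tr: "e = 1 \<or> e = -1 \<Longrightarrow> i \<noteq> j \<Longrightarrow> chi e (tr i j) = e"
  by (auto simp: chi_def app_tr sign_swap_id)

definition chi_idem :: "nat \<Rightarrow> int \<Rightarrow> galg" where
  "chi_idem n e = (1 / fact n) *\<^sub>R (\<Sum>g\<in>Sym n. real_of_int (chi e g) *\<^sub>R de g)"

lemma co_chi_idem: "g \<in> Sym n \<Longrightarrow> co (chi_idem n e) g = real_of_int (chi e g) / fact n"
  by (simp add: chi_idem_def lookup_sum co_de if_distrib cong: if_cong)

lemma chi_idem_in_Alg: "chi_idem n e \<in> Alg n"
  unfolding chi_idem_def by (intro Alg_scale Alg_sum Alg_de)

lemma chi_idem_mult_de: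
  assumes "h \<in> Sym n"
  shows "chi_idem n e * de h = real_of_int (chi e h) *\<^sub>R chi_idem n e"
proof -
  have "(\<Sum>g\<in>Sym n. real_of_int (chi e g) *\<^sub>R de g) * de h
      = (\<Sum>g\<in>Sym n. real_of_int (chi e h) *\<^sub>R (real_of_int (chi e (g + h)) *\<^sub>R de (g + h)))"
    unfolding sum_distrib_right
    by (intro sum.cong) (simp_all add: chi_plus de_plus chi_square mult.left_commute[of "real_of_int (chi e h)"]
        flip: of_int_mult)
  also have "\<dots> = (\<Sum>g\<in>Sym n. real_of_int (chi e h) *\<^sub>R (real_of_int (chi e g) *\<^sub>R de g))"
    by (rule sum_Sym_translate'[OF assms])
  also have "\<dots> = real_of_int (chi e h) *\<^sub>R (\<Sum>g\<in>Sym n. real_of_int (chi e g) *\<^sub>R de g)"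
    by (rule scaleR_sum_right[symmetric])
  finally show ?thesis by (simp add: chi_idem_def mult.commute)
qed

lemma chi_idem_mult_JM:
  assumes "e = 1 \<or> e = -1" "m < n"
  shows "chi_idem n e * JM (Suc m) = real_of_int (e * int m) *\<^sub>R chi_idem n e"
proof -
  have "chi_idem n e * JM (Suc m) = (\<Sum>i\<in>{1..m}. real_of_int e *\<^sub>R chi_idem n e)"
    unfolding JM_Suc sum_distrib_left
    using assms by (intro sum.cong refl) (subst chi_idem_mult_de, auto simp: chi_tr intro!: tr_in_Sym)
  also have "\<dots> = real_of_int (e * int m) *\<^sub>R chi_idem n e"
    by (simp only: sum_constant_scaleR) simp
  finally show ?thesis .
qed

lemma chi_idem_mult_idem_line:
  assumes e: "e = 1 \<or> e = -1"
  shows "m \<le> n \<Longrightarrow> chi_idem n e * idem (line e m) = chi_idem n e"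
proof (induction m)
  case (Suc m)
  have l: "line e m \<in> syt m" "e * int m \<in> addable (shape (line e m))"
    using line_in_syt[OF e, of "Suc m"] by auto
  have "chi_idem n e * idem (line e (Suc m)) = chi_idem n e * idem (line e m)
      * peval (lag (addable (shape (line e m))) (e * int m)) (JM (Suc m))"
    by (simp add: mult.assoc)
  also have "chi_idem n e * idem (line e m) = chi_idem n e" using Suc by simp
  also have "chi_idem n e * peval (lag (addable (shape (line e m))) (e * int m)) (JM (Suc m)) = chi_idem n e"
    using peval_eigen[OF chi_idem_mult_JM[OF e, of m n], of "lag (addable (shape (line e m))) (e * int m)"] Suc
      poly_lag[OF finite_addable[OF l(1)] l(2) l(2)] by simp
  finally show ?case .
qed simp

text \<open>Absorption on both sides and the scalar corner make \<open>chi_idem n e\<close> a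
  multiple t of the tableau idempotent. Idempotence forces t to be 0 or 1, and the trace 1 / n!
  excludes 0.\<close>

lemma idem_line:
  assumes e: "e = 1 \<or> e = -1"
  shows "idem (line e n) = chi_idem n e"
proof -
  let ?c = "chi_idem n e" and ?P = "idem (line e n)"
  note p = idem_props[OF line_in_syt[OF e, of n]]
  have cP: "?c * ?P = ?c" by (rule chi_idem_mult_idem_line[OF e order_refl])
  have "star ?c = ?c"
    unfolding chi_idem_def star_scale star_sum star_de
    using sum_Sym_uminus[of "\<lambda>g. real_of_int (chi e g) *\<^sub>R de g" n] by (simp add: chi_uminus)
  then have "?P * ?c = ?c" using arg_cong[OF cP, of star] p(2) by (simp add: star_mult)
  define t where "t = tau (?P * ?c) / tau ?P"
  have c: "?c = t *\<^sub>R ?P"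
    using idem_corner[OF line_in_syt[OF e] chi_idem_in_Alg, of n e] cP \<open>?P * ?c = ?c\<close> by (simp add: t_def)
  then have "t *\<^sub>R ?P = t *\<^sub>R ?P * ?P" using p by simp
  have "tau ?c = 1 / fact n"
    using co_chi_idem[of 0 n e] by (simp add: tau_def chi_def app_zero)
  have "?c * ?c = (\<Sum>g\<in>Sym n. (real_of_int (chi e g) / fact n) *\<^sub>R (?c * de g))"
    by (subst (2) Alg_expand[OF chi_idem_in_Alg]) (simp add: sum_distrib_left co_chi_idem)
  also have "\<dots> = (\<Sum>g\<in>Sym n. (1 / fact n) *\<^sub>R ?c)"
    by (intro sum.cong refl) (simp add: chi_idem_mult_de chi_square flip: of_int_mult)
  also have "\<dots> = ?c" by (simp only: sum_constant_scaleR card_Sym) (simp add: of_nat_fact)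
  finally have "?c * ?c = ?c" .
  then have "(t * t) *\<^sub>R ?P = t *\<^sub>R ?P" using c p(4) by (metis mult_scaleR_left mult_scaleR_right scaleR_scaleR)
  then have "tau ((t * t) *\<^sub>R ?P) = tau (t *\<^sub>R ?P)" by (rule arg_cong)
  then have "t = 0 \<or> t = 1" using p(3) by (simp add: tau_scale)
  moreover have "t \<noteq> 0" using c \<open>tau ?c = 1 / fact n\<close> by auto
  ultimately show ?thesis using c by simp
qed

lemma deg_line: "e = 1 \<or> e = -1 \<Longrightarrow> deg n (line e n) = 1"
  using co_chi_idem[of 0 n e] by (simp add: deg_def idem_line tau_def chi_def app_zero)


section \<open>The Witten zeta function of the symmetric groups\<close>

definition lin :: "int set set" where
  "lin = range (\<lambda>k. shape (line 1 k)) \<union> range (\<lambda>k. shape (line (-1) k))"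

lemma line_in_lin: "shape (line 1 k) \<in> lin" "shape (line (-1) k) \<in> lin"
  unfolding lin_def by blast+

abbreviation shapes :: "nat \<Rightarrow> int set set" where
  "shapes n \<equiv> shape ` syt n"

lemma hop_in_shapes: "N \<in> shapes n \<Longrightarrow> x \<in> addable N \<Longrightarrow> hop N x \<in> shapes (Suc n)"
  by (metis Cons_in_syt image_iff shape.simps(2))

lemma unhop_in_shapes: "M \<in> shapes (Suc n) \<Longrightarrow> x \<in> removable M \<Longrightarrow> unhop M x \<in> shapes n"
  using unhop_reachable by (metis image_iff)

lemma dimn_pos: "M \<in> shapes n \<Longrightarrow> 0 < dimn n M"
  unfolding dimn_def by (auto simp: card_gt_0_iff)

section \<open>Corners along the rim\<close>

lemma removable_hop_eq:
  "x \<in> addable N \<Longrightarrow> removable (hop N x) = insert x (removable N - {x - 1, x + 1})"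
  by (rule Set.set_eqI) (auto simp: removable_def addable_def hop_def)

text \<open>Going upwards, the passage from a gap to a particle takes place exactly at an addable
  content.\<close>

lemma not_in_shape_if_no_addable:
  assumes "e \<notin> N" "e \<le> c" "\<And>x. x \<in> addable N \<Longrightarrow> e < x \<Longrightarrow> x \<le> c \<Longrightarrow> False"
  shows "c \<notin> N"
  using assms(2,3)
proof (induction c rule: int_ge_induct)
  case base
  show ?case by (rule assms(1))
next
  case (step c)
  have "c \<notin> N" using step.IH step.prems by force
  then show ?case using step.prems[of "c + 1"] step.hyps by (auto simp: addable_def)
qed

lemma in_shape_if_no_removable:
  assumes "e \<in> N" "e \<le> c" "\<And>x. x \<in> removable N \<Longrightarrow> e < x \<Longrightarrow> x \<le> c \<Longrightarrow> False"
  shows "c \<in> N"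
  using assms(2,3)
proof (induction c rule: int_ge_induct)
  case base
  show ?case by (rule assms(1))
next
  case (step c)
  have "c \<in> N" using step.IH step.prems by force
  then show ?case using step.prems[of "c + 1"] step.hyps by (auto simp: removable_def)
qed

lemma addable_above:
  assumes "N \<in> shapes n" "e \<notin> N"
  shows "\<exists>x\<in>addable N. e < x"
proof (rule ccontr)
  assume a: "\<not> (\<exists>x\<in>addable N. e < x)"
  have "max e (int n) \<notin> N"
    by (rule not_in_shape_if_no_addable[OF assms(2)]) (use a in auto)
  moreover have "max e (int n) \<in> N" using assms(1) shape_bounds by fastforce
  ultimately show False by simp
qed

lemma addable_below:
  assumes "N \<in> shapes n" "c \<in> N"
  shows "\<exists>x\<in>addable N. x \<le> c"
proof (rule ccontr)
  assume a: "\<not> (\<exists>x\<in>addable N. x \<le> c)"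
  have "min c (- int n - 1) \<notin> {- int n..}" by simp
  then have "min c (- int n - 1) \<notin> N" using assms(1) shape_bounds by blast
  then have "c \<notin> N" by (rule not_in_shape_if_no_addable) (use a in auto)
  then show False using assms(2) by simp
qed

text \<open>Shapes with a single corner are rectangles; the corner touches an addable box only if the
  rectangle is a single row or column.\<close>
lemma rectangle_corner_isolated:
  assumes N: "N \<in> shapes n" and R: "removable N = {y}" and x: "x \<in> addable N" and "N \<notin> lin"
  shows "x \<noteq> y - 1" "x \<noteq> y + 1"
proof -
  have yN: "y \<notin> N" "y - 1 \<in> N" using R by (auto simp: removable_def)
  obtain a where a: "a \<in> syt n" "N = shape a" using N by auto
  have "card (addable N) = 2" using card_addable[OF a(1)] R a(2) by simp
  then obtain z where add: "addable N = {x, z}" "x \<noteq> z" using x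
    by (metis card_2_iff insertE insert_commute singletonD)
  \<comment> \<open>The contents of the two addable boxes add up to that of the single corner. If
    one of them touches the corner, the other is 1 or -1, which pins down a column or a row.\<close>
  have sum: "x + z = y" using sum_addable_eq_sum_removable[OF a(1)] R a(2) add by simp
  have xz: "x \<in> N" "z \<in> N" using add by (auto simp: addable_def)
  show "x \<noteq> y - 1"
  proof
    assume xy: "x = y - 1"
    then have z: "z = 1" using sum by simp
    obtain w where "w \<in> addable N" "y < w" using addable_above[OF N yN(1)] by auto
    then have "y < 1" using add xy z by auto
    have "c \<in> N \<longleftrightarrow> c \<in> insert (y - 1) {1..}" for c
    proof -
      consider "c < y - 1" | "c = y - 1" | "y \<le> c" "c < 1" | "1 \<le> c" by linarith
      then show ?thesis
      proof cases
        case 1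
        then have "c \<notin> N" using addable_below[OF N, of c] add xy z \<open>y < 1\<close> by auto
        then show ?thesis using 1 \<open>y < 1\<close> by auto
      next
        case 2
        then show ?thesis using xz xy by simp
      next
        case 3
        have "c \<notin> N" by (rule not_in_shape_if_no_addable[OF yN(1) 3(1)]) (use add xy z 3 in auto)
        then show ?thesis using 3 by auto
      next
        case 4
        have "c \<in> N" by (rule in_shape_if_no_removable[of 1]) (use xz z 4 R \<open>y < 1\<close> in auto)
        then show ?thesis using 4 by auto
      qed
    qed
    then have "N = insert (y - 1) {1..}" by (rule Set.set_eqI)
    also have "\<dots> = shape (line (-1) (nat (1 - y)))" using \<open>y < 1\<close> by (simp add: shape_col)
    finally show False using \<open>N \<notin> lin\<close> line_in_lin by metis
  qed
  show "x \<noteq> y + 1"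
  proof
    assume xy: "x = y + 1"
    then have z: "z = - 1" using sum by simp
    obtain w where "w \<in> addable N" "w \<le> y - 1" using addable_below[OF N yN(2)] by auto
    then have "- 1 \<le> y - 1" using add xy z by auto
    have "c \<in> N \<longleftrightarrow> c \<in> {-1..} - {y}" for c
    proof -
      consider "c < - 1" | "- 1 \<le> c" "c < y" | "c = y" | "y + 1 \<le> c" by linarith
      then show ?thesis
      proof cases
        case 1
        then have "c \<notin> N" using addable_below[OF N, of c] add xy z \<open>- 1 \<le> y - 1\<close> by auto
        then show ?thesis using 1 by auto
      next
        case 2
        have "c \<in> N" by (rule in_shape_if_no_removable[of "- 1"]) (use xz z 2 R in auto)
        then show ?thesis using 2 by auto
      next
        case 3
        then show ?thesis using yN by simp
      next
        case 4
        have "c \<in> N" by (rule in_shape_if_no_removable[of "y + 1"]) (use xz xy 4 R in auto)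
        then show ?thesis using 4 \<open>- 1 \<le> y - 1\<close> by auto
      qed
    qed
    then have "N = {-1..} - {y}" by (rule Set.set_eqI)
    also have "\<dots> = shape (line 1 (nat (y + 1)))" using \<open>- 1 \<le> y - 1\<close> by (simp add: shape_row)
    finally show False using \<open>N \<notin> lin\<close> line_in_lin by metis
  qed
qed

lemma in_linD:
  assumes "a \<in> syt n" "shape a \<in> lin"
  shows "a = line 1 n \<or> a = line (-1) n"
proof -
  obtain k where "shape a = shape (line 1 k) \<or> shape a = shape (line (-1) k)"
    using assms(2) unfolding lin_def by blast
  then show ?thesis
  proof
    assume "shape a = shape (line 1 k)"
    from iffD1[OF shape_eq_row_iff[OF assms(1)] this] show ?thesis by blast
  next
    assume "shape a = shape (line (-1) k)"
    from iffD1[OF shape_eq_col_iff[OF assms(1)] this] show ?thesis by blast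
  qed
qed

text \<open>Rectangles are discounted to make the branching step a contraction: the dimension of a
  rectangle is no larger than that of the only diagram below it.\<close>
definition wt :: "nat \<Rightarrow> real" where
  "wt r = (if r = 1 then 1 / 2 else 1)"

lemma removable_empty_lin: "N \<in> shapes n \<Longrightarrow> removable N = {} \<Longrightarrow> N \<in> lin"
proof -
  assume N: "N \<in> shapes n" and R: "removable N = {}"
  then obtain a where a: "a \<in> syt n" "N = shape a" by auto
  have "n = 0"
  proof (cases n)
    case (Suc m)
    then obtain x b where "a = x # b" "x \<in> addable (shape b)" using a(1) by (auto elim: syt_SucE)
    then show ?thesis using R a(2) removable_hop by auto
  qed simp
  then have "N = shape (line 1 0)" using a by simp
  then show ?thesis using line_in_lin(1) by metis
qed

text \<open>A box at x creates the corner x and destroys at most x - 1 and x + 1. One corner gives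
  2/8 against 3/8. Two corners give at most 1/2 + 2/8 = 3/4, where 1/2 belongs to the one box that
  may complete a rectangle; undiscounted it would be 1. With t + 1 corners, t at least 2, the bound
  is (t + 2) / t^3.\<close>

lemma weight_contraction:
  assumes N: "N \<in> shapes n" "N \<notin> lin"
  shows "(\<Sum>x\<in>addable N. wt (card (removable (hop N x))) / card (removable (hop N x)) ^ 3)
    \<le> 3 / 4 * wt (card (removable N))"
proof -
  let ?A = "addable N" and ?R = "removable N"
  let ?c = "\<lambda>x. card (removable (hop N x))"
  let ?w = "\<lambda>r::nat. wt r / r ^ 3"
  have finR: "finite ?R" and finA: "finite ?A" using N(1) by auto
  obtain a where a: "a \<in> syt n" "N = shape a" using N by auto
  have cA: "card ?A = Suc (card ?R)" using card_addable[OF a(1)] a(2) by simp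
  have disj: "x \<in> ?A \<Longrightarrow> x \<notin> ?R" for x by (auto simp: addable_def removable_def)
  have c: "?c x = Suc (card (?R - {x - 1, x + 1}))" if "x \<in> ?A" for x
    using disj[OF that] finR by (simp add: removable_hop_eq[OF that])
  have w2: "?w r \<le> 1 / real s ^ 3" if "2 \<le> s" "s \<le> r" for r s
    using that by (simp add: wt_def frac_le power_mono)
  have "?R \<noteq> {}" using removable_empty_lin N by blast
  then have "card ?R \<noteq> 0" using finR by simp
  then consider "card ?R = 1" | "card ?R = 2" | "3 \<le> card ?R" by linarith
  then show ?thesis
  proof cases
    case 1
    then obtain y where y: "?R = {y}" by (rule card_1_singletonE)
    have "?c x = 2" if "x \<in> ?A" for x
      using rectangle_corner_isolated[OF N(1) y that N(2)] by (simp add: c[OF that] y insert_Diff_if)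
    then have "(\<Sum>x\<in>?A. ?w (?c x)) = (\<Sum>x\<in>?A. 1 / 8)"
      by (intro sum.cong refl) (simp add: wt_def)
    then show ?thesis using cA 1 by (simp add: wt_def)
  next
    case 2
    define B where "B = {x \<in> ?A. ?c x = 1}"
    have finB: "finite B" "B \<subseteq> ?A" using finA by (auto simp: B_def)
    have RB: "?R = {x - 1, x + 1}" if "x \<in> B" for x
    proof (rule card_subset_eq)
      have "card (?R - {x - 1, x + 1}) = 0" using that c[of x] by (auto simp: B_def)
      then show "?R \<subseteq> {x - 1, x + 1}" using finR by simp
    qed (use 2 in auto)
    have "x = x'" if "x \<in> B" "x' \<in> B" for x x'
    proof -
      have "{x - 1, x + 1} = {x' - 1, x' + 1}" using RB[OF that(1)] RB[OF that(2)] by simp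
      then show ?thesis by (auto simp: doubleton_eq_iff)
    qed
    then have "card B \<le> 1" using finB by (simp add: card_le_Suc0_iff_eq)
    have "(\<Sum>x\<in>?A. ?w (?c x)) = (\<Sum>x\<in>B. ?w (?c x)) + (\<Sum>x\<in>?A - B. ?w (?c x))"
      using finA finB by (simp add: sum.subset_diff add.commute)
    also have "(\<Sum>x\<in>B. ?w (?c x)) = (\<Sum>x\<in>B. 1 / 2)"
      by (rule sum.cong) (auto simp: B_def wt_def)
    also have "(\<Sum>x\<in>?A - B. ?w (?c x)) \<le> (\<Sum>x\<in>?A - B. 1 / 8)"
    proof (rule sum_mono)
      fix x assume "x \<in> ?A - B"
      then have "2 \<le> ?c x" using c[of x] by (auto simp: B_def)
      then show "?w (?c x) \<le> 1 / 8" using w2[of 2 "?c x"] by simp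
    qed
    also have "(\<Sum>x\<in>?A - B. 1 / 8) = (3 - real (card B)) / 8"
      using finB finA cA 2 \<open>card B \<le> 1\<close> by (simp add: card_Diff_subset)
    also have "(\<Sum>x\<in>B. 1 / 2) = real (card B) / 2" by simp
    finally have "(\<Sum>x\<in>?A. ?w (?c x)) \<le> real (card B) / 2 + (3 - real (card B)) / 8" by simp
    also have "\<dots> \<le> 3 / 4"
    proof -
      have "b / 2 + (3 - b) / 8 \<le> 3 / 4" if "b \<le> 1" for b :: real
        using that by (simp add: field_simps)
      then show ?thesis using \<open>card B \<le> 1\<close> by simp
    qed
    also have "3 / 4 = 3 / 4 * wt (card ?R)" using 2 by (simp add: wt_def)
    finally show ?thesis .
  next
    case 3
    define t where "t = card ?R - 1"
    have t: "2 \<le> t" "card ?R = Suc t" using 3 by (auto simp: t_def)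
    have "(\<Sum>x\<in>?A. ?w (?c x)) \<le> (\<Sum>x\<in>?A. 1 / real t ^ 3)"
    proof (rule sum_mono)
      fix x assume x: "x \<in> ?A"
      have "card ?R - card {x - 1, x + 1} \<le> card (?R - {x - 1, x + 1})"
        by (rule diff_card_le_card_Diff) simp
      then have "t \<le> ?c x" using c[OF x] t by simp
      then show "?w (?c x) \<le> 1 / real t ^ 3" using w2 t by blast
    qed
    also have "\<dots> = (real t + 2) / real t ^ 3" using cA t by simp
    also have "\<dots> \<le> 3 / 4"
    proof -
      have "4 * real t \<le> real t ^ 3"
        using t mult_mono[of 2 "real t" 2 "real t"] by (simp add: power3_eq_cube mult_right_mono)
      moreover have "2 \<le> real t" using t by simp
      ultimately have "4 * real t + 8 \<le> 3 * real t ^ 3" by linarith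
      then show ?thesis using t by (simp add: divide_simps)
    qed
    finally show ?thesis using 3 by (simp add: wt_def)
  qed
qed

text \<open>Convexity of \<open>x \<mapsto> 1 / x\<^sup>2\<close>, via the tangent at the mean.\<close>
lemma inverse_square_sum_le:
  fixes f :: "'a \<Rightarrow> real"
  assumes "finite R" "R \<noteq> {}" "\<And>x. x \<in> R \<Longrightarrow> 0 < f x"
  shows "1 / (\<Sum>x\<in>R. f x) ^ 2 \<le> (\<Sum>x\<in>R. 1 / f x ^ 2) / real (card R) ^ 3"
proof -
  define r where "r = real (card R)"
  define s where "s = (\<Sum>x\<in>R. f x)"
  define m where "m = s / r"
  have r: "r > 0" using assms by (simp add: r_def card_gt_0_iff)
  have s: "s > 0" unfolding s_def using assms by (intro sum_pos) auto
  have m: "m > 0" using r s by (simp add: m_def)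
  have "3 / m ^ 2 - 2 * f x / m ^ 3 \<le> 1 / f x ^ 2" if "x \<in> R" for x
  proof -
    have f: "f x > 0" using assms that by simp
    have "1 / f x ^ 2 - (3 / m ^ 2 - 2 * f x / m ^ 3) = (f x - m) ^ 2 * (2 * f x + m) / (f x ^ 2 * m ^ 3)"
      using f m by (simp add: field_simps power2_eq_square power3_eq_cube)
    also have "\<dots> \<ge> 0" using f m by simp
    finally show ?thesis by simp
  qed
  then have "(\<Sum>x\<in>R. 3 / m ^ 2 - 2 * f x / m ^ 3) \<le> (\<Sum>x\<in>R. 1 / f x ^ 2)"
    by (rule sum_mono)
  also have "(\<Sum>x\<in>R. 3 / m ^ 2 - 2 * f x / m ^ 3) = r * (3 / m ^ 2) - 2 * s / m ^ 3"
    by (simp add: sum_subtractf r_def s_def sum_divide_distrib sum_distrib_left)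
  also have "\<dots> = r ^ 3 / s ^ 2"
    using r s by (simp add: m_def field_simps power2_eq_square power3_eq_cube)
  finally have "r ^ 3 / s ^ 2 \<le> (\<Sum>x\<in>R. 1 / f x ^ 2)" .
  then show ?thesis using r s by (simp add: r_def[symmetric] s_def[symmetric] field_simps)
qed

text \<open>The Witten zeta function at 2 without the one-dimensional characters, taken with tableau
  numbers and the discount.\<close>

definition zsum :: "nat \<Rightarrow> real" where
  "zsum n = (\<Sum>M\<in>shapes n - lin. wt (card (removable M)) / real (dimn n M) ^ 2)"

lemma wt_bounds: "0 < wt r" "wt r \<le> 1" "1 / 2 \<le> wt r"
  by (auto simp: wt_def)

lemma addable_row: "addable (shape (line 1 n)) \<subseteq> {-1, int n}"
  by (auto simp: shape_row addable_def)

lemma addable_col: "addable (shape (line (-1) n)) \<subseteq> {1, - int n}"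
  by (auto simp: shape_col addable_def)

text \<open>The diagrams next to a line correspond to the representations of degree n of
  \<open>Sym (Suc n)\<close>: each branching step adds the single tableau of the line.\<close>

lemma dimn_near_line:
  assumes e: "e = 1 \<or> e = -1" and n: "1 \<le> n"
  shows "- e \<in> addable (shape (line e n)) \<and> n \<le> dimn (Suc n) (hop (shape (line e n)) (- e))"
  using n
proof (induction n rule: dec_induct)
  case base
  have 1: "- e \<in> addable (shape (line e 1))" using e
    by (elim disjE) (simp_all only: shape_row shape_col, auto simp: addable_def)
  have "shape (line e 1) \<in> shapes 1" using line_in_syt[OF e, of 1] by blast
  then have "hop (shape (line e 1)) (- e) \<in> shapes (Suc 1)" using 1 hop_in_shapes by blast
  then show ?case using dimn_pos[of _ "Suc 1"] 1 by fastforce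
next
  case (step n)
  let ?L = "shape (line e (Suc n))"
  let ?M = "hop ?L (- e)"
  have L: "?L \<in> shapes (Suc n)" using line_in_syt[OF e, of "Suc n"] by blast
  have 1: "- e \<in> addable ?L" using e
    by (elim disjE) (simp_all only: shape_row shape_col, auto simp: addable_def)
  have M: "?M \<in> shapes (Suc (Suc n))" using hop_in_shapes[OF L 1] .
  have 2: "e * int n \<in> removable ?M" "e * int n \<noteq> - e"
    using e step(1) by (elim disjE; simp only: shape_row shape_col; auto simp: removable_def hop_def)+
  have 3: "unhop ?M (e * int n) = hop (shape (line e n)) (- e)"
    using e step(1) by (elim disjE) (simp_all only: shape_row shape_col, auto simp: unhop_def hop_def)
  have "dimn (Suc (Suc n)) ?M = (\<Sum>x\<in>removable ?M. dimn (Suc n) (unhop ?M x))"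
    using M by (intro dimn_Suc) auto
  also have "\<dots> \<ge> (\<Sum>x\<in>{e * int n, - e}. dimn (Suc n) (unhop ?M x))"
    using M 2 removable_hop[OF 1] by (intro sum_mono2) auto
  also have "(\<Sum>x\<in>{e * int n, - e}. dimn (Suc n) (unhop ?M x))
      = dimn (Suc n) (hop (shape (line e n)) (- e)) + dimn (Suc n) ?L"
    using 2 3 unhop_hop[OF 1] by simp
  finally show ?case using 1 step(3) dimn_pos[OF L] by linarith
qed

text \<open>Q holds the diagrams directly above a line, at most two, for which branching would lead
  to an excluded term. For the others convexity passes to the diagrams below, and after exchanging
  the sums each of these carries the sum in \<open>weight_contraction\<close>.\<close>

lemma zsum_Suc_le:
  assumes n: "1 \<le> n"
  shows "zsum (Suc n) \<le> 3 / 4 * zsum n + 2 / real n ^ 2"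
proof -
  define Q where "Q = {M \<in> shapes (Suc n) - lin. \<exists>x\<in>removable M. unhop M x \<in> lin}"
  define G where "G = shapes (Suc n) - lin - Q"
  let ?h = "\<lambda>M. wt (card (removable M)) / real (dimn (Suc n) M) ^ 2"
  let ?w = "\<lambda>r::nat. wt r / r ^ 3"
  have finG: "finite G" and GU: "G \<subseteq> shapes (Suc n)" by (auto simp: G_def)
  have QL: "Q \<subseteq> {hop (shape (line 1 n)) (-1), hop (shape (line (-1) n)) 1}"
  proof
    fix M assume "M \<in> Q"
    then obtain x where M: "M \<in> shapes (Suc n)" "M \<notin> lin" "x \<in> removable M" "unhop M x \<in> lin"
      by (auto simp: Q_def)
    obtain a where a: "a \<in> syt n" "shape a = unhop M x" using unhop_in_shapes[OF M(1,3)] by auto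
    have Mx: "M = hop (shape a) x" "x \<in> addable (shape a)" using a M(3) hop_unhop addable_unhop by auto
    have "a = line 1 n \<or> a = line (-1) n"
      by (rule in_linD[OF a(1)]) (use M(4) a(2) in simp)
    then show "M \<in> {hop (shape (line 1 n)) (-1), hop (shape (line (-1) n)) 1}"
    proof
      assume l: "a = line 1 n"
      have "x \<noteq> int n"
      proof
        assume "x = int n"
        then have "M = shape (line 1 (Suc n))" using Mx l by simp
        then show False using M(2) line_in_lin by metis
      qed
      then show ?thesis using Mx l addable_row[of n] by auto
    next
      assume l: "a = line (-1) n"
      have "x \<noteq> - int n"
      proof
        assume "x = - int n"
        then have "M = shape (line (-1) (Suc n))" using Mx l by simp
        then show False using M(2) line_in_lin by metis
      qed
      then show ?thesis using Mx l addable_col[of n] by auto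
    qed
  qed
  have "(\<Sum>M\<in>Q. ?h M) \<le> (\<Sum>M\<in>Q. 1 / real n ^ 2)"
  proof (rule sum_mono)
    fix M assume "M \<in> Q"
    then have "n \<le> dimn (Suc n) M"
      using QL dimn_near_line[of 1 n] dimn_near_line[of "-1" n] n by auto
    then have "real n ^ 2 \<le> real (dimn (Suc n) M) ^ 2" by (intro power_mono) auto
    then show "?h M \<le> 1 / real n ^ 2" using n wt_bounds by (intro frac_le) auto
  qed
  also have "\<dots> = real (card Q) / real n ^ 2" by simp
  also have "\<dots> \<le> 2 / real n ^ 2"
  proof -
    have "card Q \<le> card {hop (shape (line 1 n)) (-1), hop (shape (line (-1) n)) 1}"
      by (rule card_mono[OF _ QL]) simp
    also have "\<dots> \<le> 2" by (simp add: card_insert_if)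
    finally show ?thesis by (intro divide_right_mono) auto
  qed
  finally have 1: "(\<Sum>M\<in>Q. ?h M) \<le> 2 / real n ^ 2" .
  have "(\<Sum>M\<in>G. ?h M) \<le> (\<Sum>M\<in>G. \<Sum>x\<in>removable M. ?w (card (removable M)) * (1 / real (dimn n (unhop M x)) ^ 2))"
  proof (rule sum_mono)
    fix M assume "M \<in> G"
    then have M: "M \<in> shapes (Suc n)" "M \<notin> lin" by (auto simp: G_def)
    have fin: "finite (removable M)" using M by auto
    have ne: "removable M \<noteq> {}" using removable_empty_lin M by blast
    have "1 / (\<Sum>x\<in>removable M. real (dimn n (unhop M x))) ^ 2
        \<le> (\<Sum>x\<in>removable M. 1 / real (dimn n (unhop M x)) ^ 2) / real (card (removable M)) ^ 3"
      using dimn_pos unhop_in_shapes[OF M(1)] by (intro inverse_square_sum_le fin ne) auto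
    then have "?h M \<le> wt (card (removable M))
        * ((\<Sum>x\<in>removable M. 1 / real (dimn n (unhop M x)) ^ 2) / real (card (removable M)) ^ 3)"
      using mult_left_mono[OF _ less_imp_le[OF wt_bounds(1)]] by (fastforce simp: dimn_Suc[OF fin])
    then show "?h M \<le> (\<Sum>x\<in>removable M. ?w (card (removable M)) * (1 / real (dimn n (unhop M x)) ^ 2))"
      unfolding sum_distrib_left[symmetric] by simp
  qed
  also have "\<dots> = (\<Sum>(M, x)\<in>(SIGMA M:G. removable M). ?w (card (removable M)) * (1 / real (dimn n (unhop M x)) ^ 2))"
    using finG GU by (intro sum.Sigma) auto
  also have "\<dots> = (\<Sum>(N, x)\<in>(\<lambda>(M, x). (unhop M x, x)) ` (SIGMA M:G. removable M).
      ?w (card (removable (hop N x))) * (1 / real (dimn n N) ^ 2))"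
  proof (subst sum.reindex)
    show "inj_on (\<lambda>(M, x). (unhop M x, x)) (SIGMA M:G. removable M)"
      by (rule inj_on_inverseI[of _ "\<lambda>(N, x). (hop N x, x)"]) (auto simp: hop_unhop)
  qed (auto simp: hop_unhop intro!: sum.cong)
  also have "\<dots> \<le> (\<Sum>(N, x)\<in>(SIGMA N:shapes n - lin. addable N).
      ?w (card (removable (hop N x))) * (1 / real (dimn n N) ^ 2))"
  proof (rule sum_mono2)
    show "finite (SIGMA N:shapes n - lin. addable N)" by auto
    show "(\<lambda>(M, x). (unhop M x, x)) ` (SIGMA M:G. removable M) \<subseteq> (SIGMA N:shapes n - lin. addable N)"
    proof
      fix p assume "p \<in> (\<lambda>(M, x). (unhop M x, x)) ` (SIGMA M:G. removable M)"
      then obtain M x where p: "p = (unhop M x, x)" "M \<in> G" "x \<in> removable M" by auto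
      then have "unhop M x \<in> shapes n" "unhop M x \<notin> lin"
        using unhop_in_shapes[of M n x] by (auto simp: G_def Q_def)
      then show "p \<in> (SIGMA N:shapes n - lin. addable N)" using p addable_unhop by auto
    qed
  qed (auto simp: wt_def)
  also have "\<dots> = (\<Sum>N\<in>shapes n - lin. (\<Sum>x\<in>addable N. ?w (card (removable (hop N x)))) * (1 / real (dimn n N) ^ 2))"
    unfolding sum_distrib_right by (rule sum.Sigma[symmetric]) auto
  also have "\<dots> \<le> (\<Sum>N\<in>shapes n - lin. (3 / 4 * wt (card (removable N))) * (1 / real (dimn n N) ^ 2))"
    using weight_contraction by (intro sum_mono mult_right_mono) auto
  also have "\<dots> = 3 / 4 * zsum n" by (simp add: zsum_def sum_distrib_left)
  finally have 2: "(\<Sum>M\<in>G. ?h M) \<le> 3 / 4 * zsum n" .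
  have "zsum (Suc n) = (\<Sum>M\<in>Q. ?h M) + (\<Sum>M\<in>G. ?h M)"
    unfolding zsum_def G_def by (rule sum.subset_diff[THEN trans[OF _ add.commute]]) (auto simp: Q_def)
  then show ?thesis using 1 2 by simp
qed

lemma zsum_bound: "\<exists>C>0. \<forall>n\<ge>20. zsum n \<le> C / real n ^ 2"
proof -
  \<comment> \<open>400 = 20^2 settles n = 20. C at least 20 makes 2 / n^2 at most a tenth of C /
    n^2, and 3/4 + 1/10 = 17/20 is below n^2 / (n + 1)^2 from n = 20 on.\<close>
  define C where "C = max 20 (400 * zsum 20)"
  have C: "20 \<le> C" "zsum 20 \<le> C / real 20 ^ 2" by (auto simp: C_def)
  have "zsum n \<le> C / real n ^ 2" if "20 \<le> n" for n
    using that
  proof (induction n rule: dec_induct)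
    case base
    show ?case by (rule C(2))
  next
    case (step n)
    have n: "20 \<le> real n" using step by simp
    have "zsum (Suc n) \<le> 3 / 4 * zsum n + 2 / real n ^ 2" using zsum_Suc_le[of n] step by simp
    also have "\<dots> \<le> 3 / 4 * (C / real n ^ 2) + C / 10 / real n ^ 2"
      using step C by (intro add_mono mult_left_mono divide_right_mono) auto
    also have "\<dots> = (17 / 20 * C) / real n ^ 2" by (simp add: field_simps)
    also have "\<dots> \<le> C / real (Suc n) ^ 2"
    proof -
      have "17 * (real n + 1) ^ 2 \<le> 20 * real n ^ 2"
      proof -
        have "20 * real n \<le> real n * real n" using n by (intro mult_right_mono) auto
        moreover have "17 * (real n + 1) ^ 2 = 17 * (real n * real n) + 34 * real n + 17"
          by (simp add: power2_eq_square algebra_simps)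
        ultimately show ?thesis using n unfolding power2_eq_square by linarith
      qed
      then have "C * (17 * (real n + 1) ^ 2) \<le> C * (20 * real n ^ 2)" using C by (intro mult_left_mono) auto
      then show ?thesis using n by (simp add: field_simps)
    qed
    finally show ?case .
  qed
  then show ?thesis using C by (intro exI[of _ C]) auto
qed

definition nonlin :: "nat \<Rightarrow> int list set" where
  "nonlin n = syt n - {line 1 n, line (-1) n}"

lemma shape_nonlin: "a \<in> nonlin n \<Longrightarrow> shape a \<in> shapes n - lin"
  using in_linD[of a n] by (auto simp: nonlin_def)

lemma inverse_deg_square_le:
  assumes "a \<in> nonlin n"
  shows "1 / deg n a ^ 2 \<le> 2 * zsum n"
proof -
  have a: "a \<in> syt n" using assms by (simp add: nonlin_def)
  have f: "0 < dimn n (shape a)" using a dimn_pos by blast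
  have "1 / deg n a ^ 2 \<le> 1 / real (dimn n (shape a)) ^ 2"
    using dimn_le_deg[OF a] f deg_pos[OF a] by (intro frac_le power_mono) auto
  also have "\<dots> \<le> 2 * (wt (card (removable (shape a))) / real (dimn n (shape a)) ^ 2)"
    using wt_bounds(3)[of "card (removable (shape a))"] f by (simp add: field_simps)
  also have "wt (card (removable (shape a))) / real (dimn n (shape a)) ^ 2 \<le> zsum n"
    unfolding zsum_def
    by (rule member_le_sum[OF shape_nonlin[OF assms], of "\<lambda>M. wt (card (removable M)) / real (dimn n M) ^ 2"])
       (auto simp: wt_def)
  finally show ?thesis by simp
qed

text \<open>The multiplicity of a shape among the tableaux uses up one of the three powers; the
  factor 2 undoes the discount.\<close>

lemma sum_inverse_deg_cube_le: "(\<Sum>a\<in>nonlin n. 1 / deg n a ^ 3) \<le> 2 * zsum n"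
proof -
  have fin: "finite (nonlin n)" by (simp add: nonlin_def)
  have "(\<Sum>a\<in>nonlin n. 1 / deg n a ^ 3) \<le> (\<Sum>a\<in>nonlin n. 1 / real (dimn n (shape a)) ^ 3)"
  proof (rule sum_mono)
    fix a assume "a \<in> nonlin n"
    then have a: "a \<in> syt n" by (simp add: nonlin_def)
    have "0 < dimn n (shape a)" using a dimn_pos by blast
    then show "1 / deg n a ^ 3 \<le> 1 / real (dimn n (shape a)) ^ 3"
      using dimn_le_deg[OF a] deg_pos[OF a] by (intro frac_le power_mono) auto
  qed
  also have "\<dots> = (\<Sum>M\<in>shape ` nonlin n. \<Sum>a\<in>{a \<in> nonlin n. shape a = M}. 1 / real (dimn n (shape a)) ^ 3)"
    by (rule sum.image_gen[OF fin])
  also have "\<dots> = (\<Sum>M\<in>shape ` nonlin n. 1 / real (dimn n M) ^ 2)"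
  proof (rule sum.cong[OF refl])
    fix M assume M: "M \<in> shape ` nonlin n"
    then have MU: "M \<in> shapes n" "M \<notin> lin" using shape_nonlin by auto
    have "{a \<in> nonlin n. shape a = M} = {a \<in> syt n. shape a = M}"
      using MU(2) line_in_lin by (auto simp: nonlin_def)
    then have "(\<Sum>a\<in>{a \<in> nonlin n. shape a = M}. 1 / real (dimn n (shape a)) ^ 3)
        = real (dimn n M) * (1 / real (dimn n M) ^ 3)"
      by (simp add: dimn_def)
    then show "(\<Sum>a\<in>{a \<in> nonlin n. shape a = M}. 1 / real (dimn n (shape a)) ^ 3) = 1 / real (dimn n M) ^ 2"
      using dimn_pos[OF MU(1)] by (simp add: power2_eq_square power3_eq_cube)
  qed
  also have "\<dots> \<le> (\<Sum>M\<in>shapes n - lin. 2 * (wt (card (removable M)) / real (dimn n M) ^ 2))"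
  proof (rule order_trans[OF sum_mono2])
    show "shape ` nonlin n \<subseteq> shapes n - lin" using shape_nonlin by blast
    show "(\<Sum>M\<in>shapes n - lin. 1 / real (dimn n M) ^ 2)
        \<le> (\<Sum>M\<in>shapes n - lin. 2 * (wt (card (removable M)) / real (dimn n M) ^ 2))"
    proof (rule sum_mono)
      fix M
      have "1 \<le> 2 * wt (card (removable M))" using wt_bounds(3)[of "card (removable M)"] by simp
      then have "1 / real (dimn n M) ^ 2 \<le> (2 * wt (card (removable M))) / real (dimn n M) ^ 2"
        by (rule divide_right_mono) simp
      then show "1 / real (dimn n M) ^ 2 \<le> 2 * (wt (card (removable M)) / real (dimn n M) ^ 2)" by simp
    qed
  qed auto
  also have "\<dots> = 2 * zsum n" by (simp add: zsum_def sum_distrib_left)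
  finally show ?thesis .
qed

text \<open>Since 4g - 1 = 3 + 2 (2g - 2), three powers are summed and the remaining 2g - 2 inverse
  squares are bounded uniformly.\<close>

lemma sum_inverse_deg_power_le:
  assumes "1 \<le> g"
  shows "(\<Sum>a\<in>nonlin n. 1 / deg n a ^ (4 * g - 1)) \<le> (2 * zsum n) ^ (2 * g - 1)"
proof -
  have z: "0 \<le> 2 * zsum n" unfolding zsum_def using wt_bounds(1) by (auto intro!: sum_nonneg simp: less_imp_le)
  obtain h where h: "g = Suc h" using assms by (cases g) auto
  have e: "4 * g - 1 = 3 + 2 * (2 * h)" "2 * g - 1 = Suc (2 * h)" using h by auto
  have "(\<Sum>a\<in>nonlin n. 1 / deg n a ^ (4 * g - 1)) \<le> (\<Sum>a\<in>nonlin n. 1 / deg n a ^ 3 * (2 * zsum n) ^ (2 * h))"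
  proof (rule sum_mono)
    fix a assume a: "a \<in> nonlin n"
    have "0 < deg n a" using a deg_pos by (simp add: nonlin_def)
    then have "(1 / deg n a ^ 2) ^ (2 * h) \<le> (2 * zsum n) ^ (2 * h)"
      using inverse_deg_square_le[OF a] by (intro power_mono) auto
    then have "1 / deg n a ^ 3 * (1 / deg n a ^ 2) ^ (2 * h) \<le> 1 / deg n a ^ 3 * (2 * zsum n) ^ (2 * h)"
      using \<open>0 < deg n a\<close> by (intro mult_left_mono) auto
    then show "1 / deg n a ^ (4 * g - 1) \<le> 1 / deg n a ^ 3 * (2 * zsum n) ^ (2 * h)"
      unfolding e by (simp add: power_add power_mult power_one_over)
  qed
  also have "\<dots> \<le> 2 * zsum n * (2 * zsum n) ^ (2 * h)"
    unfolding sum_distrib_right[symmetric]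
    using sum_inverse_deg_cube_le z by (intro mult_right_mono) auto
  finally show ?thesis unfolding e by simp
qed


section \<open>Moments of the number of cycles\<close>

abbreviation orb :: "(nat \<Rightarrow> nat) \<Rightarrow> nat \<Rightarrow> nat set" where
  "orb \<equiv> Orbits.orbit"

lemma orb_eq: "permutation f \<Longrightarrow> y \<in> orb f x \<Longrightarrow> orb f y = orb f x"
  by (rule orbit_cyclic_eq3[OF cyclic_on_orbit'])

lemma permutes_permutation: "q permutes {1..n::nat} \<Longrightarrow> permutation q"
  using permutation_permutes by blast

lemma num_cycles_Suc_fixed:
  assumes q: "q permutes {1..n}"
  shows "num_cycles (Suc n) q = Suc (num_cycles n q)"
proof -
  have "q (Suc n) = Suc n" using q by (rule permutes_not_in) simp
  then have o: "orb q (Suc n) = {Suc n}" by (simp add: orbit_eq_singleton_iff)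
  have "orb q x \<subseteq> {1..n}" if "x \<in> {1..n}" for x using permutes_orbit_subset[OF q that] .
  then have "{Suc n} \<notin> orb q ` {1..n}" by fastforce
  then show ?thesis by (simp add: num_cycles_def atLeastAtMostSuc_conv o)
qed

text \<open>The product inserts n + 1 directly before b in its cycle, so deleting n + 1 from the new
  orbits gives back the old ones.\<close>

lemma num_cycles_Suc_insert:
  assumes q: "q permutes {1..n}" and b: "b \<in> {1..n}"
  shows "num_cycles (Suc n) (Transposition.transpose (Suc n) b \<circ> q) = num_cycles n q"
proof -
  let ?a = "Suc n"
  define p where "p = Transposition.transpose ?a b \<circ> q"
  have qa: "q ?a = ?a" using q by (rule permutes_not_in) simp
  have q_in: "q y \<in> {1..n} \<longleftrightarrow> y \<in> {1..n}" for y using q by (rule permutes_in_image)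
  have pa: "p ?a = b" by (simp add: p_def qa)
  have p1: "p y = q y" if "y \<in> {1..n}" "q y \<noteq> b" for y
    using that q_in[of y] by (auto simp: p_def Transposition.transpose_def)
  have p2: "p y = ?a" if "q y = b" for y using that by (simp add: p_def)
  have pp: "permutation p" unfolding p_def
    by (intro permutation_compose permutes_permutation[OF q] permutation_swap_id)
  have qp: "permutation q" by (rule permutes_permutation[OF q])
  have sub: "orb q x \<subseteq> {1..n}" if "x \<in> {1..n}" for x using permutes_orbit_subset[OF q that] .
  have step: "q y \<in> orb p x" if "y \<in> orb p x \<or> y = x" "y \<in> {1..n}" for x y
  proof (cases "q y = b")
    case True
    have "p y \<in> orb p x" using that(1) by (auto intro: Orbits.orbit.intros)
    then have "p (p y) \<in> orb p x" by (rule Orbits.orbit.step)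
    then show ?thesis using p2[OF True] pa True by simp
  next
    case False
    have "p y \<in> orb p x" using that(1) by (auto intro: Orbits.orbit.intros)
    then show ?thesis using p1[OF that(2) False] by simp
  qed
  have 1: "y \<in> orb p x" if "y \<in> orb q x" "x \<in> {1..n}" for x y
    using that
  proof (induction rule: Orbits.orbit.induct)
    case base
    then show ?case using step[of x x] by simp
  next
    case (step y)
    then show ?case using \<open>\<And>x y. y \<in> orb p x \<or> y = x \<Longrightarrow> y \<in> {1..n} \<Longrightarrow> q y \<in> orb p x\<close>[of y x] sub by blast
  qed
  \<comment> \<open>While the orbit sits at \<open>?a\<close>, the invariant speaks about b, the
    point that comes next.\<close>
  have 2: "if y = ?a then b \<in> orb q x else y \<in> orb q x" if "y \<in> orb p x" "x \<in> {1..n}" for x y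
    using that
  proof (induction rule: Orbits.orbit.induct)
    case base
    show ?case
    proof (cases "q x = b")
      case True
      then show ?thesis using p2 Orbits.orbit.base[of q x] by simp
    next
      case False
      then have "p x = q x" "q x \<noteq> ?a" using p1 base q_in[of x] by auto
      then show ?thesis using Orbits.orbit.base[of q x] by simp
    qed
  next
    case (step y)
    show ?case
    proof (cases "y = ?a")
      case True
      then show ?thesis using step pa b by simp
    next
      case False
      then have y: "y \<in> orb q x" using step by simp
      then have y': "y \<in> {1..n}" using sub step by blast
      have qy: "q y \<in> orb q x" using y by (rule Orbits.orbit.step)
      show ?thesis
      proof (cases "q y = b")
        case True
        then show ?thesis using p2 qy by simp
      next
        case False
        then have "p y = q y" "q y \<noteq> ?a" using p1[OF y'] q_in[of y] y' by auto
        then show ?thesis using qy by simp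
      qed
    qed
  qed
  have minus: "orb p x - {?a} = orb q x" if "x \<in> {1..n}" for x
  proof
    show "orb p x - {?a} \<subseteq> orb q x" using 2[OF _ that] by (metis Diff_iff insertI1 subsetI)
    show "orb q x \<subseteq> orb p x - {?a}" using 1[OF _ that] sub[OF that] by fastforce
  qed
  have "orb p ?a = orb p b"
    using orb_eq[OF pp, of b ?a] Orbits.orbit.base[of p ?a] pa by simp
  then have "orb p ` {1..Suc n} = orb p ` {1..n}"
    using b by (auto simp: atLeastAtMostSuc_conv)
  moreover have "(\<lambda>U. U - {?a}) ` orb p ` {1..n} = orb q ` {1..n}"
    unfolding image_image using minus by (intro image_cong) auto
  \<comment> \<open>The point x lies in its own orbit and survives the deletion of
    \<open>?a\<close>, so the truncated orbit still identifies the orbit.\<close>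
  moreover have "inj_on (\<lambda>U. U - {?a}) (orb p ` {1..n})"
  proof (rule inj_onI, clarify)
    fix x y assume x: "x \<in> {1..n}" and y: "y \<in> {1..n}" and e: "orb p x - {?a} = orb p y - {?a}"
    have "x \<in> orb p x - {?a}" using permutation_self_in_orbit[OF pp] x by auto
    then have "x \<in> orb p y" using e by blast
    then show "orb p x = orb p y" by (rule orb_eq[OF pp])
  qed
  ultimately have "num_cycles (Suc n) p = card (orb q ` {1..n})"
    unfolding num_cycles_def by (metis card_image)
  then show ?thesis by (simp add: num_cycles_def p_def)
qed

text \<open>The Chinese restaurant process: n + 1 either becomes a fixed point or is inserted at one
  of n places.\<close>

lemma sum_num_cycles_Suc:
  fixes F :: "nat \<Rightarrow> real"
  shows "(\<Sum>p | p permutes {1..Suc n}. F (num_cycles (Suc n) p))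
    = (\<Sum>q | q permutes {1..n}. F (Suc (num_cycles n q)) + real n * F (num_cycles n q))"
proof -
  have "(\<Sum>p | p permutes {1..Suc n}. F (num_cycles (Suc n) p))
      = (\<Sum>b\<in>insert (Suc n) {1..n}. \<Sum>q | q permutes {1..n}.
           F (num_cycles (Suc n) (Transposition.transpose (Suc n) b \<circ> q)))"
  proof -
    have "{1..Suc n} = insert (Suc n) {1..n}" by auto
    then show ?thesis
      using sum_over_permutations_insert[of "{1..n}" "Suc n" "\<lambda>p. F (num_cycles (Suc n) p)"] by simp
  qed
  also have "\<dots> = (\<Sum>q | q permutes {1..n}. F (num_cycles (Suc n) q))
      + (\<Sum>b\<in>{1..n}. \<Sum>q | q permutes {1..n}. F (num_cycles n q))"
    by (subst sum.insert) (auto simp: num_cycles_Suc_insert)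
  also have "(\<Sum>q | q permutes {1..n}. F (num_cycles (Suc n) q))
      = (\<Sum>q | q permutes {1..n}. F (Suc (num_cycles n q)))"
    by (intro sum.cong refl) (simp add: num_cycles_Suc_fixed)
  finally show ?thesis by (simp add: sum.distrib sum_distrib_left)
qed

text \<open>The shift by 1 keeps the base at least 1 even for n = 0, so the increment of a power is
  bounded by the next lower power.\<close>

definition cycle_moment :: "nat \<Rightarrow> nat \<Rightarrow> real" where
  "cycle_moment m n = (\<Sum>p | p permutes {1..n}. (1 + real (num_cycles n p)) ^ m) / fact n"

lemma power_Suc_diff_le:
  fixes x :: real
  assumes "1 \<le> x"
  shows "(1 + x) ^ Suc m - x ^ Suc m \<le> real (Suc m) * 2 ^ m * x ^ m"
proof -
  have "(1 + x) ^ Suc m - x ^ Suc m = (\<Sum>i<Suc m. (1 + x) ^ i * x ^ (m - i))"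
    using diff_power_eq_sum[of "1 + x" m x] by simp
  also have "\<dots> \<le> (\<Sum>i<Suc m. 2 ^ m * x ^ m)"
  proof (rule sum_mono)
    fix i assume i: "i \<in> {..<Suc m}"
    have "(1 + x) ^ i * x ^ (m - i) \<le> (2 * x) ^ i * x ^ (m - i)"
      using assms by (intro mult_right_mono power_mono) auto
    also have "\<dots> = 2 ^ i * x ^ m"
      using i by (simp add: power_mult_distrib mult.assoc flip: power_add)
    also have "\<dots> \<le> 2 ^ m * x ^ m"
      using i assms by (intro mult_right_mono power_increasing) auto
    finally show "(1 + x) ^ i * x ^ (m - i) \<le> 2 ^ m * x ^ m" .
  qed
  also have "\<dots> = real (Suc m) * 2 ^ m * x ^ m" by simp
  finally show ?thesis .
qed

lemma cycle_moment_Suc_le: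
  "cycle_moment (Suc m) (Suc n)
    \<le> cycle_moment (Suc m) n + real (Suc m) * 2 ^ m * cycle_moment m n / real (Suc n)"
proof -
  let ?S = "{q. q permutes {1..n}}"
  let ?x = "\<lambda>q. 1 + real (num_cycles n q)"
  have "cycle_moment (Suc m) (Suc n)
      = (\<Sum>q\<in>?S. (1 + ?x q) ^ Suc m + real n * ?x q ^ Suc m) / fact (Suc n)"
    unfolding cycle_moment_def
    using sum_num_cycles_Suc[of "\<lambda>c. (1 + real c) ^ Suc m" n] by (simp add: add.assoc)
  also have "\<dots> \<le> (\<Sum>q\<in>?S. real (Suc n) * ?x q ^ Suc m + real (Suc m) * 2 ^ m * ?x q ^ m) / fact (Suc n)"
  proof (intro divide_right_mono sum_mono)
    fix q
    show "(1 + ?x q) ^ Suc m + real n * ?x q ^ Suc m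
        \<le> real (Suc n) * ?x q ^ Suc m + real (Suc m) * 2 ^ m * ?x q ^ m"
      using power_Suc_diff_le[of "?x q" m] by (simp add: algebra_simps)
  qed simp
  also have "\<dots> = (real (Suc n) * (\<Sum>q\<in>?S. ?x q ^ Suc m) + real (Suc m) * 2 ^ m * (\<Sum>q\<in>?S. ?x q ^ m))
      / (real (Suc n) * fact n)"
    by (simp only: sum.distrib sum_distrib_left fact_Suc of_nat_mult)
  also have "\<dots> = cycle_moment (Suc m) n + real (Suc m) * 2 ^ m * cycle_moment m n / real (Suc n)"
    unfolding cycle_moment_def by (simp add: add_divide_distrib del: power_Suc of_nat_Suc)
  finally show ?thesis .
qed

text \<open>From n to n + 1 a moment grows by a constant times the lower moment over n + 1. Summing
  the reciprocals contributes one more harmonic factor.\<close>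

lemma cycle_moment_le: "\<exists>K\<ge>0. \<forall>n. cycle_moment m n \<le> K * (1 + harm n) ^ m"
proof (induction m)
  case 0
  have "cycle_moment 0 n \<le> 1 * (1 + harm n) ^ 0" for n
    by (simp add: cycle_moment_def card_permutations[of _ n] of_nat_fact)
  then show ?case by (intro exI[of _ 1]) auto
next
  case (Suc m)
  then obtain K where K: "0 \<le> K" "\<And>n. cycle_moment m n \<le> K * (1 + harm n) ^ m" by auto
  define c where "c = real (Suc m) * 2 ^ m * K"
  have c: "0 \<le> c" using K by (simp add: c_def)
  have *: "cycle_moment (Suc m) n \<le> 1 + c * harm n * (1 + harm n) ^ m" for n
  proof (induction n)
    case 0
    show ?case by (simp add: cycle_moment_def num_cycles_def harm_expand)
  next
    case (Suc n)
    have h: "0 \<le> (harm n :: real)" by (rule harm_nonneg)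
    have "cycle_moment (Suc m) (Suc n)
        \<le> cycle_moment (Suc m) n + real (Suc m) * 2 ^ m * cycle_moment m n / real (Suc n)"
      by (rule cycle_moment_Suc_le)
    also have "\<dots> \<le> (1 + c * harm n * (1 + harm n) ^ m)
        + real (Suc m) * 2 ^ m * (K * (1 + harm n) ^ m) / real (Suc n)"
      using K(2)[of n] by (intro add_mono Suc divide_right_mono mult_left_mono) auto
    also have "\<dots> = 1 + c * harm (Suc n) * (1 + harm n) ^ m"
      by (simp add: c_def harm_Suc algebra_simps divide_inverse)
    also have "\<dots> \<le> 1 + c * harm (Suc n) * (1 + harm (Suc n)) ^ m"
      using c h harm_nonneg[of "Suc n", where 'a = real] harm_mono[of n "Suc n", where 'a = real]
      by (intro add_left_mono mult_left_mono power_mono) auto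
    finally show ?case .
  qed
  have "cycle_moment (Suc m) n \<le> (1 + c) * (1 + harm n) ^ Suc m" for n
  proof -
    have h: "0 \<le> (harm n :: real)" by (rule harm_nonneg)
    have "1 \<le> (1 + harm n :: real) ^ Suc m" using h by (intro one_le_power) auto
    moreover have "c * harm n * (1 + harm n) ^ m \<le> c * (1 + harm n :: real) ^ Suc m"
      using c h by (simp add: mult_left_mono mult_right_mono mult.assoc)
    ultimately have "1 + c * harm n * (1 + harm n) ^ m \<le> (1 + c) * (1 + harm n) ^ Suc m"
      by (simp add: distrib_right)
    then show ?thesis using *[of n] by linarith
  qed
  then show ?case using c by (intro exI[of _ "1 + c"]) auto
qed

lemma harm_le_ln: "1 \<le> n \<Longrightarrow> harm n \<le> ln (real n) + 1"
proof -
  assume "1 \<le> n"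
  then obtain m where m: "n = Suc m" by (cases n) auto
  show ?thesis using decseqD[OF decseq_harm_diff_ln, of 0 m] by (simp add: m harm_expand)
qed

lemma cycle_moment_le_ln: "\<exists>K\<ge>0. \<forall>n\<ge>3. cycle_moment m n \<le> K * ln (real n) ^ m"
proof -
  obtain K where K: "0 \<le> K" "\<And>n. cycle_moment m n \<le> K * (1 + harm n) ^ m"
    using cycle_moment_le[of m] by auto
  \<comment> \<open>From n = 3 on \<open>ln n\<close> is at least 1, so 1 + harm n is at most 2 + ln
    n, hence at most 3 ln n.\<close>
  have "cycle_moment m n \<le> (K * 3 ^ m) * ln (real n) ^ m" if "3 \<le> n" for n
  proof -
    have "1 \<le> ln (real n)"
    proof -
      have "exp 1 \<le> real n" using exp_le that by linarith
      then show ?thesis using that by (subst ln_ge_iff) auto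
    qed
    then have "1 + harm n \<le> 3 * ln (real n)" using harm_le_ln[of n] that by simp
    then have "(1 + harm n) ^ m \<le> (3 * ln (real n)) ^ m"
      using harm_nonneg[of n, where 'a = real] by (intro power_mono) auto
    then have "K * (1 + harm n) ^ m \<le> K * (3 * ln (real n)) ^ m" using K(1) by (rule mult_left_mono)
    then show ?thesis using K(2)[of n] by (simp add: power_mult_distrib mult.assoc)
  qed
  then show ?thesis using K(1) by (intro exI[of _ "K * 3 ^ m"]) auto
qed

lemma abs_poly_le_power:
  fixes p :: "real poly"
  shows "\<exists>K\<ge>0. \<forall>x\<ge>0. \<bar>poly p x\<bar> \<le> K * (1 + x) ^ degree p"
proof -
  define K where "K = (\<Sum>i\<le>degree p. \<bar>coeff p i\<bar>)"
  have "\<bar>poly p x\<bar> \<le> K * (1 + x) ^ degree p" if x: "0 \<le> x" for x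
  proof -
    have "\<bar>poly p x\<bar> \<le> (\<Sum>i\<le>degree p. \<bar>coeff p i * x ^ i\<bar>)"
      unfolding poly_altdef by (rule sum_abs)
    also have "\<dots> \<le> (\<Sum>i\<le>degree p. \<bar>coeff p i\<bar> * (1 + x) ^ degree p)"
    proof (rule sum_mono)
      fix i assume "i \<in> {..degree p}"
      then have "x ^ i \<le> (1 + x) ^ i" "(1 + x) ^ i \<le> (1 + x) ^ degree p"
        using x by (auto intro!: power_mono power_increasing)
      then show "\<bar>coeff p i * x ^ i\<bar> \<le> \<bar>coeff p i\<bar> * (1 + x) ^ degree p"
        using x by (auto simp: abs_mult intro!: mult_left_mono)
    qed
    finally show ?thesis by (simp add: K_def sum_distrib_right)
  qed
  moreover have "0 \<le> K" by (simp add: K_def sum_nonneg)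
  ultimately show ?thesis by blast
qed

section \<open>Expectations\<close>

lemma sum_permutes_eq_sum_Sym: "(\<Sum>p | p permutes {1..n}. f p) = (\<Sum>g\<in>Sym n. f (app g))"
  using sum.reindex_bij_betw[OF bij_app_Sym, of f n] by simp

lemma foldr_app: "foldr (\<circ>) (map app gs) id = app (sum_list gs)"
  by (induction gs) (simp_all add: app_zero app_plus)

lemma sum_sym_tuples: "(\<Sum>s\<in>sym_tuples n k. f s) = (\<Sum>gs\<in>tuples n k. f (map app gs))"
proof -
  have "bij_betw (map app) (tuples n k) (sym_tuples n k)"
  proof (rule bij_betwI[where g = "map Fperm"])
    have a: "app g \<in> carrier (sym_group n)" if "g \<in> Sym n" for g
      using that by (simp add: Sym_def sym_group_def)
    have b: "Fperm f \<in> Sym n \<and> app (Fperm f) = f" if "f \<in> carrier (sym_group n)" for f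
      using that permutes_permutation[of f n] by (simp add: Fperm_inverse Sym_def sym_group_def)
    show "map app \<in> tuples n k \<rightarrow> sym_tuples n k"
    proof
      fix gs assume "gs \<in> tuples n k"
      then have gs: "length gs = k" "set gs \<subseteq> Sym n" by (simp_all add: in_tuples_iff)
      have "set (map app gs) \<subseteq> carrier (sym_group n)" using gs(2) a unfolding set_map by blast
      then show "map app gs \<in> sym_tuples n k" using gs(1) by (simp add: sym_tuples_def)
    qed
    show "map Fperm \<in> sym_tuples n k \<rightarrow> tuples n k"
    proof
      fix s assume "s \<in> sym_tuples n k"
      then have s: "length s = k" "set s \<subseteq> carrier (sym_group n)" by (simp_all add: sym_tuples_def)
      have "set (map Fperm s) \<subseteq> Sym n" using s(2) b unfolding set_map by blast
      then show "map Fperm s \<in> tuples n k" using s(1) by (simp add: in_tuples_iff)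
    qed
    show "map Fperm (map app gs) = gs" for gs
      by (simp add: app_inverse comp_def)
    show "map app (map Fperm s) = s" if "s \<in> sym_tuples n k" for s
    proof -
      have "map (app \<circ> Fperm) s = map id s"
      proof (intro map_cong refl)
        fix f assume "f \<in> set s"
        then have "f \<in> carrier (sym_group n)" using that unfolding sym_tuples_def by blast
        then show "(app \<circ> Fperm) f = id f" using b by simp
      qed
      then show ?thesis by simp
    qed
  qed
  then show ?thesis by (rule sum.reindex_bij_betw[symmetric])
qed

lemma card_tuples: "card (tuples n k) = fact n ^ k"
  by (induction k) (simp_all add: card_image inj_on_def card_cartesian_product card_Sym)

lemma expect_word_eq:
  "expect_word w p n k
    = (\<Sum>gs\<in>tuples n k. poly p (real (num_cycles n (w (map app gs))))) / fact n ^ k"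
proof -
  have "real (card (sym_tuples n k)) = (\<Sum>s\<in>sym_tuples n k. 1)" by simp
  also have "\<dots> = real (card (tuples n k))" by (simp only: sum_sym_tuples) simp
  finally show ?thesis
    unfolding expect_word_def
    by (simp add: integral_pmf_of_set[OF sym_tuples_nonempty finite_sym_tuples] sum_sym_tuples card_tuples of_nat_fact)
qed

lemma expect_sym_eq: "expect_sym p n = (\<Sum>g\<in>Sym n. poly p (real (num_cycles n (app g)))) / fact n"
proof -
  have c: "carrier (sym_group n) = {q. q permutes {1..n}}" by (simp add: sym_group_def)
  show ?thesis
    unfolding expect_sym_def integral_pmf_of_set[OF sym_group_carrier_nonempty finite_sym_group_carrier]
    unfolding c sum_permutes_eq_sum_Sym by (simp add: card_permutations[of _ n] of_nat_fact)
qed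

text \<open>1 + sign is the density of the uniform law on the alternating group; for n below 2 that
  group is everything and the factor 2 would be wrong.\<close>

lemma expect_alt_eq:
  assumes "2 \<le> n"
  shows "expect_alt p n
    = (\<Sum>g\<in>Sym n. poly p (real (num_cycles n (app g))) * (1 + real_of_int (sign (app g)))) / fact n"
proof -
  let ?h = "\<lambda>q. poly p (real (num_cycles n q))"
  have c: "carrier (alt_group n) = {q. q permutes {1..n} \<and> evenperm q}" by (simp add: alt_group_def)
  have "real (2 * card (carrier (alt_group n))) = fact n"
    using alt_group_card_carrier[OF assms] by (metis of_nat_fact)
  then have card: "real (card (carrier (alt_group n))) = fact n / 2" by simp
  have "(\<Sum>q\<in>carrier (alt_group n). ?h q) = (\<Sum>q | q permutes {1..n}. if evenperm q then ?h q else 0)"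
    unfolding c by (rule sum.mono_neutral_cong_left) (auto simp: finite_permutations)
  also have "\<dots> = (\<Sum>q | q permutes {1..n}. ?h q * (1 + real_of_int (sign q)) / 2)"
    by (rule sum.cong) (auto simp: sign_def)
  also have "\<dots> = (\<Sum>g\<in>Sym n. ?h (app g) * (1 + real_of_int (sign (app g))) / 2)"
    by (rule sum_permutes_eq_sum_Sym)
  finally have "(\<Sum>q\<in>carrier (alt_group n). ?h q)
      = (\<Sum>g\<in>Sym n. ?h (app g) * (1 + real_of_int (sign (app g)))) / 2"
    by (simp add: sum_divide_distrib)
  then show ?thesis
    unfolding expect_alt_def integral_pmf_of_set[OF alt_group_carrier_nonempty finite_alt_group_carrier] card
    by simp
qed

lemma map_inv_app: "map inv' (map app gs) = map app (map uminus gs)"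
  by (simp add: app_uminus comp_def)

lemma expect_word_a:
  assumes "k \<ge> 1"
  shows "expect_word word_a p n k = expect_sym p n"
proof -
  let ?h = "\<lambda>g. poly p (real (num_cycles n (app g)))"
  obtain j where j: "k = Suc j" using assms by (cases k) auto
  have "(\<Sum>gs\<in>tuples n k. ?h (sum_list gs)) = (\<Sum>x\<in>Sym n. \<Sum>gs\<in>tuples n j. ?h (x + sum_list gs))"
    by (simp add: j sum_tuples_Suc del: tuples.simps)
  also have "\<dots> = (\<Sum>gs\<in>tuples n j. \<Sum>x\<in>Sym n. ?h (x + sum_list gs))"
    by (rule sum.swap)
  also have "\<dots> = (\<Sum>gs\<in>tuples n j. \<Sum>x\<in>Sym n. ?h x)"
    by (intro sum.cong refl sum_Sym_translate') (simp add: in_tuples_iff sum_list_in_Sym)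
  finally show ?thesis
    by (simp add: expect_word_eq word_a_def foldr_app expect_sym_eq card_tuples of_nat_fact j)
qed

lemma expect_word_b:
  assumes "k \<ge> 1"
  shows "expect_word word_b p n k = expect_sym p n"
proof -
  let ?h = "\<lambda>g. poly p (real (num_cycles n (app g)))"
  obtain j where j: "k = Suc j" using assms by (cases k) auto
  have "(\<Sum>gs\<in>tuples n k. ?h (sum_list (map uminus gs)))
      = (\<Sum>x\<in>Sym n. \<Sum>gs\<in>tuples n j. ?h (- x + sum_list (map uminus gs)))"
    by (simp add: j sum_tuples_Suc del: tuples.simps)
  also have "\<dots> = (\<Sum>gs\<in>tuples n j. \<Sum>x\<in>Sym n. ?h (- x + sum_list (map uminus gs)))"
    by (rule sum.swap)
  also have "\<dots> = (\<Sum>gs\<in>tuples n j. \<Sum>x\<in>Sym n. ?h x)"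
  proof (rule sum.cong[OF refl])
    fix gs assume "gs \<in> tuples n j"
    then have "set (map uminus gs) \<subseteq> Sym n" by (auto simp: in_tuples_iff)
    then have Y: "sum_list (map uminus gs) \<in> Sym n" by (rule sum_list_in_Sym)
    have "(\<Sum>x\<in>Sym n. ?h (- x + sum_list (map uminus gs))) = (\<Sum>x\<in>Sym n. ?h (x + sum_list (map uminus gs)))"
      by (rule sum_Sym_uminus)
    also have "\<dots> = (\<Sum>x\<in>Sym n. ?h x)" by (rule sum_Sym_translate'[OF Y])
    finally show "(\<Sum>x\<in>Sym n. ?h (- x + sum_list (map uminus gs))) = (\<Sum>x\<in>Sym n. ?h x)" .
  qed
  finally have "(\<Sum>gs\<in>tuples n k. ?h (sum_list (map uminus gs))) = (\<Sum>gs\<in>tuples n j. \<Sum>x\<in>Sym n. ?h x)" .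
  moreover have "word_b (map app gs) = app (sum_list (map uminus gs))" for gs
    unfolding word_b_def map_inv_app foldr_app ..
  ultimately show ?thesis
    by (simp add: expect_word_eq expect_sym_eq card_tuples of_nat_fact j del: tuples.simps)
qed

text \<open>What remains of the density of the word after removing the blocks of the trivial and the
  sign character, which together give the uniform distribution on the alternating group.\<close>
definition error_elem :: "nat \<Rightarrow> nat \<Rightarrow> galg" where
  "error_elem n g = (\<Sum>a\<in>nonlin n. (1 / deg n a ^ (2 * g)) *\<^sub>R idem a)"

lemma expect_word_c_minus_alt:
  assumes n: "2 \<le> n"
  shows "expect_word word_c p n k - expect_alt p n
    = (\<Sum>x\<in>Sym n. poly p (real (num_cycles n (app x))) * co (error_elem n (k div 2)) x)"
proof -
  let ?h = "\<lambda>g. poly p (real (num_cycles n (app g)))"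
  let ?g = "k div 2"
  have "word_c (map app gs) = app (comm_word gs)" for gs
    unfolding word_c_def map_inv_app map_append[symmetric] foldr_app comm_word_def by simp
  then have "expect_word word_c p n k = (\<Sum>gs\<in>tuples n k. ?h (comm_word gs)) / fact n ^ k"
    by (simp add: expect_word_eq)
  also have "\<dots> = (\<Sum>x\<in>Sym n. ?h x * co (\<Sum>gs\<in>tuples n k. de (comm_word gs)) x) / fact n ^ k"
    by (subst sum_comm_word_fun) simp
  also have "(\<Sum>gs\<in>tuples n k. de (comm_word gs)) = fact n ^ k *\<^sub>R (\<Sum>a\<in>syt n. (1 / deg n a ^ (2 * ?g)) *\<^sub>R idem a)"
  proof -
    have "(fact n :: real) ^ (k mod 2) * ((fact n)\<^sup>2 / (deg n a)\<^sup>2) ^ ?g = fact n ^ k * (1 / deg n a ^ (2 * ?g))" for a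
    proof -
      have "(fact n :: real) ^ (k mod 2) * fact n ^ (2 * ?g) = fact n ^ k"
        by (metis power_add mod_mult_div_eq)
      moreover have "((fact n)\<^sup>2 / (deg n a)\<^sup>2) ^ ?g = fact n ^ (2 * ?g) / deg n a ^ (2 * ?g)"
        by (simp add: power_divide flip: power_mult)
      ultimately show ?thesis by simp
    qed
    then show ?thesis
      unfolding sum_comm_word comm_sum_power_eq by (simp add: scaleR_sum_right)
  qed
  also have "(\<Sum>x\<in>Sym n. ?h x * co (fact n ^ k *\<^sub>R (\<Sum>a\<in>syt n. (1 / deg n a ^ (2 * ?g)) *\<^sub>R idem a)) x) / fact n ^ k
      = (\<Sum>x\<in>Sym n. ?h x * co (\<Sum>a\<in>syt n. (1 / deg n a ^ (2 * ?g)) *\<^sub>R idem a) x)"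
    by (simp add: sum_distrib_left[symmetric] mult.left_commute)
  also have "(\<Sum>a\<in>syt n. (1 / deg n a ^ (2 * ?g)) *\<^sub>R idem a) = chi_idem n 1 + chi_idem n (-1) + error_elem n ?g"
  proof -
    \<comment> \<open>From n = 2 on the row and the column are different tableaux, so the trivial
      and the sign block split off separately.\<close>
    obtain m where m: "n = Suc (Suc m)" using n by (metis Suc_le_D numeral_2_eq_2 Suc_le_mono)
    then have ne: "line 1 n \<noteq> line (-1) n" by simp
    have "(\<Sum>a\<in>syt n. (1 / deg n a ^ (2 * ?g)) *\<^sub>R idem a)
        = error_elem n ?g + (\<Sum>a\<in>{line 1 n, line (-1) n}. (1 / deg n a ^ (2 * ?g)) *\<^sub>R idem a)"
      unfolding error_elem_def nonlin_def
      using line_in_syt[of 1 n] line_in_syt[of "-1" n] by (intro sum.subset_diff) auto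
    then show ?thesis using ne by (simp add: deg_line idem_line del: idem.simps line.simps)
  qed
  also have "(\<Sum>x\<in>Sym n. ?h x * co (chi_idem n 1 + chi_idem n (-1) + error_elem n ?g) x)
      = (\<Sum>x\<in>Sym n. ?h x * (1 + real_of_int (sign (app x)))) / fact n
       + (\<Sum>x\<in>Sym n. ?h x * co (error_elem n ?g) x)"
    unfolding sum_divide_distrib sum.distrib[symmetric]
    by (intro sum.cong refl) (simp add: lookup_add co_chi_idem chi_def field_simps)
  finally show ?thesis by (simp add: expect_alt_eq[OF n])
qed

text \<open>Orthogonality leaves one trace per tableau, and this trace, deg / n!, lowers the
  exponent 4g to 4g - 1.\<close>

lemma sum_square_error_elem:
  assumes "1 \<le> g"
  shows "(\<Sum>x\<in>Sym n. (co (error_elem n g) x)\<^sup>2) = (\<Sum>a\<in>nonlin n. 1 / deg n a ^ (4 * g - 1)) / fact n"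
proof -
  have syt: "a \<in> syt n" if "a \<in> nonlin n" for a using that by (simp add: nonlin_def)
  have fin: "finite (nonlin n)" by (simp add: nonlin_def)
  let ?e = "error_elem n g" and ?c = "\<lambda>a. 1 / deg n a ^ (2 * g)"
  have in_Alg: "?e \<in> Alg n" unfolding error_elem_def by (intro Alg_sum Alg_scale idem_props(1) syt)
  have "star ?e = ?e"
    unfolding error_elem_def star_sum star_scale by (intro sum.cong refl) (simp add: idem_props(2)[OF syt])
  then have "(\<Sum>x\<in>Sym n. (co ?e x)\<^sup>2) = tau (?e * ?e)" using tau_star_self[OF in_Alg] by simp
  also have "?e * ?e = (\<Sum>a\<in>nonlin n. \<Sum>b\<in>nonlin n. if b = a then (?c a * ?c a) *\<^sub>R idem a else 0)"
    unfolding error_elem_def sum_product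
    by (intro sum.cong refl) (auto simp: idem_props(4)[OF syt] idem_props(5)[OF syt syt])
  also have "\<dots> = (\<Sum>a\<in>nonlin n. (?c a * ?c a) *\<^sub>R idem a)" using fin by simp
  also have "tau \<dots> = (\<Sum>a\<in>nonlin n. 1 / deg n a ^ (4 * g - 1) / fact n)"
    unfolding tau_sum
  proof (intro sum.cong refl)
    fix a assume a: "a \<in> nonlin n"
    have d: "deg n a > 0" by (rule deg_pos[OF syt[OF a]])
    have "2 * g + 2 * g = Suc (4 * g - 1)" using assms by simp
    then have "?c a * ?c a = 1 / deg n a ^ Suc (4 * g - 1)" by (simp flip: power_add)
    then have "tau ((?c a * ?c a) *\<^sub>R idem a) = 1 / deg n a ^ Suc (4 * g - 1) * tau (idem a)"
      by (simp only: tau_scale)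
    also have "tau (idem a) = deg n a / fact n" by (simp add: deg_def)
    finally show "tau ((?c a * ?c a) *\<^sub>R idem a) = 1 / deg n a ^ (4 * g - 1) / fact n"
      using d by simp
  qed
  finally show ?thesis by (simp add: sum_divide_distrib)
qed

lemma expect_word_c_bigo:
  fixes p :: "real poly"
  assumes k: "2 \<le> k"
  shows "(\<lambda>n. expect_word word_c p n k - expect_alt p n)
    \<in> O(\<lambda>n. ln (real n) ^ degree p / real n ^ (2 * (k div 2) - 1))"
proof -
  define g where "g = k div 2"
  have g: "1 \<le> g" using k by (simp add: g_def)
  let ?l = "degree p" and ?m = "2 * g - 1"
  obtain K where K: "0 \<le> K" "\<And>x. 0 \<le> x \<Longrightarrow> \<bar>poly p x\<bar> \<le> K * (1 + x) ^ ?l"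
    using abs_poly_le_power[of p] by auto
  obtain B where B: "0 \<le> B" "\<And>n. 3 \<le> n \<Longrightarrow> cycle_moment (2 * ?l) n \<le> B * ln (real n) ^ (2 * ?l)"
    using cycle_moment_le_ln[of "2 * ?l"] by auto
  obtain C where C: "0 < C" "\<And>n. 20 \<le> n \<Longrightarrow> zsum n \<le> C / real n ^ 2"
    using zsum_bound by auto
  have "\<bar>expect_word word_c p n k - expect_alt p n\<bar>
      \<le> (K * sqrt B * sqrt ((2 * C) ^ ?m)) * \<bar>ln (real n) ^ ?l / real n ^ ?m\<bar>" if n: "20 \<le> n" for n
  proof -
    let ?h = "\<lambda>g. poly p (real (num_cycles n (app g)))"
    have z: "0 \<le> zsum n" unfolding zsum_def by (auto intro!: sum_nonneg simp: wt_def)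
    have "(\<Sum>x\<in>Sym n. (?h x)\<^sup>2) \<le> (\<Sum>x\<in>Sym n. K\<^sup>2 * (1 + real (num_cycles n (app x))) ^ (2 * ?l))"
    proof (rule sum_mono)
      fix x
      have "\<bar>?h x\<bar>\<^sup>2 \<le> (K * (1 + real (num_cycles n (app x))) ^ ?l)\<^sup>2"
        by (intro power_mono K) auto
      then show "(?h x)\<^sup>2 \<le> K\<^sup>2 * (1 + real (num_cycles n (app x))) ^ (2 * ?l)"
        by (simp add: power_mult_distrib power_mult[symmetric] mult.commute)
    qed
    also have "\<dots> = K\<^sup>2 * (fact n * cycle_moment (2 * ?l) n)"
      unfolding cycle_moment_def sum_permutes_eq_sum_Sym by (simp flip: sum_distrib_left)
    also have "\<dots> \<le> K\<^sup>2 * (fact n * (B * ln (real n) ^ (2 * ?l)))"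
      using B(2)[of n] n by (intro mult_left_mono) auto
    finally have 1: "(\<Sum>x\<in>Sym n. (?h x)\<^sup>2) \<le> K\<^sup>2 * (fact n * (B * ln (real n) ^ (2 * ?l)))" .
    have "(\<Sum>a\<in>nonlin n. 1 / deg n a ^ (4 * g - 1)) \<le> (2 * zsum n) ^ ?m"
      by (rule sum_inverse_deg_power_le[OF g])
    also have "\<dots> \<le> (2 * C / real n ^ 2) ^ ?m"
      using C(2)[OF n] z by (intro power_mono) auto
    finally have 2: "(\<Sum>x\<in>Sym n. (co (error_elem n g) x)\<^sup>2) \<le> (2 * C / real n ^ 2) ^ ?m / fact n"
      unfolding sum_square_error_elem[OF g] by (intro divide_right_mono) auto
    have "(expect_word word_c p n k - expect_alt p n)\<^sup>2
        \<le> (\<Sum>x\<in>Sym n. (?h x)\<^sup>2) * (\<Sum>x\<in>Sym n. (co (error_elem n g) x)\<^sup>2)"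
      using expect_word_c_minus_alt[of n p k] n Cauchy_Schwarz_ineq_sum[of ?h "co (error_elem n g)" "Sym n"]
      by (simp add: g_def)
    also have "\<dots> \<le> (K\<^sup>2 * (fact n * (B * ln (real n) ^ (2 * ?l)))) * ((2 * C / real n ^ 2) ^ ?m / fact n)"
      using n B(1) by (intro mult_mono 1 2) (auto intro!: sum_nonneg mult_nonneg_nonneg)
    \<comment> \<open>The n! of the moment cancels the 1 / n! of the error element, and
      (n^-2)^(2g-1) is the square of the claimed rate.\<close>
    also have "\<dots> = (K\<^sup>2 * B * (2 * C) ^ ?m) * (ln (real n) ^ ?l / real n ^ ?m)\<^sup>2"
      by (simp add: power_divide power_mult[symmetric] mult.commute[of _ 2])
    also have "\<dots> = (K * sqrt B * sqrt ((2 * C) ^ ?m) * \<bar>ln (real n) ^ ?l / real n ^ ?m\<bar>)\<^sup>2"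
    proof -
      have "K\<^sup>2 * B * X * y\<^sup>2 = (K * sqrt B * sqrt X * \<bar>y\<bar>)\<^sup>2" if "0 \<le> X" for X y
        using B(1) that by (simp add: power_mult_distrib)
      then show ?thesis using C(1) by simp
    qed
    finally have "\<bar>expect_word word_c p n k - expect_alt p n\<bar>\<^sup>2
        \<le> (K * sqrt B * sqrt ((2 * C) ^ ?m) * \<bar>ln (real n) ^ ?l / real n ^ ?m\<bar>)\<^sup>2" by simp
    then show ?thesis
      by (rule power2_le_imp_le) (use K(1) B(1) C(1) in auto)
  qed
  then show ?thesis
    unfolding g_def[symmetric]
    by (intro bigoI[where c = "K * sqrt B * sqrt ((2 * C) ^ ?m)"])
       (auto simp: eventually_at_top_linorder simp del: abs_divide intro!: exI[of _ 20])
qed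

theorem theorem4p8:
  fixes p :: "real poly" and l k :: nat
  assumes "degree p = l"
    and "\<And>x. 0 \<le> x \<Longrightarrow> 0 \<le> poly p x"
    and "mono_on {0..} (poly p)"
    and "k \<ge> 2"
  shows "(even k \<longrightarrow>
            (\<lambda>n. expect_word word_c p n k - expect_alt p n)
              \<in> O(\<lambda>n. ln (real n) ^ l / real n ^ (k - 1)))
       \<and> (odd k \<longrightarrow>
            (\<lambda>n. expect_word word_c p n k - expect_alt p n)
              \<in> O(\<lambda>n. ln (real n) ^ l / real n ^ (k - 2)))
       \<and> (\<forall>n\<ge>1. expect_word word_a p n k = expect_sym p n)
       \<and> (\<forall>n\<ge>1. expect_word word_b p n k = expect_sym p n)"
proof -
  have "2 * (k div 2) - 1 = (if even k then k - 1 else k - 2)"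
    by (auto elim!: evenE oddE)
  then show ?thesis
    using expect_word_c_bigo[OF assms(4), of p] expect_word_a[of k p] expect_word_b[of k p] assms(1,4)
    by auto
qed

end
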